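(* Over $\mathsf{RCA}_0$ the following five statements are pairwise equivalent: (1) $\mathrm{WPO}(\mathcal{D})$; (2) there is no infinite ascending sequence of closed sets of diagrams; (3) there is no infinite ascending sequence of finitely generated closed sets of diagrams; (4) every closed set of diagrams is finitely generated; (5) every closed sequence of diagrams is finitely generated.
   Context: $\mathbb{N}$ denotes the positive integers; $\mathsf{RCA}_0$ is the standard base system of second-order arithmetic. A diagram (Young diagram) is a partition $m_1\ge\cdots\ge m_k>0$ with $k>0$; $\mathcal{D}$ is the set of diagrams; $r_i(D)$ is the length of the $i$th row (0 if none), $c_i(D)$ the length of the $i$th column. $D\le E$ means $r_i(D)\le r_i(E)$ for all $i$; $D<E$ means $D\le E$, $D\ne E$. $\mathrm{WPO}(\mathcal{D})$ states that for every infinite sequence $\langle D_i\rangle_{i\in\mathbb{N}}$ of diagrams there are $i<j$ with $D_i\le D_j$. $D\cup E$ has rows $\max(r_i(D),r_i(E))$; $\mathrm{ucl}(\mathcal{T})=\{E:\exists D\in\mathcal{T},\ D\le E\}$; $(D)_r$ has $r_1=\max(r_2(D),1)$ and other rows as in $D$; $(D)_c$ has $c_1=\max(c_2(D),1)$ and other columns as in $D$. A set $\mathcal{U}$ of diagrams is closed if for every $D$: $D\in\mathcal{U}\iff\forall E\,(E>D\Rightarrow E\in\mathcal{U})$. For finite $\mathcal{S}$, $\mathrm{cl}(\mathcal{S})=\mathrm{ucl}(\{(D)_r\cup(E)_c:D,E\in\mathcal{S}\})$, the smallest closed set containing $\mathcal{S}$; a closed set is finitely generated if it equals $\mathrm{cl}(\mathcal{S})$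 for some finite $\mathcal{S}$. A sequence $\langle D_i\rangle_{i\in\mathbb{N}}$ is closed if for all $D$: $(\exists i\,D=D_i)\iff\forall E\,(E>D\Rightarrow\exists j\,E=D_j)$, and finitely generated if its range equals $\mathrm{cl}(\mathcal{S})$ for some finite $\mathcal{S}$. An infinite ascending sequence of sets is $\langle\mathcal{U}_i\rangle_{i\in\mathbb{N}}$ with $\mathcal{U}_i\subsetneq\mathcal{U}_j$ for $i<j$. *)

theory Defs
  imports Main
begin

section \<open>The language of second-order arithmetic\<close>

text \<open>
  De Bruijn indices, with separate index spaces for number variables and set variables:
  \<open>Forall\<close> binds number variable 0 and \<open>ForallS\<close> binds set variable 0. The only terms of sort
  set are the set variables, and (as usual) equality is primitive between numbers only.
\<close>

datatype tm = Var nat | Zero | One | Add tm tm | Mul tm tm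

datatype fm =
    Eq tm tm
  | Less tm tm
  | Mem tm nat
  | Bot
  | Imp fm fm
  | Forall fm
  | ForallS fm

definition Neg :: "fm \<Rightarrow> fm" where "Neg A = Imp A Bot"
definition Conj :: "fm \<Rightarrow> fm \<Rightarrow> fm" where "Conj A B = Neg (Imp A (Neg B))"
definition Disj :: "fm \<Rightarrow> fm \<Rightarrow> fm" where "Disj A B = Imp (Neg A) B"
definition Iff :: "fm \<Rightarrow> fm \<Rightarrow> fm" where "Iff A B = Conj (Imp A B) (Imp B A)"
definition Exists :: "fm \<Rightarrow> fm" where "Exists A = Neg (Forall (Neg A))"
definition ExistsS :: "fm \<Rightarrow> fm" where "ExistsS A = Neg (ForallS (Neg A))"

primrec subst_tm :: "(nat \<Rightarrow> tm) \<Rightarrow> tm \<Rightarrow> tm" where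
  "subst_tm \<sigma> (Var n) = \<sigma> n"
| "subst_tm \<sigma> Zero = Zero"
| "subst_tm \<sigma> One = One"
| "subst_tm \<sigma> (Add s t) = Add (subst_tm \<sigma> s) (subst_tm \<sigma> t)"
| "subst_tm \<sigma> (Mul s t) = Mul (subst_tm \<sigma> s) (subst_tm \<sigma> t)"

definition lift_tm :: "tm \<Rightarrow> tm" where
  "lift_tm = subst_tm (\<lambda>n. Var (Suc n))"

text \<open>Simultaneous substitution of \<open>\<sigma>\<close> for the number variables and of \<open>\<rho>\<close> for the set variables.\<close>

primrec subst :: "(nat \<Rightarrow> tm) \<Rightarrow> (nat \<Rightarrow> nat) \<Rightarrow> fm \<Rightarrow> fm" where
  "subst \<sigma> \<rho> (Eq s t) = Eq (subst_tm \<sigma> s) (subst_tm \<sigma> t)"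
| "subst \<sigma> \<rho> (Less s t) = Less (subst_tm \<sigma> s) (subst_tm \<sigma> t)"
| "subst \<sigma> \<rho> (Mem t k) = Mem (subst_tm \<sigma> t) (\<rho> k)"
| "subst \<sigma> \<rho> Bot = Bot"
| "subst \<sigma> \<rho> (Imp A B) = Imp (subst \<sigma> \<rho> A) (subst \<sigma> \<rho> B)"
| "subst \<sigma> \<rho> (Forall A) = Forall (subst (case_nat (Var 0) (\<lambda>n. lift_tm (\<sigma> n))) \<rho> A)"
| "subst \<sigma> \<rho> (ForallS A) = ForallS (subst \<sigma> (case_nat 0 (\<lambda>n. Suc (\<rho> n))) A)"

definition lift :: "fm \<Rightarrow> fm" where "lift = subst (\<lambda>n. Var (Suc n)) id"
definition liftS :: "fm \<Rightarrow> fm" where "liftS = subst Var Suc"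
definition inst :: "tm \<Rightarrow> fm \<Rightarrow> fm" where "inst t = subst (case_nat t Var) id"
definition instS :: "nat \<Rightarrow> fm \<Rightarrow> fm" where "instS k = subst Var (case_nat k id)"


section \<open>Provability\<close>

text \<open>
  A Hilbert-style calculus for classical two-sorted first-order logic with equality.
  Because of the generalization rules, an axiom with free variables has the same
  force as its universal closure.
\<close>

inductive provable :: "fm set \<Rightarrow> fm \<Rightarrow> bool" (infix "\<turnstile>" 45) for T :: "fm set" where
  Ax: "A \<in> T \<Longrightarrow> T \<turnstile> A"
| MP: "T \<turnstile> Imp A B \<Longrightarrow> T \<turnstile> A \<Longrightarrow> T \<turnstile> B"
| Gen: "T \<turnstile> A \<Longrightarrow> T \<turnstile> Forall A"
| GenS: "T \<turnstile> A \<Longrightarrow> T \<turnstile> ForallS A"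
| K: "T \<turnstile> Imp A (Imp B A)"
| S: "T \<turnstile> Imp (Imp A (Imp B C)) (Imp (Imp A B) (Imp A C))"
| DNE: "T \<turnstile> Imp (Neg (Neg A)) A"
| Inst: "T \<turnstile> Imp (Forall A) (inst t A)"
| InstS: "T \<turnstile> Imp (ForallS A) (instS k A)"
| Distr: "T \<turnstile> Imp (Forall (Imp (lift A) B)) (Imp A (Forall B))"
| DistrS: "T \<turnstile> Imp (ForallS (Imp (liftS A) B)) (Imp A (ForallS B))"
| Refl: "T \<turnstile> Eq t t"
| Leibniz: "T \<turnstile> Imp (Eq s t) (Imp (inst s A) (inst t A))"


section \<open>Writing formulas with named bound variables\<close>

text \<open>
  To avoid writing de Bruijn indices by hand, a formula is represented as a function of the
  numbers \<open>d\<close> and \<open>e\<close> of number and set quantifiers in whose scope it occurs. A variable bound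
  at depth \<open>d\<close> has index \<open>d' - Suc d\<close> when it is used at depth \<open>d'\<close>, so the bound variables can
  be ordinary HOL variables. Setting both depths to 0 yields a closed formula.
\<close>

type_synonym ntm = "nat \<Rightarrow> tm"
type_synonym nset = "nat \<Rightarrow> nat"
type_synonym nfm = "nat \<Rightarrow> nat \<Rightarrow> fm"

definition sentence :: "nfm \<Rightarrow> fm" where "sentence P = P 0 0"

definition nAll :: "(ntm \<Rightarrow> nfm) \<Rightarrow> nfm" (binder "\<^bold>\<forall>" 10) where
  "nAll P = (\<lambda>d e. Forall (P (\<lambda>d'. Var (d' - Suc d)) (Suc d) e))"
definition nEx :: "(ntm \<Rightarrow> nfm) \<Rightarrow> nfm" (binder "\<^bold>\<exists>" 10) where
  "nEx P = (\<lambda>d e. Exists (P (\<lambda>d'. Var (d' - Suc d)) (Suc d) e))"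
definition nAllS :: "(nset \<Rightarrow> nfm) \<Rightarrow> nfm" (binder "\<^bold>\<forall>\<^sub>S" 10) where
  "nAllS P = (\<lambda>d e. ForallS (P (\<lambda>e'. e' - Suc e) d (Suc e)))"
definition nExS :: "(nset \<Rightarrow> nfm) \<Rightarrow> nfm" (binder "\<^bold>\<exists>\<^sub>S" 10) where
  "nExS P = (\<lambda>d e. ExistsS (P (\<lambda>e'. e' - Suc e) d (Suc e)))"

definition nImp :: "nfm \<Rightarrow> nfm \<Rightarrow> nfm" (infixr "\<^bold>\<longrightarrow>" 25) where
  "(P \<^bold>\<longrightarrow> Q) = (\<lambda>d e. Imp (P d e) (Q d e))"
definition nIff :: "nfm \<Rightarrow> nfm \<Rightarrow> nfm" (infixr "\<^bold>\<longleftrightarrow>" 25) where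
  "(P \<^bold>\<longleftrightarrow> Q) = (\<lambda>d e. Iff (P d e) (Q d e))"
definition nDisj :: "nfm \<Rightarrow> nfm \<Rightarrow> nfm" (infixr "\<^bold>\<or>" 30) where
  "(P \<^bold>\<or> Q) = (\<lambda>d e. Disj (P d e) (Q d e))"
definition nConj :: "nfm \<Rightarrow> nfm \<Rightarrow> nfm" (infixr "\<^bold>\<and>" 35) where
  "(P \<^bold>\<and> Q) = (\<lambda>d e. Conj (P d e) (Q d e))"
definition nNeg :: "nfm \<Rightarrow> nfm" ("\<^bold>\<not> _" [40] 40) where
  "(\<^bold>\<not> P) = (\<lambda>d e. Neg (P d e))"

definition nEq :: "ntm \<Rightarrow> ntm \<Rightarrow> nfm" (infix "\<^bold>=" 50) where
  "(s \<^bold>= t) = (\<lambda>d e. Eq (s d) (t d))"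
definition nLess :: "ntm \<Rightarrow> ntm \<Rightarrow> nfm" (infix "\<^bold><" 50) where
  "(s \<^bold>< t) = (\<lambda>d e. Less (s d) (t d))"
definition nMem :: "ntm \<Rightarrow> nset \<Rightarrow> nfm" (infix "\<^bold>\<in>" 50) where
  "(t \<^bold>\<in> X) = (\<lambda>d e. Mem (t d) (X e))"
definition nLe :: "ntm \<Rightarrow> ntm \<Rightarrow> nfm" (infix "\<^bold>\<le>" 50) where
  "(s \<^bold>\<le> t) = (s \<^bold>< t \<^bold>\<or> s \<^bold>= t)"

definition nZero :: ntm ("\<^bold>0") where "\<^bold>0 = (\<lambda>d. Zero)"
definition nOne :: ntm ("\<^bold>1") where "\<^bold>1 = (\<lambda>d. One)"
definition nAdd :: "ntm \<Rightarrow> ntm \<Rightarrow> ntm" (infixl "\<^bold>+" 65) where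
  "s \<^bold>+ t = (\<lambda>d. Add (s d) (t d))"
definition nMul :: "ntm \<Rightarrow> ntm \<Rightarrow> ntm" (infixl "\<^bold>*" 70) where
  "s \<^bold>* t = (\<lambda>d. Mul (s d) (t d))"


section \<open>The system RCA0\<close>

definition basic_axioms :: "fm set" where
  "basic_axioms = sentence ` {
     \<^bold>\<forall>n. \<^bold>\<not> (n \<^bold>+ \<^bold>1 \<^bold>= \<^bold>0),
     \<^bold>\<forall>m. \<^bold>\<forall>n. m \<^bold>+ \<^bold>1 \<^bold>= n \<^bold>+ \<^bold>1 \<^bold>\<longrightarrow> m \<^bold>= n,
     \<^bold>\<forall>m. m \<^bold>+ \<^bold>0 \<^bold>= m,
     \<^bold>\<forall>m. \<^bold>\<forall>n. m \<^bold>+ (n \<^bold>+ \<^bold>1) \<^bold>= (m \<^bold>+ n) \<^bold>+ \<^bold>1,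
     \<^bold>\<forall>m. m \<^bold>* \<^bold>0 \<^bold>= \<^bold>0,
     \<^bold>\<forall>m. \<^bold>\<forall>n. m \<^bold>* (n \<^bold>+ \<^bold>1) \<^bold>= (m \<^bold>* n) \<^bold>+ m,
     \<^bold>\<forall>m. \<^bold>\<not> (m \<^bold>< \<^bold>0),
     \<^bold>\<forall>m. \<^bold>\<forall>n. m \<^bold>< n \<^bold>+ \<^bold>1 \<^bold>\<longleftrightarrow> (m \<^bold>< n \<^bold>\<or> m \<^bold>= n)}"

inductive_set Sigma00 :: "fm set" where
  "Eq s t \<in> Sigma00"
| "Less s t \<in> Sigma00"
| "Mem t k \<in> Sigma00"
| "Bot \<in> Sigma00"
| "A \<in> Sigma00 \<Longrightarrow> B \<in> Sigma00 \<Longrightarrow> Imp A B \<in> Sigma00"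
| "A \<in> Sigma00 \<Longrightarrow> Forall (Imp (Less (Var 0) (lift_tm t)) A) \<in> Sigma00"
| "A \<in> Sigma00 \<Longrightarrow> Exists (Conj (Less (Var 0) (lift_tm t)) A) \<in> Sigma00"

definition Sigma01 :: "fm set" where "Sigma01 = Exists ` Sigma00"
definition Pi01 :: "fm set" where "Pi01 = Forall ` Sigma00"

text \<open>In the schemes the formulas may contain parameters of both sorts; the distinguished
  number variable \<open>n\<close> is \<open>Var 0\<close>, and \<open>succ_inst A\<close> is \<open>A(n + 1)\<close>, again with \<open>n\<close> as \<open>Var 0\<close>.\<close>

definition succ_inst :: "fm \<Rightarrow> fm" where
  "succ_inst = subst (case_nat (Add (Var 0) One) (\<lambda>n. Var (Suc n))) id"

definition Sigma01_induction :: "fm set" where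
  "Sigma01_induction =
     {Imp (Conj (inst Zero A) (Forall (Imp A (succ_inst A)))) (Forall A) | A. A \<in> Sigma01}"

definition Delta01_comprehension :: "fm set" where
  "Delta01_comprehension =
     {Imp (Forall (Iff A B)) (ExistsS (Forall (Iff (Mem (Var 0) 0) (liftS A)))) | A B.
        A \<in> Sigma01 \<and> B \<in> Pi01}"

definition RCA0 :: "fm set" where
  "RCA0 = basic_axioms \<union> Sigma01_induction \<union> Delta01_comprehension"


section \<open>Pairs and finite sets of numbers\<close>

definition pair :: "ntm \<Rightarrow> ntm \<Rightarrow> ntm" where
  "pair i j = (i \<^bold>+ j) \<^bold>* (i \<^bold>+ j) \<^bold>+ i"

text \<open>
  The usual coding of finite sets in RCA0: \<open>(k, (m, n))\<close> represents the set of all \<open>i < k\<close> such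
  that \<open>m(i + 1) + 1\<close> divides \<open>n\<close>, and the code of a finite set is the least number that
  represents it. Codes are unique, so equality of coded objects is equality of numbers.
\<close>

definition represents :: "ntm \<Rightarrow> nfm" where
  "represents x = (\<^bold>\<exists>k. \<^bold>\<exists>m. \<^bold>\<exists>n. x \<^bold>= pair k (pair m n))"

definition elt :: "ntm \<Rightarrow> ntm \<Rightarrow> nfm" where
  "elt i x = (\<^bold>\<exists>k. \<^bold>\<exists>m. \<^bold>\<exists>n. x \<^bold>= pair k (pair m n) \<^bold>\<and> i \<^bold>< k \<^bold>\<and>
                (\<^bold>\<exists>q. n \<^bold>= (m \<^bold>* (i \<^bold>+ \<^bold>1) \<^bold>+ \<^bold>1) \<^bold>* q))"

definition finset_code :: "ntm \<Rightarrow> nfm" where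
  "finset_code x = (represents x \<^bold>\<and>
     (\<^bold>\<forall>y. y \<^bold>< x \<^bold>\<and> represents y \<^bold>\<longrightarrow> \<^bold>\<not> (\<^bold>\<forall>i. elt i y \<^bold>\<longleftrightarrow> elt i x)))"


section \<open>Diagrams\<close>

text \<open>
  Rows, columns and sequences are indexed by the positive numbers. A diagram is (the code of) a
  finite sequence \<open>m\<^sub>1 \<ge> \<dots> \<ge> m\<^sub>k > 0\<close> with \<open>k > 0\<close>, i.e. the finite set of the pairs \<open>(i, m\<^sub>i)\<close>.
\<close>

definition diagram :: "ntm \<Rightarrow> nfm" where
  "diagram D = (finset_code D \<^bold>\<and>
     (\<^bold>\<exists>k. \<^bold>0 \<^bold>< k \<^bold>\<and>
        (\<^bold>\<forall>p. elt p D \<^bold>\<longrightarrow> (\<^bold>\<exists>i. \<^bold>\<exists>r. p \<^bold>= pair i r \<^bold>\<and> \<^bold>0 \<^bold>< i \<^bold>\<and> i \<^bold>\<le> k \<^bold>\<and> \<^bold>0 \<^bold>< r)) \<^bold>\<and>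
        (\<^bold>\<forall>i. \<^bold>0 \<^bold>< i \<^bold>\<and> i \<^bold>\<le> k \<^bold>\<longrightarrow> (\<^bold>\<exists>r. elt (pair i r) D))) \<^bold>\<and>
     (\<^bold>\<forall>i. \<^bold>\<forall>r. \<^bold>\<forall>s. elt (pair i r) D \<^bold>\<and> elt (pair i s) D \<^bold>\<longrightarrow> r \<^bold>= s) \<^bold>\<and>
     (\<^bold>\<forall>i. \<^bold>\<forall>j. \<^bold>\<forall>r. \<^bold>\<forall>s. i \<^bold>< j \<^bold>\<and> elt (pair i r) D \<^bold>\<and> elt (pair j s) D \<^bold>\<longrightarrow> s \<^bold>\<le> r))"

text \<open>\<open>row D i r\<close> and \<open>col D j c\<close> say that \<open>r = r\<^sub>i(D)\<close> and \<open>c = c\<^sub>j(D)\<close>, for \<open>i, j > 0\<close>. Since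
  row lengths decrease, the rows meeting column \<open>j\<close> are exactly the first \<open>c\<^sub>j(D)\<close> rows.\<close>

definition row :: "ntm \<Rightarrow> ntm \<Rightarrow> ntm \<Rightarrow> nfm" where
  "row D i r = (elt (pair i r) D \<^bold>\<or> (r \<^bold>= \<^bold>0 \<^bold>\<and> \<^bold>\<not> (\<^bold>\<exists>s. elt (pair i s) D)))"

definition col :: "ntm \<Rightarrow> ntm \<Rightarrow> ntm \<Rightarrow> nfm" where
  "col D j c = (\<^bold>\<forall>i. \<^bold>0 \<^bold>< i \<^bold>\<longrightarrow> (i \<^bold>\<le> c \<^bold>\<longleftrightarrow> (\<^bold>\<exists>r. row D i r \<^bold>\<and> j \<^bold>\<le> r)))"

definition dle :: "ntm \<Rightarrow> ntm \<Rightarrow> nfm" where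
  "dle D E = (\<^bold>\<forall>i. \<^bold>\<forall>r. \<^bold>\<forall>s. \<^bold>0 \<^bold>< i \<^bold>\<and> row D i r \<^bold>\<and> row E i s \<^bold>\<longrightarrow> r \<^bold>\<le> s)"

definition dless :: "ntm \<Rightarrow> ntm \<Rightarrow> nfm" where
  "dless D E = (dle D E \<^bold>\<and> \<^bold>\<not> (D \<^bold>= E))"

definition is_max :: "ntm \<Rightarrow> ntm \<Rightarrow> ntm \<Rightarrow> nfm" where
  "is_max r s t = ((r \<^bold>\<le> s \<^bold>\<and> t \<^bold>= s) \<^bold>\<or> (s \<^bold>\<le> r \<^bold>\<and> t \<^bold>= r))"

text \<open>The operations \<open>D \<union> E\<close>, \<open>(D)\<^sub>r\<close> and \<open>(D)\<^sub>c\<close>, as graphs: the last argument is the value.\<close>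

definition dunion :: "ntm \<Rightarrow> ntm \<Rightarrow> ntm \<Rightarrow> nfm" where
  "dunion D E F = (diagram F \<^bold>\<and>
     (\<^bold>\<forall>i. \<^bold>\<forall>r. \<^bold>\<forall>s. \<^bold>\<forall>t. \<^bold>0 \<^bold>< i \<^bold>\<and> row D i r \<^bold>\<and> row E i s \<^bold>\<and> row F i t \<^bold>\<longrightarrow> is_max r s t))"

definition drow :: "ntm \<Rightarrow> ntm \<Rightarrow> nfm" where
  "drow D F = (diagram F \<^bold>\<and>
     (\<^bold>\<forall>r. \<^bold>\<forall>t. row D (\<^bold>1 \<^bold>+ \<^bold>1) r \<^bold>\<and> row F \<^bold>1 t \<^bold>\<longrightarrow> is_max r \<^bold>1 t) \<^bold>\<and>
     (\<^bold>\<forall>i. \<^bold>\<forall>r. \<^bold>1 \<^bold>< i \<^bold>\<longrightarrow> (row F i r \<^bold>\<longleftrightarrow> row D i r)))"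

definition dcol :: "ntm \<Rightarrow> ntm \<Rightarrow> nfm" where
  "dcol D F = (diagram F \<^bold>\<and>
     (\<^bold>\<forall>c. \<^bold>\<forall>t. col D (\<^bold>1 \<^bold>+ \<^bold>1) c \<^bold>\<and> col F \<^bold>1 t \<^bold>\<longrightarrow> is_max c \<^bold>1 t) \<^bold>\<and>
     (\<^bold>\<forall>j. \<^bold>\<forall>c. \<^bold>1 \<^bold>< j \<^bold>\<longrightarrow> (col F j c \<^bold>\<longleftrightarrow> col D j c)))"


section \<open>Closed sets\<close>

text \<open>
  A class is a formula with a distinguished number variable. The notions below are defined for
  classes because they are applied not only to sets, but also to the members \<open>\<U>\<^sub>i\<close> of a sequence of
  sets and to the range of a sequence, which RCA0 need not prove to be a set.
\<close>

type_synonym nclass = "ntm \<Rightarrow> nfm"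

definition set_class :: "nset \<Rightarrow> nclass" where
  "set_class X = (\<lambda>n. n \<^bold>\<in> X)"

definition class_le :: "nclass \<Rightarrow> nclass \<Rightarrow> nfm" where
  "class_le U V = (\<^bold>\<forall>n. U n \<^bold>\<longrightarrow> V n)"

definition class_less :: "nclass \<Rightarrow> nclass \<Rightarrow> nfm" where
  "class_less U V = (class_le U V \<^bold>\<and> \<^bold>\<not> class_le V U)"

definition class_eq :: "nclass \<Rightarrow> nclass \<Rightarrow> nfm" where
  "class_eq U V = (\<^bold>\<forall>n. U n \<^bold>\<longleftrightarrow> V n)"

definition finite_set :: "nset \<Rightarrow> nfm" where
  "finite_set X = (\<^bold>\<exists>b. \<^bold>\<forall>n. n \<^bold>\<in> X \<^bold>\<longrightarrow> n \<^bold>< b)"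

definition closed_class :: "nclass \<Rightarrow> nfm" where
  "closed_class U = (class_le U diagram \<^bold>\<and>
     (\<^bold>\<forall>D. diagram D \<^bold>\<longrightarrow> (U D \<^bold>\<longleftrightarrow> (\<^bold>\<forall>E. diagram E \<^bold>\<and> dless D E \<^bold>\<longrightarrow> U E))))"

definition ucl :: "nclass \<Rightarrow> nclass" where
  "ucl U = (\<lambda>E. diagram E \<^bold>\<and> (\<^bold>\<exists>D. U D \<^bold>\<and> dle D E))"

definition cl :: "nset \<Rightarrow> nclass" where
  "cl X = ucl (\<lambda>F. \<^bold>\<exists>D. \<^bold>\<exists>E. \<^bold>\<exists>G. \<^bold>\<exists>H. D \<^bold>\<in> X \<^bold>\<and> E \<^bold>\<in> X \<^bold>\<and> drow D G \<^bold>\<and> dcol E H \<^bold>\<and> dunion G H F)"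

definition finitely_generated :: "nclass \<Rightarrow> nfm" where
  "finitely_generated U =
     (\<^bold>\<exists>\<^sub>S X. finite_set X \<^bold>\<and> class_le (set_class X) diagram \<^bold>\<and> class_eq U (cl X))"


section \<open>Sequences\<close>

text \<open>A sequence of diagrams is a function from the positive numbers to the diagrams, given as
  a set of pairs; a sequence of sets is coded by the single set of all \<open>(i, n)\<close> with \<open>n \<in> \<U>\<^sub>i\<close>.\<close>

definition diagram_sequence :: "nset \<Rightarrow> nfm" where
  "diagram_sequence X =
     ((\<^bold>\<forall>p. p \<^bold>\<in> X \<^bold>\<longrightarrow> (\<^bold>\<exists>i. \<^bold>\<exists>D. p \<^bold>= pair i D \<^bold>\<and> \<^bold>0 \<^bold>< i \<^bold>\<and> diagram D)) \<^bold>\<and>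
      (\<^bold>\<forall>i. \<^bold>0 \<^bold>< i \<^bold>\<longrightarrow> (\<^bold>\<exists>D. pair i D \<^bold>\<in> X)) \<^bold>\<and>
      (\<^bold>\<forall>i. \<^bold>\<forall>D. \<^bold>\<forall>E. pair i D \<^bold>\<in> X \<^bold>\<and> pair i E \<^bold>\<in> X \<^bold>\<longrightarrow> D \<^bold>= E))"

definition range_class :: "nset \<Rightarrow> nclass" where
  "range_class X = (\<lambda>D. \<^bold>\<exists>i. \<^bold>0 \<^bold>< i \<^bold>\<and> pair i D \<^bold>\<in> X)"

definition section_class :: "nset \<Rightarrow> ntm \<Rightarrow> nclass" where
  "section_class X i = (\<lambda>n. pair i n \<^bold>\<in> X)"

definition ascending :: "nset \<Rightarrow> nfm" where
  "ascending X = (\<^bold>\<forall>i. \<^bold>\<forall>j. \<^bold>0 \<^bold>< i \<^bold>\<and> i \<^bold>< j \<^bold>\<longrightarrow> class_less (section_class X i) (section_class X j))"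


section \<open>The five statements\<close>

definition WPO_D :: nfm where
  "WPO_D = (\<^bold>\<forall>\<^sub>S X. diagram_sequence X \<^bold>\<longrightarrow>
     (\<^bold>\<exists>i. \<^bold>\<exists>j. \<^bold>\<exists>D. \<^bold>\<exists>E. \<^bold>0 \<^bold>< i \<^bold>\<and> i \<^bold>< j \<^bold>\<and> pair i D \<^bold>\<in> X \<^bold>\<and> pair j E \<^bold>\<in> X \<^bold>\<and> dle D E))"

definition no_ascending_closed :: nfm where
  "no_ascending_closed = (\<^bold>\<not> (\<^bold>\<exists>\<^sub>S X. ascending X \<^bold>\<and>
     (\<^bold>\<forall>i. \<^bold>0 \<^bold>< i \<^bold>\<longrightarrow> closed_class (section_class X i))))"

definition no_ascending_fg_closed :: nfm where
  "no_ascending_fg_closed = (\<^bold>\<not> (\<^bold>\<exists>\<^sub>S X. ascending X \<^bold>\<and>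
     (\<^bold>\<forall>i. \<^bold>0 \<^bold>< i \<^bold>\<longrightarrow> closed_class (section_class X i) \<^bold>\<and> finitely_generated (section_class X i))))"

definition closed_sets_fg :: nfm where
  "closed_sets_fg =
     (\<^bold>\<forall>\<^sub>S X. closed_class (set_class X) \<^bold>\<longrightarrow> finitely_generated (set_class X))"

definition closed_sequences_fg :: nfm where
  "closed_sequences_fg = (\<^bold>\<forall>\<^sub>S X. diagram_sequence X \<^bold>\<and> closed_class (range_class X) \<^bold>\<longrightarrow>
     finitely_generated (range_class X))"

end

theory Submission
  imports Defs "HOL-Library.Countable"
begin

text \<open>
  By a Henkin completeness theorem for the calculus, it suffices to prove the equivalences inside
  an arbitrary, possibly nonstandard, model of RCA0. There, a bad sequence arises from an ascending
  sequence of closed sets \<open>\<U>\<^sub>i\<close> by choosing an element of each \<open>\<U>\<^sub>i\<^sub>+\<^sub>1 - \<U>\<^sub>i\<close>, and from a closed sequence that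
  is not finitely generated by keeping the terms that are not in the closure of the earlier ones.
  Conversely, a bad sequence can be modified so that the first row and the first column of every
  term are repeated; then upward closures are closed, and those of its initial segments form an
  infinite ascending sequence of finitely generated closed sets. If moreover the first rows are
  long, the upward closure of the whole sequence is a set, closed but not finitely generated.
\<close>

text \<open>The numbers of the model may be nonstandard, so induction in HOL says nothing about
  them. All facts about them come from Sigma01 induction and Delta01 comprehension, through the
  predicates \<open>sig\<close>, \<open>dec\<close> and \<open>fn\<close>. No primitive recursion is
  developed: functions are searches for least witnesses (\<open>fn_Least\<close>), and finite sets
  enter through divisibility codes with a uniform bound. The implications form two cycles through
  WPO, namely (1), (2), (3) and (1), (5), (4). The hard point is that the range of a closed sequence
  is only Sigma01. To see that it contains \<open>cl\<close> of finitely many members, closedness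
  has to be iterated downwards with a Sigma01 induction statement (\<open>closed_generates\<close>).
  For closed sets the obstacle is that the upward closure of an infinite sequence need not be a set;
  the long first rows bound the search for an index. The repeated first row matters for closedness:
  if one box is added to the first row of \<open>E\<close>, a diagram with two equal first rows that
  lies below the result lies already below \<open>E\<close>.\<close>

section \<open>Substitution\<close>

text \<open>A name for the substitution used by \<open>subst\<close> below a number quantifier, so
  that the quantifier case can be rewritten without exposing \<open>case_nat\<close>.\<close>

definition up :: "(nat \<Rightarrow> tm) \<Rightarrow> nat \<Rightarrow> tm" where
  "up \<sigma> = case_nat (Var 0) (\<lambda>n. lift_tm (\<sigma> n))"

primrec fv_tm :: "tm \<Rightarrow> nat set" where
  "fv_tm (Var n) = {n}"
| "fv_tm Zero = {}"
| "fv_tm One = {}"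
| "fv_tm (Add s t) = fv_tm s \<union> fv_tm t"
| "fv_tm (Mul s t) = fv_tm s \<union> fv_tm t"

primrec fv :: "fm \<Rightarrow> nat set" where
  "fv (Eq s t) = fv_tm s \<union> fv_tm t"
| "fv (Less s t) = fv_tm s \<union> fv_tm t"
| "fv (Mem t k) = fv_tm t"
| "fv Bot = {}"
| "fv (Imp A B) = fv A \<union> fv B"
| "fv (Forall A) = {n. Suc n \<in> fv A}"
| "fv (ForallS A) = fv A"

primrec fvS :: "fm \<Rightarrow> nat set" where
  "fvS (Eq s t) = {}"
| "fvS (Less s t) = {}"
| "fvS (Mem t k) = {k}"
| "fvS Bot = {}"
| "fvS (Imp A B) = fvS A \<union> fvS B"
| "fvS (Forall A) = fvS A"
| "fvS (ForallS A) = {n. Suc n \<in> fvS A}"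

lemma finite_fv_tm: "finite (fv_tm t)"
  by (induction t) auto

lemma finite_Suc_vimage: "finite A \<Longrightarrow> finite {n. Suc n \<in> A}"
  using finite_vimageI[of A Suc] by (simp add: vimage_def)

lemma finite_fv: "finite (fv A)"
  by (induction A) (auto simp: finite_fv_tm finite_Suc_vimage)

lemma finite_fvS: "finite (fvS A)"
  by (induction A) (auto simp: finite_Suc_vimage)

lemma subst_Forall: "subst \<sigma> \<rho> (Forall A) = Forall (subst (up \<sigma>) \<rho> A)"
  by (simp add: up_def)

lemma subst_tm_comp: "subst_tm \<sigma> (subst_tm \<tau> t) = subst_tm (\<lambda>n. subst_tm \<sigma> (\<tau> n)) t"
  by (induction t) auto

lemma subst_tm_cong: "(\<And>n. n \<in> fv_tm t \<Longrightarrow> \<sigma> n = \<tau> n) \<Longrightarrow> subst_tm \<sigma> t = subst_tm \<tau> t"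
  by (induction t) auto

lemma subst_tm_Var: "subst_tm Var t = t"
  by (induction t) auto

lemma subst_tm_up_lift: "subst_tm (up \<sigma>) (lift_tm t) = lift_tm (subst_tm \<sigma> t)"
  by (simp add: lift_tm_def subst_tm_comp up_def)

lemma subst_tm_case_lift: "subst_tm (case_nat s \<sigma>) (lift_tm t) = subst_tm \<sigma> t"
  by (simp add: lift_tm_def subst_tm_comp)

lemma up_comp: "(\<lambda>n. subst_tm (up \<sigma>) (up \<tau> n)) = up (\<lambda>n. subst_tm \<sigma> (\<tau> n))"
proof
  fix n show "subst_tm (up \<sigma>) (up \<tau> n) = up (\<lambda>n. subst_tm \<sigma> (\<tau> n)) n"
    by (cases n) (simp_all add: up_def subst_tm_up_lift[unfolded up_def])
qed

lemma upS_comp: "case_nat 0 (\<lambda>n. Suc (\<rho> n)) \<circ> case_nat 0 (\<lambda>n. Suc (\<rho>' n)) = case_nat 0 (\<lambda>n. Suc (\<rho> (\<rho>' n)))"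
  by (auto split: nat.splits)

lemma subst_comp: "subst \<sigma> \<rho> (subst \<tau> \<rho>' A) = subst (\<lambda>n. subst_tm \<sigma> (\<tau> n)) (\<lambda>n. \<rho> (\<rho>' n)) A"
proof (induction A arbitrary: \<sigma> \<tau> \<rho> \<rho>')
  case (Forall A)
  show ?case by (simp add: subst_Forall Forall.IH up_comp del: subst.simps(6))
next
  case (ForallS A)
  show ?case by (simp add: ForallS.IH) (metis upS_comp comp_def)
qed (auto simp: subst_tm_comp)

lemma subst_cong:
  "(\<And>n. n \<in> fv A \<Longrightarrow> \<sigma> n = \<tau> n) \<Longrightarrow> (\<And>n. n \<in> fvS A \<Longrightarrow> \<rho> n = \<rho>' n) \<Longrightarrow> subst \<sigma> \<rho> A = subst \<tau> \<rho>' A"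
proof (induction A arbitrary: \<sigma> \<tau> \<rho> \<rho>')
  case (Forall A)
  have "subst (up \<sigma>) \<rho> A = subst (up \<tau>) \<rho>' A"
    by (rule Forall.IH) (use Forall.prems in \<open>auto simp: up_def split: nat.splits\<close>)
  then show ?case by (simp only: subst_Forall)
next
  case (ForallS A)
  have "subst \<sigma> (case_nat 0 (\<lambda>n. Suc (\<rho> n))) A = subst \<tau> (case_nat 0 (\<lambda>n. Suc (\<rho>' n))) A"
    by (rule ForallS.IH) (use ForallS.prems in \<open>auto split: nat.splits\<close>)
  then show ?case by simp
next
  case (Imp A B)
  have "subst \<sigma> \<rho> A = subst \<tau> \<rho>' A" "subst \<sigma> \<rho> B = subst \<tau> \<rho>' B"
    using Imp.prems by (auto intro!: Imp.IH)
  then show ?case by simp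
qed (auto intro: subst_tm_cong)

lemma up_Var: "up Var = Var"
  by (auto simp: up_def lift_tm_def split: nat.splits)

lemma subst_Var: "subst Var (\<lambda>n. n) A = A"
proof -
  have "case_nat 0 Suc = (\<lambda>n. n)" by (auto split: nat.splits)
  then show ?thesis
    by (induction A) (simp_all add: subst_tm_Var subst_Forall up_Var del: subst.simps(6))
qed

section \<open>Closure under substitution, deduction theorem, eigenvariables\<close>

section \<open>Derivations\<close>

text \<open>\<open>Gen\<close> and \<open>Inst\<close> replace one variable at a time. The terms
  already inserted are lifted, so that index 0 stands for variable \<open>k\<close> alone, the next
  to be instantiated, and the remaining variables slide down.\<close>

lemma provable_subst_prefix:
  assumes "T \<turnstile> A"
  shows "T \<turnstile> subst (\<lambda>n. if n < k then \<sigma> n else Var (n - k)) id A"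
proof (induction k arbitrary: \<sigma>)
  case 0
  then show ?case using assms by (simp add: subst_Var id_def)
next
  case (Suc k)
  let ?B = "subst (\<lambda>n. if n < k then lift_tm (\<sigma> n) else Var (n - k)) id A"
  have "T \<turnstile> inst (\<sigma> k) ?B"
    by (rule MP[OF Inst Gen[OF Suc.IH]])
  moreover have "inst (\<sigma> k) ?B = subst (\<lambda>n. if n < Suc k then \<sigma> n else Var (n - Suc k)) id A"
    unfolding inst_def subst_comp
    by (rule subst_cong) (auto simp: subst_tm_case_lift subst_tm_Var split: nat.splits, presburger?)
  ultimately show ?case by (simp only:)
qed

lemma provable_substS_prefix:
  assumes "T \<turnstile> A"
  shows "T \<turnstile> subst Var (\<lambda>n. if n < k then \<rho> n else n - k) A"
proof (induction k arbitrary: \<rho>)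
  case 0
  then show ?case using assms subst_Var by simp
next
  case (Suc k)
  let ?B = "subst Var (\<lambda>n. if n < k then Suc (\<rho> n) else n - k) A"
  have "T \<turnstile> instS (\<rho> k) ?B"
    by (rule MP[OF InstS GenS[OF Suc.IH]])
  moreover have "instS (\<rho> k) ?B = subst Var (\<lambda>n. if n < Suc k then \<rho> n else n - Suc k) A"
    unfolding instS_def subst_comp
    by (rule subst_cong) (auto split: nat.splits, presburger?)
  ultimately show ?case by simp
qed

lemma finite_nat_less: "finite (A::nat set) \<Longrightarrow> \<exists>k. \<forall>n\<in>A. n < k"
  using finite_nat_set_iff_bounded by auto

text \<open>A prefix longer than all free variables makes the shift of the remaining variables
  invisible. Set variables are treated first, then number variables.\<close>

lemma provable_subst:
  assumes "T \<turnstile> A"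
  shows "T \<turnstile> subst \<sigma> \<rho> A"
proof -
  obtain k where k: "\<forall>n\<in>fvS A. n < k" using finite_nat_less finite_fvS by blast
  have "T \<turnstile> subst Var (\<lambda>n. if n < k then \<rho> n else n - k) A"
    using assms by (rule provable_substS_prefix)
  also have "subst Var (\<lambda>n. if n < k then \<rho> n else n - k) A = subst Var \<rho> A"
    by (rule subst_cong) (use k in auto)
  finally have A: "T \<turnstile> subst Var \<rho> A" .
  obtain l where l: "\<forall>n\<in>fv (subst Var \<rho> A). n < l" using finite_nat_less finite_fv by blast
  have "T \<turnstile> subst (\<lambda>n. if n < l then \<sigma> n else Var (n - l)) id (subst Var \<rho> A)"
    using A by (rule provable_subst_prefix)
  also have "\<dots> = subst \<sigma> id (subst Var \<rho> A)"
    by (rule subst_cong) (use l in auto)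
  finally show ?thesis by (simp add: subst_comp)
qed

lemma provable_I: "T \<turnstile> Imp A A"
  by (rule MP[OF MP[OF S K] K[where B=A]])

text \<open>Hypotheses are kept apart from the theory: generalization happens only inside
  \<open>prv\<close>, never over a variable of a hypothesis, so the deduction theorem holds without
  side conditions.\<close>

inductive der :: "fm set \<Rightarrow> fm set \<Rightarrow> fm \<Rightarrow> bool" for T \<Gamma> where
  hyp: "A \<in> \<Gamma> \<Longrightarrow> der T \<Gamma> A"
| prv: "T \<turnstile> A \<Longrightarrow> der T \<Gamma> A"
| mp: "der T \<Gamma> (Imp A B) \<Longrightarrow> der T \<Gamma> A \<Longrightarrow> der T \<Gamma> B"

lemma der_mono: "der T \<Gamma> A \<Longrightarrow> \<Gamma> \<subseteq> \<Delta> \<Longrightarrow> der T \<Delta> A"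
  by (induction rule: der.induct) (auto intro: der.intros)

lemma der_empty: "der T {} A \<Longrightarrow> T \<turnstile> A"
  by (induction rule: der.induct) (auto intro: MP)

lemma deduction:
  assumes "der T (insert A \<Gamma>) B"
  shows "der T \<Gamma> (Imp A B)"
  using assms
proof (induction rule: der.induct)
  case (hyp B)
  then show ?case
    using der.mp[OF der.prv[OF K] der.hyp] der.prv[OF provable_I] by blast
next
  case (prv B)
  show ?case by (rule der.prv[OF MP[OF K prv]])
next
  case (mp B C)
  show ?case by (rule der.mp[OF der.mp[OF der.prv[OF S] mp.IH(1)] mp.IH(2)])
qed

lemma der_subst: "der T \<Gamma> A \<Longrightarrow> der T (subst \<sigma> \<rho> ` \<Gamma>) (subst \<sigma> \<rho> A)"
proof (induction rule: der.induct)
  case (mp A B)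
  then show ?case using der.mp by fastforce
qed (auto intro: der.hyp der.prv provable_subst)

lemma der_Gen: "finite \<Gamma> \<Longrightarrow> der T (lift ` \<Gamma>) A \<Longrightarrow> der T \<Gamma> (Forall A)"
proof (induction arbitrary: A rule: finite_induct)
  case empty
  then show ?case by (auto intro: prv Gen der_empty)
next
  case (insert C \<Gamma>)
  then have "der T \<Gamma> (Forall (Imp (lift C) A))" by (auto intro: deduction)
  then have "der T \<Gamma> (Imp C (Forall A))" by (rule mp[OF prv[OF Distr]])
  then have "der T (insert C \<Gamma>) (Imp C (Forall A))" by (rule der_mono) auto
  then show ?case by (rule mp) (auto intro: hyp)
qed

lemma der_GenS: "finite \<Gamma> \<Longrightarrow> der T (liftS ` \<Gamma>) A \<Longrightarrow> der T \<Gamma> (ForallS A)"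
proof (induction arbitrary: A rule: finite_induct)
  case empty
  then show ?case by (auto intro: prv GenS der_empty)
next
  case (insert C \<Gamma>)
  then have "der T \<Gamma> (ForallS (Imp (liftS C) A))" by (auto intro: deduction)
  then have "der T \<Gamma> (Imp C (ForallS A))" by (rule mp[OF prv[OF DistrS]])
  then have "der T (insert C \<Gamma>) (Imp C (ForallS A))" by (rule der_mono) auto
  then show ?case by (rule mp) (auto intro: hyp)
qed

lemma der_eigen:
  assumes fin: "finite \<Gamma>" and y: "\<And>C. C \<in> \<Gamma> \<Longrightarrow> y \<notin> fv C" "y \<notin> fv (Forall A)"
    and d: "der T \<Gamma> (inst (Var y) A)"
  shows "der T \<Gamma> (Forall A)"
proof (rule der_Gen[OF fin])
  \<comment> \<open>This renaming sends the eigenvariable to index 0 and every other variable to its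
    lift; since \<open>y\<close> is fresh, it acts as \<open>lift\<close> on the hypotheses.\<close>
  define \<sigma> where "\<sigma> n = (if n = y then Var 0 else Var (Suc n))" for n
  have "subst \<sigma> id ` \<Gamma> = lift ` \<Gamma>"
    unfolding lift_def by (rule image_cong[OF refl], rule subst_cong) (use y in \<open>auto simp: \<sigma>_def\<close>)
  moreover have "subst \<sigma> id (inst (Var y) A) = subst Var id A"
    unfolding inst_def subst_comp
    by (rule subst_cong) (use y in \<open>auto simp: \<sigma>_def split: nat.splits\<close>)
  ultimately show "der T (lift ` \<Gamma>) A"
    using der_subst[OF d, of \<sigma> id] by (simp add: subst_Var id_def)
qed

lemma der_eigenS:
  assumes fin: "finite \<Gamma>" and y: "\<And>C. C \<in> \<Gamma> \<Longrightarrow> y \<notin> fvS C" "y \<notin> fvS (ForallS A)"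
    and d: "der T \<Gamma> (instS y A)"
  shows "der T \<Gamma> (ForallS A)"
proof (rule der_GenS[OF fin])
  define \<rho> where "\<rho> n = (if n = y then 0 else Suc n)" for n
  have "subst Var \<rho> ` \<Gamma> = liftS ` \<Gamma>"
    unfolding liftS_def by (rule image_cong[OF refl], rule subst_cong) (use y in \<open>auto simp: \<rho>_def\<close>)
  moreover have "subst Var \<rho> (instS y A) = subst Var id A"
    unfolding instS_def subst_comp
    by (rule subst_cong) (use y in \<open>auto simp: \<rho>_def split: nat.splits\<close>)
  ultimately show "der T (liftS ` \<Gamma>) A"
    using der_subst[OF d, of Var \<rho>] by (simp add: subst_Var id_def)
qed

lemma der_Neg: "der T (insert (Neg A) \<Gamma>) Bot \<Longrightarrow> der T \<Gamma> A"
  by (rule mp[OF prv[OF DNE]], subst Neg_def, rule deduction)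

lemma der_contra: "der T \<Gamma> (Neg A) \<Longrightarrow> der T \<Gamma> A \<Longrightarrow> der T \<Gamma> Bot"
  unfolding Neg_def by (rule mp)

lemma fresh_exists:
  assumes "finite \<Gamma>" "\<And>C. finite (f C :: nat set)"
  shows "\<exists>y. \<forall>C\<in>\<Gamma>. y \<notin> f C"
proof -
  have "finite (\<Union>C\<in>\<Gamma>. f C)" using assms by blast
  then show ?thesis by (metis UN_I ex_new_if_finite infinite_UNIV_nat)
qed

section \<open>Henkin extensions with variables as witnesses\<close>

section \<open>Complete Henkin theories\<close>

text \<open>Decides one formula. If a universal formula is refuted, a variable that is fresh for the
  finite theory becomes its counterexample, so variables take the role of Henkin constants.\<close>

lemma henkin_step:
  assumes "finite \<Gamma>" "\<not> der T \<Gamma> Bot"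
  shows "\<exists>\<Gamma>'. finite \<Gamma>' \<and> \<not> der T \<Gamma>' Bot \<and> \<Gamma> \<subseteq> \<Gamma>' \<and> (F \<in> \<Gamma>' \<or> Neg F \<in> \<Gamma>') \<and>
    (\<forall>A. F = Forall A \<longrightarrow> Neg F \<in> \<Gamma>' \<longrightarrow> (\<exists>y. Neg (inst (Var y) A) \<in> \<Gamma>')) \<and>
    (\<forall>A. F = ForallS A \<longrightarrow> Neg F \<in> \<Gamma>' \<longrightarrow> (\<exists>y. Neg (instS y A) \<in> \<Gamma>'))"
proof (cases "der T (insert (Neg F) \<Gamma>) Bot")
  case True
  then have "der T \<Gamma> F" by (rule der_Neg)
  then have "\<not> der T (insert F \<Gamma>) Bot" using assms deduction mp by blast
  moreover have "Neg F \<notin> insert F \<Gamma>"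
    using calculation der_contra[OF hyp hyp, of F "insert F \<Gamma>"] by blast
  ultimately show ?thesis using assms by (intro exI[of _ "insert F \<Gamma>"]) auto
next
  case False
  let ?\<Delta> = "insert (Neg F) \<Gamma>"
  have fin: "finite ?\<Delta>" using assms by simp
  consider A where "F = Forall A" | A where "F = ForallS A" | "\<forall>A. F \<noteq> Forall A \<and> F \<noteq> ForallS A" by blast
  then show ?thesis
  proof cases
    case 1
    obtain y where y: "\<forall>C\<in>?\<Delta>. y \<notin> fv C" using fresh_exists[OF fin, of fv] finite_fv by blast
    have "\<not> der T (insert (Neg (inst (Var y) A)) ?\<Delta>) Bot"
    proof
      assume "der T (insert (Neg (inst (Var y) A)) ?\<Delta>) Bot"
      then have "der T ?\<Delta> (Forall A)"
        using der_eigen[OF fin, of y A T] y 1 der_Neg by (auto simp: Neg_def)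
      then show False using False 1 using der_contra[OF hyp, of F ?\<Delta>] by blast
    qed
    then show ?thesis using fin 1
      by (intro exI[of _ "insert (Neg (inst (Var y) A)) ?\<Delta>"]) auto
  next
    case 2
    obtain y where y: "\<forall>C\<in>?\<Delta>. y \<notin> fvS C" using fresh_exists[OF fin, of fvS] finite_fvS by blast
    have "\<not> der T (insert (Neg (instS y A)) ?\<Delta>) Bot"
    proof
      assume "der T (insert (Neg (instS y A)) ?\<Delta>) Bot"
      then have "der T ?\<Delta> (ForallS A)"
        using der_eigenS[OF fin, of y A T] y 2 der_Neg by (auto simp: Neg_def)
      then show False using False 2 using der_contra[OF hyp, of F ?\<Delta>] by blast
    qed
    then show ?thesis using fin 2
      by (intro exI[of _ "insert (Neg (instS y A)) ?\<Delta>"]) auto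
  next
    case 3
    then show ?thesis using fin False by (intro exI[of _ ?\<Delta>]) auto
  qed
qed

instance tm :: countable by countable_datatype
instance fm :: countable by countable_datatype

text \<open>The clauses for \<open>Bot\<close> and \<open>Imp\<close> amount to consistency and
  completeness of the theory, those for the quantifiers to the existence of witnesses.\<close>

definition henkin :: "fm set \<Rightarrow> fm set \<Rightarrow> bool" where
  "henkin T H \<longleftrightarrow> Bot \<notin> H \<and> (\<forall>A. T \<turnstile> A \<longrightarrow> A \<in> H) \<and> (\<forall>A B. Imp A B \<in> H \<longleftrightarrow> (A \<in> H \<longrightarrow> B \<in> H)) \<and>
     (\<forall>A. Forall A \<in> H \<longleftrightarrow> (\<forall>t. inst t A \<in> H)) \<and> (\<forall>A. ForallS A \<in> H \<longleftrightarrow> (\<forall>k. instS k A \<in> H))"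

text \<open>A derivation uses finitely many hypotheses, so some stage of the chain contains them
  all.\<close>

lemma der_chain:
  assumes "der T (\<Union>n::nat. G n) A" and "mono G"
  shows "\<exists>n. der T (G n) A"
  using assms(1)
proof (induction rule: der.induct)
  case (mp A B)
  then obtain m n where "der T (G m) (Imp A B)" "der T (G n) A" by blast
  then have "der T (G (max m n)) (Imp A B)" "der T (G (max m n)) A"
    using \<open>mono G\<close> by (meson der_mono max.cobounded1 max.cobounded2 monoD)+
  then show ?case by (metis der.mp)
qed (auto intro: der.intros)

theorem henkin_exists:
  assumes "\<not> T \<turnstile> A"
  shows "\<exists>H. henkin T H \<and> A \<notin> H"
proof -
  have c0: "\<not> der T {Neg A} Bot" using assms der_Neg der_empty by blast
  define Q where "Q F \<Gamma>' \<longleftrightarrow> (F \<in> \<Gamma>' \<or> Neg F \<in> \<Gamma>') \<and>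
    (\<forall>A. F = Forall A \<longrightarrow> Neg F \<in> \<Gamma>' \<longrightarrow> (\<exists>y. Neg (inst (Var y) A) \<in> \<Gamma>')) \<and>
    (\<forall>A. F = ForallS A \<longrightarrow> Neg F \<in> \<Gamma>' \<longrightarrow> (\<exists>y. Neg (instS y A) \<in> \<Gamma>'))" for F \<Gamma>'
  \<comment> \<open>Stage \<open>Suc n\<close> decides the formula with number \<open>n\<close>;
    finiteness of every stage keeps fresh variables available.\<close>
  have "\<exists>G. \<forall>n. (finite (G n) \<and> \<not> der T (G n) Bot \<and> Neg A \<in> G n) \<and>
      (G n \<subseteq> G (Suc n) \<and> Q (from_nat n) (G (Suc n)))"
  proof (rule dependent_nat_choice)
    show "\<exists>x. finite x \<and> \<not> der T x Bot \<and> Neg A \<in> x" using c0 by blast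
  next
    fix x n
    assume "finite x \<and> \<not> der T x Bot \<and> Neg A \<in> x"
    then show "\<exists>y. (finite y \<and> \<not> der T y Bot \<and> Neg A \<in> y) \<and> x \<subseteq> y \<and> Q (from_nat n) y"
      using henkin_step[of x T "from_nat n"] unfolding Q_def by blast
  qed
  then obtain G where G: "\<And>n. \<not> der T (G n) Bot" "\<And>n. Neg A \<in> G n" "\<And>n. G n \<subseteq> G (Suc n)"
    "\<And>n. Q (from_nat n) (G (Suc n))" by blast
  have mono: "mono G" using G(3) by (simp add: mono_iff_le_Suc)
  define H where "H = (\<Union>n. G n)"
  have con: "\<not> der T H Bot" using der_chain[OF _ mono] G(1) unfolding H_def by blast
  have QH: "F \<in> H \<or> Neg F \<in> H" for F
    using G(4)[of "to_nat F"] unfolding Q_def H_def by auto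
  have notin: "Neg F \<in> H \<longleftrightarrow> F \<notin> H" for F
    using QH con der_contra[OF hyp hyp] by blast
  have in_H: "der T H F \<Longrightarrow> F \<in> H" for F
    using notin con der_contra[OF hyp] by blast
  have "A \<notin> H" using notin G(2) H_def by blast
  moreover have "henkin T H"
    unfolding henkin_def
  proof (intro conjI allI impI)
    show "Bot \<notin> H" using con hyp by blast
    fix B show "T \<turnstile> B \<Longrightarrow> B \<in> H" using in_H prv by blast
  next
    fix B C
    have "Imp B C \<in> H" if "C \<in> H" by (rule in_H[OF mp[OF prv[OF K] hyp[OF that]]])
    moreover have "Imp B C \<in> H" if "B \<notin> H"
    proof -
      have "der T (insert B H) Bot" using that notin by (intro der_contra[OF hyp hyp, of B]) auto
      then have "der T (insert (Neg C) (insert B H)) Bot" by (rule der_mono) auto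
      then show ?thesis using der_Neg deduction in_H by blast
    qed
    ultimately show "(Imp B C \<in> H) = (B \<in> H \<longrightarrow> C \<in> H)" using in_H[OF mp[OF hyp hyp]] by blast
  next
    fix B
    have 1: "inst t B \<in> H" if "Forall B \<in> H" for t by (rule in_H[OF mp[OF prv[OF Inst] hyp[OF that]]])
    have "\<exists>y. inst (Var y) B \<notin> H" if "Forall B \<notin> H"
    proof -
      have "Q (Forall B) (G (Suc (to_nat (Forall B))))" using G(4)[of "to_nat (Forall B)"] by simp
      moreover have "Forall B \<notin> G (Suc (to_nat (Forall B)))" using that unfolding H_def by blast
      ultimately obtain y where "Neg (inst (Var y) B) \<in> H" unfolding Q_def H_def by blast
      then show ?thesis using notin by blast
    qed
    with 1 show "(Forall B \<in> H) = (\<forall>t. inst t B \<in> H)" by blast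
  next
    fix B
    have 1: "instS t B \<in> H" if "ForallS B \<in> H" for t by (rule in_H[OF mp[OF prv[OF InstS] hyp[OF that]]])
    have "\<exists>y. instS y B \<notin> H" if "ForallS B \<notin> H"
    proof -
      have "Q (ForallS B) (G (Suc (to_nat (ForallS B))))" using G(4)[of "to_nat (ForallS B)"] by simp
      moreover have "ForallS B \<notin> G (Suc (to_nat (ForallS B)))" using that unfolding H_def by blast
      ultimately obtain y where "Neg (instS y B) \<in> H" unfolding Q_def H_def by blast
      then show ?thesis using notin by blast
    qed
    with 1 show "(ForallS B \<in> H) = (\<forall>t. instS t B \<in> H)" by blast
  qed
  ultimately show ?thesis by blast
qed

section \<open>Semantics with restricted set quantifiers, and the term model\<close>

section \<open>Structures\<close>

text \<open>Set quantifiers range over the family \<open>ss\<close> and not over all subsets of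
  \<open>dom\<close>; for this semantics the two-sorted calculus is complete.\<close>

record 'a model =
  dom :: "'a set"
  zr :: 'a
  on :: 'a
  ad :: "'a \<Rightarrow> 'a \<Rightarrow> 'a"
  ml :: "'a \<Rightarrow> 'a \<Rightarrow> 'a"
  ls :: "'a \<Rightarrow> 'a \<Rightarrow> bool"
  ss :: "'a set set"

primrec val :: "('a, 'b) model_scheme \<Rightarrow> (nat \<Rightarrow> 'a) \<Rightarrow> tm \<Rightarrow> 'a" where
  "val M e (Var n) = e n"
| "val M e Zero = zr M"
| "val M e One = on M"
| "val M e (Add s t) = ad M (val M e s) (val M e t)"
| "val M e (Mul s t) = ml M (val M e s) (val M e t)"

primrec sat :: "('a, 'b) model_scheme \<Rightarrow> (nat \<Rightarrow> 'a) \<Rightarrow> (nat \<Rightarrow> 'a set) \<Rightarrow> fm \<Rightarrow> bool" where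
  "sat M e r (Eq s t) = (val M e s = val M e t)"
| "sat M e r (Less s t) = ls M (val M e s) (val M e t)"
| "sat M e r (Mem t k) = (val M e t \<in> r k)"
| "sat M e r Bot = False"
| "sat M e r (Imp A B) = (sat M e r A \<longrightarrow> sat M e r B)"
| "sat M e r (Forall A) = (\<forall>x\<in>dom M. sat M (case_nat x e) r A)"
| "sat M e r (ForallS A) = (\<forall>X\<in>ss M. sat M e (case_nat X r) A)"

lemma sat_defined [simp]:
  "sat M e r (Neg A) = (\<not> sat M e r A)"
  "sat M e r (Conj A B) = (sat M e r A \<and> sat M e r B)"
  "sat M e r (Disj A B) = (sat M e r A \<or> sat M e r B)"
  "sat M e r (Iff A B) = (sat M e r A = sat M e r B)"
  "sat M e r (Exists A) = (\<exists>x\<in>dom M. sat M (case_nat x e) r A)"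
  "sat M e r (ExistsS A) = (\<exists>X\<in>ss M. sat M e (case_nat X r) A)"
  by (auto simp: Neg_def Conj_def Disj_def Iff_def Exists_def ExistsS_def)

lemma val_subst: "val M e (subst_tm \<sigma> t) = val M (\<lambda>n. val M e (\<sigma> n)) t"
  by (induction t) auto

lemma val_lift: "val M (case_nat x e) (lift_tm t) = val M e t"
  by (simp add: lift_tm_def val_subst)

lemma val_up: "(\<lambda>n. val M (case_nat x e) (up \<sigma> n)) = case_nat x (\<lambda>n. val M e (\<sigma> n))"
  by (auto simp: up_def val_lift split: nat.splits)

lemma case_nat_upS: "(\<lambda>n. case_nat X r (case_nat 0 (\<lambda>n. Suc (\<rho> n)) n)) = case_nat X (\<lambda>n. r (\<rho> n))"
  by (auto split: nat.splits)

lemma sat_subst: "sat M e r (subst \<sigma> \<rho> A) = sat M (\<lambda>n. val M e (\<sigma> n)) (\<lambda>n. r (\<rho> n)) A"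
proof (induction A arbitrary: e r \<sigma> \<rho>)
  case (Forall A)
  show ?case by (simp only: subst_Forall sat.simps Forall.IH val_up)
next
  case (ForallS A)
  show ?case by (simp only: subst.simps sat.simps ForallS.IH case_nat_upS)
qed (auto simp: val_subst)

definition models :: "('a, 'b) model_scheme \<Rightarrow> fm set \<Rightarrow> bool" where
  "models M T \<longleftrightarrow> (\<forall>A\<in>T. \<forall>e r. range e \<subseteq> dom M \<longrightarrow> range r \<subseteq> ss M \<longrightarrow> sat M e r A)"

definition wf_structure :: "('a, 'b) model_scheme \<Rightarrow> bool" where
  "wf_structure M \<longleftrightarrow> zr M \<in> dom M \<and> on M \<in> dom M \<and> (\<forall>x\<in>dom M. \<forall>y\<in>dom M. ad M x y \<in> dom M) \<and>
     (\<forall>x\<in>dom M. \<forall>y\<in>dom M. ml M x y \<in> dom M) \<and> ss M \<subseteq> Pow (dom M) \<and> ss M \<noteq> {}"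

lemma subst_case_inst: "inst t (subst (up \<sigma>) \<rho> A) = subst (case_nat t \<sigma>) \<rho> A"
  unfolding inst_def subst_comp
  by (rule subst_cong) (auto simp: up_def subst_tm_case_lift subst_tm_Var split: nat.splits)

lemma subst_case_instS:
  "instS k (subst \<sigma> (case_nat 0 (\<lambda>n. Suc (\<rho> n))) A) = subst \<sigma> (case_nat k \<rho>) A"
  unfolding instS_def subst_comp
  by (rule subst_cong) (auto simp: subst_tm_Var split: nat.splits)

text \<open>The model consists of the terms modulo the equations in \<open>H\<close>, with one set
  for each set variable. Since terms are countable, a class of terms can be represented by a natural
  number.\<close>

theorem henkin_structure:
  assumes H: "henkin T H"
  shows "\<exists>(M::nat model) e r. wf_structure M \<and> models M T \<and> range e \<subseteq> dom M \<and> range r \<subseteq> ss M \<and>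
    (\<forall>A. sat M e r A \<longleftrightarrow> A \<in> H)"
proof -
  have prov: "\<And>A. T \<turnstile> A \<Longrightarrow> A \<in> H" and imp: "\<And>A B. Imp A B \<in> H \<longleftrightarrow> (A \<in> H \<longrightarrow> B \<in> H)"
    and bot: "Bot \<notin> H" and all: "\<And>A. Forall A \<in> H \<longleftrightarrow> (\<forall>t. inst t A \<in> H)"
    and allS: "\<And>A. ForallS A \<in> H \<longleftrightarrow> (\<forall>k. instS k A \<in> H)"
    using H unfolding henkin_def by blast+
  have leib: "inst s A \<in> H \<Longrightarrow> Eq s t \<in> H \<Longrightarrow> inst t A \<in> H" for s t A
    using prov[OF Leibniz, of s t A] imp by blast
  have lift1: "subst_tm (case_nat s Var) (lift_tm t) = t" for s t
    by (simp add: subst_tm_case_lift subst_tm_Var)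
  have refl: "Eq t t \<in> H" for t using prov Refl by blast
  have sym: "Eq t s \<in> H" if "Eq s t \<in> H" for s t
    using leib[of s "Eq (Var 0) (lift_tm s)" t] that refl by (simp add: inst_def lift1)
  have trans: "Eq s u \<in> H" if "Eq s t \<in> H" "Eq t u \<in> H" for s t u
    using leib[of t "Eq (lift_tm s) (Var 0)" u] that by (simp add: inst_def lift1)
  have subst_l: "Eq (f s) (f t) \<in> H" if "Eq s t \<in> H" "\<And>u. inst u (Eq (lift_tm (f s)) F) = Eq (f s) (f u)" for s t f F
    using leib[of s "Eq (lift_tm (f s)) F" t] that refl by simp
  have add: "Eq (Add s u) (Add s' u') \<in> H" if "Eq s s' \<in> H" "Eq u u' \<in> H" for s s' u u'
  proof (rule trans)
    show "Eq (Add s u) (Add s' u) \<in> H"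
      using that by (intro subst_l[of _ _ "\<lambda>s. Add s u" "Add (Var 0) (lift_tm u)"]) (auto simp: inst_def lift1)
    show "Eq (Add s' u) (Add s' u') \<in> H"
      using that by (intro subst_l[of _ _ "\<lambda>u. Add s' u" "Add (lift_tm s') (Var 0)"]) (auto simp: inst_def lift1)
  qed
  have mul: "Eq (Mul s u) (Mul s' u') \<in> H" if "Eq s s' \<in> H" "Eq u u' \<in> H" for s s' u u'
  proof (rule trans)
    show "Eq (Mul s u) (Mul s' u) \<in> H"
      using that by (intro subst_l[of _ _ "\<lambda>s. Mul s u" "Mul (Var 0) (lift_tm u)"]) (auto simp: inst_def lift1)
    show "Eq (Mul s' u) (Mul s' u') \<in> H"
      using that by (intro subst_l[of _ _ "\<lambda>u. Mul s' u" "Mul (lift_tm s') (Var 0)"]) (auto simp: inst_def lift1)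
  qed
  have less: "Less s' u' \<in> H" if "Eq s s' \<in> H" "Eq u u' \<in> H" "Less s u \<in> H" for s s' u u'
  proof -
    have "Less s' u \<in> H"
      using leib[of s "Less (Var 0) (lift_tm u)" s'] that by (simp add: inst_def lift1)
    then show ?thesis
      using leib[of u "Less (lift_tm s') (Var 0)" u'] that by (simp add: inst_def lift1)
  qed
  have mem: "Mem s' k \<in> H" if "Eq s s' \<in> H" "Mem s k \<in> H" for s s' k
    using leib[of s "Mem (Var 0) k" s'] that by (simp add: inst_def)
  \<comment> \<open>The least number that decodes to a term equal to \<open>t\<close> according to
    \<open>H\<close>: a canonical representative, so that \<open>Eq\<close> is interpreted by
    identity.\<close>
  define c :: "tm \<Rightarrow> nat" where "c t = (LEAST n. Eq t (from_nat n) \<in> H)" for t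
  have c1: "Eq t (from_nat (c t)) \<in> H" for t
    unfolding c_def by (rule LeastI[of _ "to_nat t"]) (simp add: refl)
  have c_eq: "c s = c t \<longleftrightarrow> Eq s t \<in> H" for s t
  proof
    assume "c s = c t" then show "Eq s t \<in> H" using c1 sym trans by metis
  next
    assume "Eq s t \<in> H"
    then have "Eq s u \<in> H \<longleftrightarrow> Eq t u \<in> H" for u using sym trans by blast
    then show "c s = c t" unfolding c_def by simp
  qed
  define S where "S k = {c t | t. Mem t k \<in> H}" for k
  have S_iff: "c t \<in> S k \<longleftrightarrow> Mem t k \<in> H" for t k
    unfolding S_def mem_Collect_eq c_eq using mem sym refl by metis
  define M :: "nat model" where "M = \<lparr>dom = range c, zr = c Zero, on = c One,
    ad = (\<lambda>i j. c (Add (from_nat i) (from_nat j))), ml = (\<lambda>i j. c (Mul (from_nat i) (from_nat j))),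
    ls = (\<lambda>i j. Less (from_nat i) (from_nat j) \<in> H), ss = range S\<rparr>"
  have val: "val M (\<lambda>n. c (\<sigma> n)) t = c (subst_tm \<sigma> t)" for \<sigma> t
  proof (induction t)
    case (Add s t)
    then show ?case using c1 sym by (auto simp: M_def c_eq intro!: add)
  next
    case (Mul s t)
    then show ?case using c1 sym by (auto simp: M_def c_eq intro!: mul)
  qed (auto simp: M_def)
  have cn: "case_nat (c t) (\<lambda>n. c (\<sigma> n)) = (\<lambda>n. c (case_nat t \<sigma> n))" for t \<sigma>
    by (auto split: nat.splits)
  have cnS: "case_nat (S k) (\<lambda>n. S (\<rho> n)) = (\<lambda>n. S (case_nat k \<rho> n))" for k \<rho>
    by (auto split: nat.splits)
  \<comment> \<open>Quantifiers extend the environments, so the induction has to treat all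
    substitutions \<open>\<sigma>\<close> and \<open>\<rho>\<close> at once.\<close>
  have truth: "sat M (\<lambda>n. c (\<sigma> n)) (\<lambda>k. S (\<rho> k)) A \<longleftrightarrow> subst \<sigma> \<rho> A \<in> H" for \<sigma> \<rho> A
  proof (induction A arbitrary: \<sigma> \<rho>)
    case (Eq s t) then show ?case by (simp add: val c_eq)
  next
    case (Less s t)
    have "Less (from_nat (c s')) (from_nat (c t')) \<in> H \<longleftrightarrow> Less s' t' \<in> H" for s' t'
      using less[OF c1 c1] less[OF sym[OF c1] sym[OF c1]] by blast
    then show ?case by (simp add: val) (simp add: M_def)
  next
    case (Mem t k) then show ?case by (simp add: val S_iff)
  next
    case Bot then show ?case by (simp add: bot)
  next
    case (Imp A B) then show ?case by (simp add: imp)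
  next
    case (Forall A)
    have "sat M (\<lambda>n. c (\<sigma> n)) (\<lambda>k. S (\<rho> k)) (Forall A) \<longleftrightarrow> (\<forall>t. sat M (case_nat (c t) (\<lambda>n. c (\<sigma> n))) (\<lambda>k. S (\<rho> k)) A)"
      by (simp add: M_def)
    also have "\<dots> \<longleftrightarrow> (\<forall>t. inst t (subst (up \<sigma>) \<rho> A) \<in> H)"
      unfolding cn subst_case_inst Forall.IH ..
    finally show ?case by (simp only: subst_Forall all)
  next
    case (ForallS A)
    have "sat M (\<lambda>n. c (\<sigma> n)) (\<lambda>k. S (\<rho> k)) (ForallS A) \<longleftrightarrow> (\<forall>k. sat M (\<lambda>n. c (\<sigma> n)) (case_nat (S k) (\<lambda>n. S (\<rho> n))) A)"
      by (simp add: M_def)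
    also have "\<dots> \<longleftrightarrow> (\<forall>k. instS k (subst \<sigma> (case_nat 0 (\<lambda>n. Suc (\<rho> n))) A) \<in> H)"
      unfolding cnS subst_case_instS ForallS.IH ..
    finally show ?case by (simp only: subst.simps allS)
  qed
  have "wf_structure M" by (auto simp: wf_structure_def M_def S_def)
  moreover have "models M T"
    unfolding models_def
  proof (intro ballI allI impI)
    fix A and e :: "nat \<Rightarrow> nat" and r :: "nat \<Rightarrow> nat set" assume A: "A \<in> T" and e: "range e \<subseteq> dom M" and r: "range r \<subseteq> ss M"
    have "\<forall>n. \<exists>t. e n = c t" using e by (auto simp: M_def image_subset_iff)
    then obtain \<sigma> where \<sigma>: "\<And>n. e n = c (\<sigma> n)" by metis
    have "\<forall>n. \<exists>k. r n = S k" using r by (auto simp: M_def image_subset_iff)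
    then obtain \<rho> where \<rho>: "\<And>n. r n = S (\<rho> n)" by metis
    have "e = (\<lambda>n. c (\<sigma> n))" "r = (\<lambda>n. S (\<rho> n))" using \<sigma> \<rho> by auto
    then show "sat M e r A" using truth prov[OF provable_subst[OF Ax[OF A]]] by simp
  qed
  moreover have "sat M (\<lambda>n. c (Var n)) S A \<longleftrightarrow> A \<in> H" for A
    using truth[of Var id A] by (simp add: subst_Var id_def)
  moreover have "range (\<lambda>n. c (Var n)) \<subseteq> dom M" "range S \<subseteq> ss M" by (auto simp: M_def)
  ultimately show ?thesis by blast
qed

theorem completeness:
  assumes "\<And>(M::nat model) e r. wf_structure M \<Longrightarrow> models M T \<Longrightarrow> range e \<subseteq> dom M \<Longrightarrow> range r \<subseteq> ss M \<Longrightarrow> sat M e r A"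
  shows "T \<turnstile> A"
proof (rule ccontr)
  assume "\<not> T \<turnstile> A"
  then obtain H where H: "henkin T H" "A \<notin> H" using henkin_exists by blast
  obtain M :: "nat model" and e r where "wf_structure M" "models M T" "range e \<subseteq> dom M" "range r \<subseteq> ss M"
    "\<forall>A. sat M e r A \<longleftrightarrow> A \<in> H"
    using henkin_structure[OF H(1)] by blast
  then show False using assms H(2) by blast
qed

section \<open>From arbitrary models to one fixed type of numbers\<close>

section \<open>The type of numbers of a model\<close>

text \<open>
  By completeness it suffices to verify the theorem in every model of RCA0. To make the numeric
  type classes available, the numbers have to form a type: it is built from a single model,
  chosen to violate one of the formulas in question if some model does. The standard model
  only guarantees that there is a model to choose.
\<close>

definition statements :: "nfm set" where
  "statements = {WPO_D, no_ascending_closed, no_ascending_fg_closed, closed_sets_fg, closed_sequences_fg}"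

definition equivalences :: "fm set" where
  "equivalences = {Iff (sentence P) (sentence Q) | P Q. P \<in> statements \<and> Q \<in> statements}"

definition refutes :: "nat model \<Rightarrow> fm \<Rightarrow> bool" where
  "refutes M A \<longleftrightarrow> (\<exists>e r. range e \<subseteq> dom M \<and> range r \<subseteq> ss M \<and> \<not> sat M e r A)"

definition rca0_model :: "nat model \<Rightarrow> bool" where
  "rca0_model M \<longleftrightarrow> wf_structure M \<and> models M RCA0"

definition the_model :: "nat model" where
  "the_model = (SOME M. rca0_model M \<and>
     ((\<exists>M'. rca0_model M' \<and> (\<exists>A\<in>equivalences. refutes M' A)) \<longrightarrow> (\<exists>A\<in>equivalences. refutes M A)))"

definition std_model :: "nat model" where
  "std_model = \<lparr>dom = UNIV, zr = 0, on = 1, ad = (+), ml = (*), ls = (<), ss = UNIV\<rparr>"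

lemma std_model_simps [simp]:
  "dom std_model = UNIV" "zr std_model = 0" "on std_model = 1" "ad std_model = (+)"
  "ml std_model = (*)" "ls std_model = (<)" "ss std_model = UNIV"
  by (auto simp: std_model_def)

lemmas named_formula_defs = nAll_def nEx_def nAllS_def nExS_def nImp_def nIff_def nDisj_def nConj_def
  nNeg_def nEq_def nLess_def nMem_def nLe_def nZero_def nOne_def nAdd_def nMul_def

lemma sat_inst: "sat M e r (inst t A) = sat M (case_nat (val M e t) e) r A"
proof -
  have "(\<lambda>n. val M e (case_nat t Var n)) = case_nat (val M e t) e" by (auto split: nat.splits)
  then show ?thesis by (simp add: inst_def sat_subst)
qed

lemma sat_succ_inst: "sat M (case_nat x e) r (succ_inst A) = sat M (case_nat (ad M x (on M)) e) r A"
proof -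
  have "(\<lambda>n. val M (case_nat x e) (case_nat (Add (Var 0) One) (\<lambda>n. Var (Suc n)) n)) = case_nat (ad M x (on M)) e"
    by (auto split: nat.splits)
  then show ?thesis by (simp add: succ_inst_def sat_subst)
qed

lemma sat_liftS: "sat M e (case_nat X r) (liftS A) = sat M e r A"
  by (simp add: liftS_def sat_subst)

lemma rca0_model_std: "rca0_model std_model"
  unfolding rca0_model_def wf_structure_def models_def
proof (intro conjI ballI allI impI)
  fix A e r assume "A \<in> RCA0"
  then consider "A \<in> basic_axioms" | "A \<in> Sigma01_induction" | "A \<in> Delta01_comprehension"
    unfolding RCA0_def by blast
  then show "sat std_model e r A"
  proof cases
    case 1
    then show ?thesis
      unfolding basic_axioms_def sentence_def named_formula_defs by auto
  next
    case 2
    then obtain B where A: "A = Imp (Conj (inst Zero B) (Forall (Imp B (succ_inst B)))) (Forall B)"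
      unfolding Sigma01_induction_def by blast
    have "sat std_model (case_nat x e) r B"
      if "sat std_model (case_nat 0 e) r B" "\<And>x. sat std_model (case_nat x e) r B \<Longrightarrow> sat std_model (case_nat (Suc x) e) r B" for x
      using that by (induction x) auto
    then show ?thesis by (simp add: A sat_inst sat_succ_inst)
next
    case 3
    have "\<exists>X. \<forall>x. (x \<in> X) = P x" for P :: "nat \<Rightarrow> bool" by (rule exI[of _ "Collect P"]) simp
    then show ?thesis using 3 by (auto simp: Delta01_comprehension_def sat_liftS)
  qed
qed auto

lemma the_model:
  "rca0_model the_model"
  "rca0_model M \<Longrightarrow> A \<in> equivalences \<Longrightarrow> refutes M A \<Longrightarrow> \<exists>A\<in>equivalences. refutes the_model A"
proof -
  let ?P = "\<lambda>M. rca0_model M \<and>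
     ((\<exists>M'. rca0_model M' \<and> (\<exists>A\<in>equivalences. refutes M' A)) \<longrightarrow> (\<exists>A\<in>equivalences. refutes M A))"
  have "\<exists>M. ?P M" using rca0_model_std by blast
  then have *: "?P the_model" unfolding the_model_def by (rule someI_ex)
  then show "rca0_model the_model" by blast
  show "rca0_model M \<Longrightarrow> A \<in> equivalences \<Longrightarrow> refutes M A \<Longrightarrow> \<exists>A\<in>equivalences. refutes the_model A"
    using * by blast
qed

lemma the_model_closed:
  "zr the_model \<in> dom the_model" "on the_model \<in> dom the_model"
  "x \<in> dom the_model \<Longrightarrow> y \<in> dom the_model \<Longrightarrow> ad the_model x y \<in> dom the_model"
  "x \<in> dom the_model \<Longrightarrow> y \<in> dom the_model \<Longrightarrow> ml the_model x y \<in> dom the_model"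
  "ss the_model \<subseteq> Pow (dom the_model)" "ss the_model \<noteq> {}"
  using the_model(1) unfolding rca0_model_def wf_structure_def by auto

typedef mnat = "dom the_model"
  using the_model_closed(1) by blast

instantiation mnat :: "{zero, one, plus, times, minus, ord}"
begin

definition "0 = Abs_mnat (zr the_model)"
definition "1 = Abs_mnat (on the_model)"
definition "x + y = Abs_mnat (ad the_model (Rep_mnat x) (Rep_mnat y))"
definition "x * y = Abs_mnat (ml the_model (Rep_mnat x) (Rep_mnat y))"
definition "x < y \<longleftrightarrow> ls the_model (Rep_mnat x) (Rep_mnat y)"
definition "x \<le> y \<longleftrightarrow> x < y \<or> x = (y::mnat)"
definition "x - y = (if y \<le> x then THE d. x = y + d else (0::mnat))"

instance ..

end

definition Sets :: "mnat set set" where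
  "Sets = {X. Rep_mnat ` X \<in> ss the_model}"

definition mm :: "mnat model" where
  "mm = \<lparr>dom = UNIV, zr = 0, on = 1, ad = (+), ml = (*), ls = (<), ss = Sets\<rparr>"

lemma mm_simps [simp]:
  "dom mm = UNIV" "zr mm = 0" "on mm = 1" "ad mm = (+)"
  "ml mm = (*)" "ls mm = (<)" "ss mm = Sets"
  by (auto simp: mm_def)

lemma Rep_mnat_ops:
  "Rep_mnat 0 = zr the_model" "Rep_mnat 1 = on the_model"
  "Rep_mnat (x + y) = ad the_model (Rep_mnat x) (Rep_mnat y)"
  "Rep_mnat (x * y) = ml the_model (Rep_mnat x) (Rep_mnat y)"
  by (simp_all add: zero_mnat_def one_mnat_def plus_mnat_def times_mnat_def Abs_mnat_inverse
      the_model_closed Rep_mnat)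

lemma val_iso: "val the_model (\<lambda>n. Rep_mnat (e n)) t = Rep_mnat (val mm e t)"
  by (induction t) (simp_all add: Rep_mnat_ops)

lemma ss_the_model: "ss the_model = (`) Rep_mnat ` Sets"
proof
  show "ss the_model \<subseteq> (`) Rep_mnat ` Sets"
  proof
    fix X assume X: "X \<in> ss the_model"
    then have "X \<subseteq> range Rep_mnat"
      using the_model_closed(5) type_definition.Rep_range[OF type_definition_mnat] by auto
    then have "X = Rep_mnat ` (Rep_mnat -` X)" by auto
    then show "X \<in> (`) Rep_mnat ` Sets" using X unfolding Sets_def by (metis imageI mem_Collect_eq)
  qed
qed (auto simp: Sets_def)

lemma sat_iso: "sat the_model (\<lambda>n. Rep_mnat (e n)) (\<lambda>k. Rep_mnat ` r k) A = sat mm e r A"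
proof (induction A arbitrary: e r)
  case (Forall A)
  have "case_nat (Rep_mnat x) (\<lambda>n. Rep_mnat (e n)) = (\<lambda>n. Rep_mnat (case_nat x e n))" for x
    by (auto split: nat.splits)
  then show ?case
    by (simp add: type_definition.Rep_range[OF type_definition_mnat, symmetric] Forall.IH)
next
  case (ForallS A)
  have "case_nat (Rep_mnat ` X) (\<lambda>n. Rep_mnat ` r n) = (\<lambda>n. Rep_mnat ` (case_nat X r n))" for X
    by (auto split: nat.splits)
  then show ?case by (simp add: ss_the_model ForallS.IH)
qed (auto simp: val_iso Rep_mnat_inject inj_image_mem_iff Rep_mnat_inject inj_on_def less_mnat_def)

lemma Sets_nonempty: "Sets \<noteq> {}"
  using the_model_closed(6) ss_the_model by auto

lemma sat_RCA0: "A \<in> RCA0 \<Longrightarrow> range r \<subseteq> Sets \<Longrightarrow> sat mm e r A"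
proof -
  assume A: "A \<in> RCA0" and r: "range r \<subseteq> Sets"
  have "range (\<lambda>n. Rep_mnat (e n)) \<subseteq> dom the_model" using Rep_mnat by blast
  moreover have "range (\<lambda>k. Rep_mnat ` r k) \<subseteq> ss the_model" using r ss_the_model by auto
  ultimately show ?thesis
    using the_model(1) A unfolding rca0_model_def models_def sat_iso[symmetric] by blast
qed

text \<open>A model that refutes \<open>A\<close> only guarantees that the chosen model refutes some
  equivalence \<open>B\<close>, possibly another one. Therefore the assumption concerns all
  equivalences at once.\<close>

theorem equivalences_provable:
  assumes "\<And>A e r. A \<in> equivalences \<Longrightarrow> range r \<subseteq> Sets \<Longrightarrow> sat mm e r A"
    and A: "A \<in> equivalences"
  shows "RCA0 \<turnstile> A"
proof (rule completeness)
  fix M :: "nat model" and e :: "nat \<Rightarrow> nat" and r :: "nat \<Rightarrow> nat set"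
  assume M: "wf_structure M" "models M RCA0" and er: "range e \<subseteq> dom M" "range r \<subseteq> ss M"
  show "sat M e r A"
  proof (rule ccontr)
    assume "\<not> sat M e r A"
    then have "refutes M A" using er unfolding refutes_def by blast
    then obtain B where B: "B \<in> equivalences" "refutes the_model B"
      using the_model(2) M A unfolding rca0_model_def by blast
    then obtain e r where e: "range (e :: nat \<Rightarrow> nat) \<subseteq> dom the_model" and r: "range r \<subseteq> ss the_model"
      and n: "\<not> sat the_model e r B"
      unfolding refutes_def by blast
    have "e n = Rep_mnat (Abs_mnat (e n))" for n using e by (simp add: Abs_mnat_inverse range_subsetD)
    then have "e = (\<lambda>n. Rep_mnat (Abs_mnat (e n)))" by blast
    moreover have "\<forall>k. \<exists>X. X \<in> Sets \<and> r k = Rep_mnat ` X" using r by (simp add: ss_the_model image_subset_iff) blast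
    then obtain r' where r': "\<And>k. r' k \<in> Sets" "\<And>k. r k = Rep_mnat ` r' k" by metis
    then have "r = (\<lambda>k. Rep_mnat ` r' k)" by auto
    ultimately have "\<not> sat mm (\<lambda>n. Abs_mnat (e n)) r' B" using n sat_iso[of "\<lambda>n. Abs_mnat (e n)" r' B] by simp
    then show False using assms(1)[OF B(1)] r' by blast
  qed
qed

section \<open>Sigma00 and Sigma01 definability in the model\<close>

section \<open>Definable predicates\<close>

text \<open>\<open>d0\<close> and \<open>sig\<close> are definability by a Sigma00 and a Sigma01 formula with set parameters only;
  number parameters become available through singletons (\<open>fn_const\<close> below).\<close>

definition tmv :: "((nat \<Rightarrow> mnat) \<Rightarrow> mnat) \<Rightarrow> bool" where
  "tmv f \<longleftrightarrow> (\<exists>t. f = (\<lambda>e. val mm e t))"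

definition d0 :: "((nat \<Rightarrow> mnat) \<Rightarrow> bool) \<Rightarrow> bool" where
  "d0 P \<longleftrightarrow> (\<exists>A r. A \<in> Sigma00 \<and> range r \<subseteq> Sets \<and> P = (\<lambda>e. sat mm e r A))"

definition sig :: "((nat \<Rightarrow> mnat) \<Rightarrow> bool) \<Rightarrow> bool" where
  "sig P \<longleftrightarrow> (\<exists>Q. d0 Q \<and> P = (\<lambda>e. \<exists>x. Q (case_nat x e)))"

lemma tmvE:
  assumes "tmv f"
  obtains t where "f = (\<lambda>e. val mm e t)"
  using assms unfolding tmv_def by (elim exE) (rule that)

lemma tmvI: "tmv (\<lambda>e. val mm e t)"
  unfolding tmv_def by (rule exI) (rule refl)

lemma tmv_var: "tmv (\<lambda>e. e n)" and tmv_zero: "tmv (\<lambda>e. 0)" and tmv_one: "tmv (\<lambda>e. 1)"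
  unfolding tmv_def
  by (rule exI[of _ "Var n"], simp, rule exI[of _ Zero], simp, rule exI[of _ One], simp)

lemma tmv_add: "tmv f \<Longrightarrow> tmv g \<Longrightarrow> tmv (\<lambda>e. f e + g e)"
proof -
  assume "tmv f" and tg: "tmv g"
  from \<open>tmv f\<close> obtain s where f: "f = (\<lambda>e. val mm e s)" by (rule tmvE)
  from tg obtain t where g: "g = (\<lambda>e. val mm e t)" by (rule tmvE)
  show ?thesis using tmvI[of "Add s t"] by (simp add: f g)
qed

lemma tmv_mult: "tmv f \<Longrightarrow> tmv g \<Longrightarrow> tmv (\<lambda>e. f e * g e)"
proof -
  assume "tmv f" and tg: "tmv g"
  from \<open>tmv f\<close> obtain s where f: "f = (\<lambda>e. val mm e s)" by (rule tmvE)
  from tg obtain t where g: "g = (\<lambda>e. val mm e t)" by (rule tmvE)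
  show ?thesis using tmvI[of "Mul s t"] by (simp add: f g)
qed

lemmas tmv_intros = tmv_var tmv_zero tmv_one tmv_add tmv_mult

lemma Sigma00_subst: "A \<in> Sigma00 \<Longrightarrow> subst \<sigma> \<rho> A \<in> Sigma00"
proof (induction arbitrary: \<sigma> rule: Sigma00.induct)
  case (6 A t)
  then show ?case
    using Sigma00.intros(6)[of "subst (up \<sigma>) \<rho> A" "subst_tm \<sigma> t"]
    by (simp add: subst_Forall subst_tm_up_lift up_def[of \<sigma>] del: subst.simps(6)) (simp add: up_def[symmetric] subst_tm_up_lift)
next
  case (7 A t)
  then show ?case
    using Sigma00.intros(7)[of "subst (up \<sigma>) \<rho> A" "subst_tm \<sigma> t"]
    by (simp add: Exists_def Conj_def Neg_def up_def[symmetric] subst_tm_up_lift) (simp add: up_def)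
qed (auto intro: Sigma00.intros)

lemma some_param: "\<exists>r :: nat \<Rightarrow> mnat set. range r \<subseteq> Sets"
  using Sets_nonempty by auto

lemma d0I: "A \<in> Sigma00 \<Longrightarrow> range r \<subseteq> Sets \<Longrightarrow> P = (\<lambda>e. sat mm e r A) \<Longrightarrow> d0 P"
  unfolding d0_def by (intro exI conjI)

lemma d0E:
  assumes "d0 P"
  obtains A r where "A \<in> Sigma00" "range r \<subseteq> Sets" "P = (\<lambda>e. sat mm e r A)"
  using assms unfolding d0_def by (elim exE conjE) (rule that)

lemma d0_eq: assumes "tmv f" "tmv g" shows "d0 (\<lambda>e. f e = g e)"
proof -
  obtain s where f: "f = (\<lambda>e. val mm e s)" using assms(1) by (rule tmvE)
  obtain t where g: "g = (\<lambda>e. val mm e t)" using assms(2) by (rule tmvE)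
  obtain r :: "nat \<Rightarrow> mnat set" where r: "range r \<subseteq> Sets" using some_param by (rule exE)
  show ?thesis by (rule d0I[OF Sigma00.intros(1) r]) (simp add: f g)
qed

lemma d0_less: assumes "tmv f" "tmv g" shows "d0 (\<lambda>e. f e < g e)"
proof -
  obtain s where f: "f = (\<lambda>e. val mm e s)" using assms(1) by (rule tmvE)
  obtain t where g: "g = (\<lambda>e. val mm e t)" using assms(2) by (rule tmvE)
  obtain r :: "nat \<Rightarrow> mnat set" where r: "range r \<subseteq> Sets" using some_param by (rule exE)
  show ?thesis by (rule d0I[OF Sigma00.intros(2) r]) (simp add: f g)
qed

lemma d0_mem: assumes "tmv f" "X \<in> Sets" shows "d0 (\<lambda>e. f e \<in> X)"
proof -
  obtain t where f: "f = (\<lambda>e. val mm e t)" using assms(1) by (rule tmvE)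
  have "range (\<lambda>_::nat. X) \<subseteq> Sets" using assms(2) by auto
  then show ?thesis by (rule d0I[OF Sigma00.intros(3)]) (simp add: f)
qed

lemma d0_False: "d0 (\<lambda>e. False)"
proof -
  obtain r :: "nat \<Rightarrow> mnat set" where r: "range r \<subseteq> Sets" using some_param by (rule exE)
  show ?thesis by (rule d0I[OF Sigma00.intros(4) r]) simp
qed

text \<open>The set parameters of the two formulas are interleaved at even and odd indices, so that
  one assignment serves both.\<close>

lemma d0_common:
  assumes "d0 P" "d0 Q"
  obtains A B r where "A \<in> Sigma00" "B \<in> Sigma00" "range r \<subseteq> Sets"
    "P = (\<lambda>e. sat mm e r A)" "Q = (\<lambda>e. sat mm e r B)"
proof -
  obtain A r where A: "A \<in> Sigma00" "range r \<subseteq> Sets" "P = (\<lambda>e. sat mm e r A)" using assms(1) by (rule d0E)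
  obtain B s where B: "B \<in> Sigma00" "range s \<subseteq> Sets" "Q = (\<lambda>e. sat mm e s B)" using assms(2) by (rule d0E)
  define u where "u n = (if even n then r (n div 2) else s (n div 2))" for n
  have "range u \<subseteq> Sets" using A B by (auto simp: u_def image_subset_iff)
  moreover have "P = (\<lambda>e. sat mm e u (subst Var (\<lambda>n. 2 * n) A))" "Q = (\<lambda>e. sat mm e u (subst Var (\<lambda>n. 2 * n + 1) B))"
    by (simp_all add: sat_subst A B u_def)
  ultimately show ?thesis by (rule that[OF Sigma00_subst[OF A(1)] Sigma00_subst[OF B(1)]])
qed

lemma d0_imp: assumes "d0 P" "d0 Q" shows "d0 (\<lambda>e. P e \<longrightarrow> Q e)"
proof -
  obtain A B r where A: "A \<in> Sigma00" "B \<in> Sigma00" "range r \<subseteq> Sets"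
    "P = (\<lambda>e. sat mm e r A)" "Q = (\<lambda>e. sat mm e r B)"
    using assms by (rule d0_common)
  show ?thesis by (rule d0I[OF Sigma00.intros(5)[OF A(1,2)] A(3)]) (simp add: A)
qed

lemma d0_not: "d0 P \<Longrightarrow> d0 (\<lambda>e. \<not> P e)"
  using d0_imp[OF _ d0_False] by simp

lemma d0_conj: "d0 P \<Longrightarrow> d0 Q \<Longrightarrow> d0 (\<lambda>e. P e \<and> Q e)"
  using d0_not[OF d0_imp[OF _ d0_not]] by simp

lemma d0_disj: "d0 P \<Longrightarrow> d0 Q \<Longrightarrow> d0 (\<lambda>e. P e \<or> Q e)"
  using d0_imp[OF d0_not] by (simp add: disj_imp)

text \<open>The convention for binders from here on: a body \<open>P x e\<close> is presented with
  its bound variable at index 0 and the outer environment shifted by one.\<close>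

lemma d0_ball:
  assumes "tmv f" "d0 (\<lambda>e. P (e 0) (\<lambda>n. e (Suc n)))"
  shows "d0 (\<lambda>e. \<forall>x. x < f e \<longrightarrow> P x e)"
proof -
  obtain t where t: "f = (\<lambda>e. val mm e t)" using assms(1) by (rule tmvE)
  obtain A r where A: "A \<in> Sigma00" "range r \<subseteq> Sets" "(\<lambda>e. P (e 0) (\<lambda>n. e (Suc n))) = (\<lambda>e. sat mm e r A)"
    using assms(2) by (rule d0E)
  have "sat mm (case_nat x e) r A = P x e" for x e
    using fun_cong[OF A(3), of "case_nat x e"] by simp
  then show ?thesis
    by (intro d0I[OF Sigma00.intros(6)[OF A(1)] A(2)]) (simp add: t val_lift)
qed

lemma d0_bex:
  assumes "tmv f" "d0 (\<lambda>e. P (e 0) (\<lambda>n. e (Suc n)))"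
  shows "d0 (\<lambda>e. \<exists>x. x < f e \<and> P x e)"
  using d0_not[OF d0_ball[OF assms(1), of "\<lambda>x e. \<not> P x e"]] d0_not[OF assms(2)] by simp

lemma d0_subst:
  assumes "d0 P" "\<And>n. tmv (g n)"
  shows "d0 (\<lambda>e. P (\<lambda>n. g n e))"
proof -
  obtain A r where A: "A \<in> Sigma00" "range r \<subseteq> Sets" "P = (\<lambda>e. sat mm e r A)"
    using assms(1) by (rule d0E)
  have "\<exists>t. g n = (\<lambda>e. val mm e t)" for n using assms(2)[of n] unfolding tmv_def .
  then have "\<forall>n. \<exists>t. g n = (\<lambda>e. val mm e t)" by (rule allI)
  then obtain \<sigma> where "\<forall>n. g n = (\<lambda>e. val mm e (\<sigma> n))" by (rule choice[THEN exE])
  then show ?thesis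
    by (intro d0I[OF Sigma00_subst[OF A(1), of \<sigma> "\<lambda>n. n"] A(2)]) (simp add: A(3) sat_subst)
qed

lemma sigI: "d0 Q \<Longrightarrow> (\<And>e. P e = (\<exists>x. Q (case_nat x e))) \<Longrightarrow> sig P"
  unfolding sig_def by (intro exI[of _ Q] conjI ext)

lemma sigE:
  assumes "sig P"
  obtains Q where "d0 Q" "P = (\<lambda>e. \<exists>x. Q (case_nat x e))"
  using assms unfolding sig_def by (elim exE conjE) (rule that)

lemma sig_d0: assumes "d0 P" shows "sig P"
  by (rule sigI[of "\<lambda>e. P (\<lambda>n. e (Suc n))"]) (auto intro: d0_subst assms tmv_intros)

lemma sig_exD0: "d0 (\<lambda>e. P (e 0) (\<lambda>n. e (Suc n))) \<Longrightarrow> sig (\<lambda>e. \<exists>x. P x e)"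
  by (rule sigI) auto

lemma sig_subst:
  assumes "sig P" "\<And>n. tmv (g n)"
  shows "sig (\<lambda>e. P (\<lambda>n. g n e))"
proof -
  obtain Q where Q: "d0 Q" "P = (\<lambda>e. \<exists>x. Q (case_nat x e))" using assms(1) by (rule sigE)
  have g: "tmv (\<lambda>e. g n (\<lambda>n. e (Suc n)))" for n
  proof -
    obtain t where t: "g n = (\<lambda>e. val mm e t)" using assms(2)[of n] by (rule tmvE)
    show ?thesis using tmvI[of "lift_tm t"] by (simp add: t lift_tm_def val_subst)
  qed
  define h where "h = case_nat (\<lambda>e. e 0) (\<lambda>n e. g n (\<lambda>n. e (Suc n)))"
  have "tmv (h n)" for n unfolding h_def by (cases n) (auto intro: g tmv_intros)
  then have "d0 (\<lambda>e. Q (\<lambda>n. h n e))" using d0_subst[OF Q(1)] by blast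
  moreover have "(\<lambda>n. h n (case_nat x e)) = case_nat x (\<lambda>n. g n e)" for x e
    by (auto simp: h_def split: nat.splits)
  ultimately show ?thesis using Q(2) by (intro sigI[of "\<lambda>e. Q (\<lambda>n. h n e)"]) auto
qed

lemma sig_induct:
  assumes "sig P" "P (case_nat 0 e)" "\<And>x. P (case_nat x e) \<Longrightarrow> P (case_nat (x + 1) e)"
  shows "P (case_nat x e)"
proof -
  obtain Q where Q: "d0 Q" "P = (\<lambda>e. \<exists>x. Q (case_nat x e))" using assms(1) by (rule sigE)
  obtain A r where A: "A \<in> Sigma00" "range r \<subseteq> Sets" "Q = (\<lambda>e. sat mm e r A)" using Q(1) by (rule d0E)
  have P: "P e = sat mm e r (Exists A)" for e unfolding Q A(3) by simp
  let ?I = "Imp (Conj (inst Zero (Exists A)) (Forall (Imp (Exists A) (succ_inst (Exists A))))) (Forall (Exists A))"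
  have "?I \<in> RCA0" unfolding RCA0_def Sigma01_induction_def Sigma01_def using A(1) by blast
  from sat_RCA0[OF this A(2), of e]
  have "sat mm (case_nat 0 e) r (Exists A) \<longrightarrow>
      (\<forall>x. sat mm (case_nat x e) r (Exists A) \<longrightarrow> sat mm (case_nat (x + 1) e) r (Exists A)) \<longrightarrow>
      (\<forall>x. sat mm (case_nat x e) r (Exists A))"
    by (simp only: sat.simps(5,6) sat_defined(2) sat_inst sat_succ_inst mm_simps val.simps ball_UNIV imp_conjL)
  then show ?thesis using assms(2,3) unfolding P[symmetric] by blast
qed

text \<open>The negated matrix of the Sigma01 definition of the complement provides the Pi01 formula
  that the axiom asks for.\<close>

lemma comprehension:
  assumes "sig P" "sig (\<lambda>e. \<not> P e)"
  shows "{x. P (case_nat x e)} \<in> Sets"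
proof -
  obtain Q where Q: "d0 Q" "P = (\<lambda>e. \<exists>x. Q (case_nat x e))" using assms(1) by (rule sigE)
  obtain R where R: "d0 R" "(\<lambda>e. \<not> P e) = (\<lambda>e. \<exists>x. R (case_nat x e))" using assms(2) by (rule sigE)
  obtain A B r where A: "A \<in> Sigma00" "B \<in> Sigma00" "range r \<subseteq> Sets" "Q = (\<lambda>e. sat mm e r A)"
    "(\<lambda>e. \<not> R e) = (\<lambda>e. sat mm e r B)"
    using Q(1) d0_not[OF R(1)] by (rule d0_common)
  have P1: "P e = sat mm e r (Exists A)" for e unfolding Q A(4) by simp
  have P2: "P e = sat mm e r (Forall B)" for e
    using fun_cong[OF R(2), of e] fun_cong[OF A(5)] by auto
  let ?I = "Imp (Forall (Iff (Exists A) (Forall B))) (ExistsS (Forall (Iff (Mem (Var 0) 0) (liftS (Exists A)))))"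
  have "?I \<in> RCA0" unfolding RCA0_def Delta01_comprehension_def Sigma01_def Pi01_def using A(1,2) by blast
  from sat_RCA0[OF this A(3), of e]
  have "(\<forall>x. sat mm (case_nat x e) r (Exists A) = sat mm (case_nat x e) r (Forall B)) \<longrightarrow>
      (\<exists>X\<in>Sets. \<forall>x. (x \<in> X) = sat mm (case_nat x e) r (Exists A))"
    by (simp only: sat.simps(3,5,6) sat_defined(4,6) sat_liftS mm_simps val.simps ball_UNIV nat.case)
  then obtain X where "X \<in> Sets" "\<forall>x. (x \<in> X) = P (case_nat x e)"
    unfolding P1[symmetric] P2[symmetric] by blast
  then have "{x. P (case_nat x e)} = X" by blast
  then show ?thesis using \<open>X \<in> Sets\<close> by simp
qed

section \<open>Ordered semiring laws from Sigma01 induction\<close>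

section \<open>Arithmetic\<close>

lemma basic_axioms_sat: "A \<in> basic_axioms \<Longrightarrow> sat mm e (\<lambda>_. SOME X. X \<in> Sets) A"
  using sat_RCA0[of A "\<lambda>_. SOME X. X \<in> Sets"] Sets_nonempty some_in_eq[of Sets] unfolding RCA0_def by auto

lemma mnat_axioms:
  "x + 1 \<noteq> (0::mnat)"
  "x + 1 = y + 1 \<Longrightarrow> x = (y::mnat)"
  "x + 0 = (x::mnat)"
  "x + (y + 1) = (x + y) + (1::mnat)"
  "x * 0 = (0::mnat)"
  "x * (y + 1) = x * y + (x::mnat)"
  "\<not> x < (0::mnat)"
  "x < y + 1 \<longleftrightarrow> x < y \<or> x = (y::mnat)"
proof -
  have "\<forall>A\<in>basic_axioms. sat mm (\<lambda>_. 0) (\<lambda>_. SOME X. X \<in> Sets) A" using basic_axioms_sat by blast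
  note * = this[unfolded basic_axioms_def sentence_def named_formula_defs, simplified]
  show "x + 1 \<noteq> 0" "x + 1 = y + 1 \<Longrightarrow> x = y" "x + 0 = x" "x + (y + 1) = (x + y) + 1"
    "x * 0 = 0" "x * (y + 1) = x * y + x" "\<not> x < 0" "x < y + 1 \<longleftrightarrow> x < y \<or> x = y"
    using * by auto
qed

text \<open>The two parameters travel in the environment, because at this stage elements of the
  model are not yet available as constants of definable predicates.\<close>

lemma sig_induct3:
  assumes "sig (\<lambda>e. P (e 0) (e 1) (e (Suc 1)))" "P 0 a b" "\<And>x. P x a b \<Longrightarrow> P (x + 1) a b"
  shows "P x a b"
  using sig_induct[of "\<lambda>e. P (e 0) (e 1) (e (Suc 1))" "\<lambda>n. if n = 0 then a else b" x] assms by simp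

lemma d0_induct3:
  assumes "d0 (\<lambda>e. P (e 0) (e 1) (e (Suc 1)))" "P 0 a b" "\<And>x. P x a b \<Longrightarrow> P (x + 1) a b"
  shows "P x a b"
  using sig_induct3[OF sig_d0[OF assms(1)]] assms(2,3) .

lemmas d0_intros = d0_eq d0_less d0_mem d0_imp d0_not d0_conj d0_disj tmv_intros

lemma mnat_0_add: "0 + x = (x::mnat)"
proof (rule d0_induct3[of "\<lambda>x a b. 0 + x = x" 0 0 x])
  fix x :: mnat assume "0 + x = x" then show "0 + (x + 1) = x + 1" by (simp only: mnat_axioms(4))
qed (intro d0_intros, rule mnat_axioms(3))

lemma mnat_Suc_add: "(a + 1) + x = (a + x) + (1::mnat)"
proof (rule d0_induct3[of "\<lambda>x a b. (a + 1) + x = (a + x) + 1" a 0 x])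
  fix x :: mnat assume "(a + 1) + x = (a + x) + 1"
  then show "(a + 1) + (x + 1) = (a + (x + 1)) + 1" by (simp only: mnat_axioms(4))
qed (intro d0_intros, simp only: mnat_axioms(3))

lemma mnat_add_comm: "a + x = x + (a::mnat)"
proof (rule d0_induct3[of "\<lambda>x a b. a + x = x + a" a 0 x])
  fix x :: mnat assume "a + x = x + a"
  then show "a + (x + 1) = (x + 1) + a" by (simp only: mnat_axioms(4) mnat_Suc_add)
qed (intro d0_intros, simp only: mnat_axioms(3) mnat_0_add)

lemma mnat_add_assoc: "(a + b) + x = a + (b + (x::mnat))"
proof (rule d0_induct3[of "\<lambda>x a b. (a + b) + x = a + (b + x)" a b x])
  fix x :: mnat assume "(a + b) + x = a + (b + x)"
  then show "(a + b) + (x + 1) = a + (b + (x + 1))" by (simp only: mnat_axioms(4))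
qed (intro d0_intros, simp only: mnat_axioms(3))

lemma mnat_add_cancel: "x + a = x + b \<Longrightarrow> a = (b::mnat)"
proof -
  have "x + a = x + b \<longrightarrow> a = b"
  proof (rule d0_induct3[of "\<lambda>x a b. x + a = x + b \<longrightarrow> a = b" a b x])
    fix x :: mnat assume "x + a = x + b \<longrightarrow> a = b"
    then show "(x + 1) + a = (x + 1) + b \<longrightarrow> a = b" 
      using mnat_axioms(2)[of "x + a" "x + b"] unfolding mnat_Suc_add by blast
  qed (intro d0_intros, simp only: mnat_0_add simp_thms)
  then show "x + a = x + b \<Longrightarrow> a = b" by blast
qed

instance mnat :: comm_monoid_add
  by standard (rule mnat_add_assoc mnat_add_comm mnat_0_add)+

lemma mnat_0_mult: "0 * x = (0::mnat)"
proof (rule d0_induct3[of "\<lambda>x a b. 0 * x = 0" 0 0 x])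
  fix x :: mnat assume "0 * x = 0" then show "0 * (x + 1) = 0" by (simp only: mnat_axioms(6) add_0_right)
qed (intro d0_intros, rule mnat_axioms(5))

lemma mnat_Suc_mult: "(a + 1) * x = a * x + (x::mnat)"
proof (rule d0_induct3[of "\<lambda>x a b. (a + 1) * x = a * x + x" a 0 x])
  fix x :: mnat assume *: "(a + 1) * x = a * x + x"
  show "(a + 1) * (x + 1) = a * (x + 1) + (x + 1)"
    unfolding mnat_axioms(6) * by (simp only: ac_simps)
qed (intro d0_intros, simp only: mnat_axioms(5) add_0_right)

lemma mnat_mult_comm: "a * x = x * (a::mnat)"
proof (rule d0_induct3[of "\<lambda>x a b. a * x = x * a" a 0 x])
  fix x :: mnat assume "a * x = x * a"
  then show "a * (x + 1) = (x + 1) * a" by (simp only: mnat_axioms(6) mnat_Suc_mult)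
qed (intro d0_intros, simp only: mnat_axioms(5) mnat_0_mult)

lemma mnat_distrib: "a * (b + x) = a * b + a * (x::mnat)"
proof (rule d0_induct3[of "\<lambda>x a b. a * (b + x) = a * b + a * x" a b x])
  fix x :: mnat assume "a * (b + x) = a * b + a * x"
  then show "a * (b + (x + 1)) = a * b + a * (x + 1)"
    by (simp only: mnat_axioms(6) add.assoc[symmetric])
qed (intro d0_intros, simp only: mnat_axioms(5) add_0_right)

lemma mnat_mult_assoc: "(a * b) * x = a * (b * (x::mnat))"
proof (rule d0_induct3[of "\<lambda>x a b. (a * b) * x = a * (b * x)" a b x])
  fix x :: mnat assume *: "(a * b) * x = a * (b * x)"
  show "(a * b) * (x + 1) = a * (b * (x + 1))" unfolding mnat_axioms(6) unfolding mnat_distrib unfolding * ..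
qed (intro d0_intros, simp only: mnat_axioms(5))

lemma mnat_1_mult: "1 * x = (x::mnat)"
  using mnat_Suc_mult[of 0 x] by (simp only: mnat_0_mult add_0_left)

instance mnat :: comm_semiring_1
proof
  fix a b c :: mnat
  show "a * b * c = a * (b * c)" by (rule mnat_mult_assoc)
  show "a * b = b * a" by (rule mnat_mult_comm)
  show "1 * a = a" by (rule mnat_1_mult)
  show "0 * a = 0" by (rule mnat_0_mult)
  show "a * 0 = 0" by (rule mnat_axioms(5))
  show "(a + b) * c = a * c + b * c" by (simp only: mnat_distrib mnat_mult_comm[of _ c])
  show "(0::mnat) \<noteq> 1" using mnat_axioms(1)[of 0] by (metis add_0_left)
qed

lemma mnat_less_trans: "x < y \<Longrightarrow> y < z \<Longrightarrow> x < (z::mnat)"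
proof -
  have "x < y \<longrightarrow> y < z \<longrightarrow> x < z"
  proof (rule d0_induct3[of "\<lambda>z x y. x < y \<longrightarrow> y < z \<longrightarrow> x < z" x y z])
  qed (intro d0_intros, auto simp: mnat_axioms(7,8))
  then show "x < y \<Longrightarrow> y < z \<Longrightarrow> x < z" by blast
qed

lemma mnat_zero_less_Suc: "0 < x + (1::mnat)"
proof (rule d0_induct3[of "\<lambda>x a b. 0 < x + 1" 0 0 x])
qed (intro d0_intros, auto simp: mnat_axioms(8) simp del: add_0_left)

lemma mnat_Suc_less: "a < x \<Longrightarrow> a + 1 < x + (1::mnat)"
proof -
  have "a < x \<longrightarrow> a + 1 < x + 1"
  proof (rule d0_induct3[of "\<lambda>x a b. a < x \<longrightarrow> a + 1 < x + 1" a 0 x])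
  qed (intro d0_intros, auto simp: mnat_axioms(7,8))
  then show "a < x \<Longrightarrow> a + 1 < x + 1" by blast
qed

lemma mnat_less_Suc_self: "x < x + (1::mnat)"
  by (simp add: mnat_axioms(8))

lemma mnat_less_irrefl: "\<not> x < (x::mnat)"
proof (rule d0_induct3[of "\<lambda>x a b. \<not> x < x" 0 0 x])
  fix x :: mnat assume "\<not> x < x"
  then show "\<not> x + 1 < x + 1" using mnat_less_trans mnat_less_Suc_self mnat_axioms(8) by metis
qed (intro d0_intros, rule mnat_axioms(7))

lemma mnat_zero_or: "x = 0 \<or> 0 < (x::mnat)"
proof (rule d0_induct3[of "\<lambda>x a b. x = 0 \<or> 0 < x" 0 0 x])
qed (intro d0_intros, auto simp: mnat_zero_less_Suc)

lemma mnat_linear: "a < x \<or> a = x \<or> x < (a::mnat)"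
proof (rule d0_induct3[of "\<lambda>x a b. a < x \<or> a = x \<or> x < a" a 0 x])
  fix x assume "a < x \<or> a = x \<or> x < a"
  then show "a < x + 1 \<or> a = x + 1 \<or> x + 1 < a"
    using mnat_Suc_less[of x a] by (auto simp: mnat_axioms(8))
qed (intro d0_intros, use mnat_zero_or in auto)

lemma mnat_add_less: "a < b \<Longrightarrow> x + a < x + (b::mnat)"
proof -
  have "a < b \<longrightarrow> x + a < x + b"
  proof (rule d0_induct3[of "\<lambda>x a b. a < b \<longrightarrow> x + a < x + b" a b x])
    fix x assume "a < b \<longrightarrow> x + a < x + b"
    then show "a < b \<longrightarrow> x + 1 + a < x + 1 + b" 
      using mnat_Suc_less[of "x + a" "x + b"] unfolding mnat_Suc_add by blast
  qed (intro d0_intros, simp)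
  then show "a < b \<Longrightarrow> x + a < x + b" by blast
qed

instance mnat :: linorder
proof
  fix x y z :: mnat
  show "(x < y) = (x \<le> y \<and> \<not> y \<le> x)" "x \<le> x" "x \<le> y \<Longrightarrow> y \<le> z \<Longrightarrow> x \<le> z"
    "x \<le> y \<Longrightarrow> y \<le> x \<Longrightarrow> x = y" "x \<le> y \<or> y \<le> x"
    using mnat_less_trans mnat_less_irrefl mnat_linear unfolding less_eq_mnat_def by metis+
qed

lemma mnat_mult_less_Suc: "a < b \<Longrightarrow> (x + 1) * a < (x + 1) * (b::mnat)"
proof -
  have "a < b \<longrightarrow> (x + 1) * a < (x + 1) * b"
  proof (rule d0_induct3[of "\<lambda>x a b. a < b \<longrightarrow> (x + 1) * a < (x + 1) * b" a b x])
    fix x assume *: "a < b \<longrightarrow> (x + 1) * a < (x + 1) * b"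
    show "a < b \<longrightarrow> (x + 1 + 1) * a < (x + 1 + 1) * b"
    proof
      assume "a < b"
      then have "(x + 1) * a + a < (x + 1) * a + b" "b + (x + 1) * a < b + (x + 1) * b"
        using * mnat_add_less by blast+
      then show "(x + 1 + 1) * a < (x + 1 + 1) * b"
        unfolding mnat_Suc_mult[of "x + 1"] by (metis add.commute less_trans)
    qed
  qed (intro d0_intros, simp)
  then show "a < b \<Longrightarrow> (x + 1) * a < (x + 1) * b" by blast
qed

lemma mnat_pos_Suc: "0 < x \<Longrightarrow> \<exists>y. x = y + (1::mnat)"
proof -
  \<comment> \<open>The existential quantifier is moved to the front to obtain a Sigma01 induction
    statement.\<close>
  have "\<exists>y. 0 < x \<longrightarrow> x = y + 1"
    by (rule sig_induct3[of "\<lambda>x a b. \<exists>y. 0 < x \<longrightarrow> x = y + 1" 0 0 x])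
      (intro sig_exD0 d0_intros, auto)
  then show "0 < x \<Longrightarrow> \<exists>y. x = y + 1" by blast
qed

lemma mnat_le_add: "b \<le> a \<Longrightarrow> \<exists>d. a = b + (d::mnat)"
proof -
  have "\<exists>d. b < a \<or> a = b \<longrightarrow> a = b + d"
  proof (rule sig_induct3[of "\<lambda>a b c. \<exists>d. b < a \<or> a = b \<longrightarrow> a = b + d" b 0 a])
    fix x assume *: "\<exists>d. b < x \<or> x = b \<longrightarrow> x = b + d"
    show "\<exists>d. b < x + 1 \<or> x + 1 = b \<longrightarrow> x + 1 = b + d"
    proof (cases "b < x \<or> x = b")
      case True
      then obtain d where "x = b + d" using * by blast
      then have "x + 1 = b + (d + 1)" by (simp only: ac_simps)
      then show ?thesis by blast
    next
      case False
      then have "b < x + 1 \<or> x + 1 = b \<longrightarrow> x + 1 = b + 0" by (auto simp: mnat_axioms(8))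
      then show ?thesis by blast
    qed
  qed (intro sig_exD0 d0_intros, auto simp: mnat_axioms(7) intro: exI[of _ 0])
  then show "b \<le> a \<Longrightarrow> \<exists>d. a = b + d" unfolding less_eq_mnat_def by auto
qed

lemma mnat_minus: "(a + b) - a = (b::mnat)" "a < b \<Longrightarrow> a - b = (0::mnat)"
proof -
  have "0 \<le> b" using mnat_zero_or[of b] by (auto simp: less_eq_mnat_def)
  then have "a \<le> a + b" using mnat_add_less[of 0 b a] by (auto simp: less_eq_mnat_def)
  moreover have "(THE d. a + b = a + d) = b" using mnat_add_cancel by blast
  ultimately show "(a + b) - a = b" unfolding minus_mnat_def by simp
  show "a < b \<Longrightarrow> a - b = 0" unfolding minus_mnat_def by auto
qed

lemma mnat_minus_minus: "a - b - c = a - (b + (c::mnat))"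
proof -
  consider d where "a = b + c + d" | d where "a = b + d" "d < c" | "a < b"
    by (metis mnat_le_add add.assoc not_le)
  then show ?thesis
  proof cases
    case (1 d)
    have "a - b - c = d" unfolding 1 add.assoc mnat_minus(1) ..
    moreover have "a - (b + c) = d" unfolding 1 by (rule mnat_minus(1))
    ultimately show ?thesis by simp
  next
    case (2 d)
    then have "a < b + c" using mnat_add_less by blast
    with 2 show ?thesis by (simp only: mnat_minus)
  next
    case 3
    have "0 \<le> c" using mnat_zero_or[of c] by (auto simp: less_eq_mnat_def)
    then have "a < b + c" using 3 mnat_add_less[of 0 c b] by (auto simp: less_eq_mnat_def)
    have "0 - c = 0" by (metis \<open>0 \<le> c\<close> add_0_left le_less mnat_minus)
    then show ?thesis using 3 \<open>a < b + c\<close> by (simp only: mnat_minus)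
  qed
qed

instance mnat :: discrete_linordered_semidom
proof
  fix a b c :: mnat
  show am: "a + b - a = b" for a b :: mnat by (rule mnat_minus)
  show "a - b - c = a - (b + c)" by (rule mnat_minus_minus)
  show le: "a \<le> b \<Longrightarrow> c + a \<le> c + b" for a b c :: mnat using mnat_add_less by (auto simp: less_eq_mnat_def)
  show z: "0 < (1::mnat)" using mnat_zero_less_Suc[of 0] by simp
  show ml: "a < b \<Longrightarrow> 0 < c \<Longrightarrow> c * a < c * b" for a b c :: mnat
    using mnat_pos_Suc[of c] mnat_mult_less_Suc by blast
  show "a - b + b = a" if ba: "b \<le> a"
  proof -
    obtain d where "a = b + d" using mnat_le_add[OF ba] by blast
    then show ?thesis by (simp only: am) (rule add.commute)
  qed
  show "a \<noteq> 0 \<Longrightarrow> b \<noteq> 0 \<Longrightarrow> a * b \<noteq> 0"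
    using ml[of 0 b a] mnat_zero_or[of a] mnat_zero_or[of b] by (auto simp: mnat_less_irrefl)
  show "(a < b) = (a + 1 \<le> b)"
    using mnat_Suc_less[of a b] mnat_axioms(8)[of "a + 1" b] mnat_less_Suc_self[of a] mnat_less_trans
    unfolding less_eq_mnat_def by metis
  show "a * (b - c) = a * b - a * c"
  proof (cases "c \<le> b")
    case True
    then obtain d where "b = c + d" using mnat_le_add by blast
    then show ?thesis by (simp add: distrib_left am)
  next
    case False
    then have "b < c" by simp
    have "a * b - a * c = 0"
    proof (cases "0 < a")
      case True
      then show ?thesis using \<open>b < c\<close> ml mnat_minus(2) by blast
    next
      case False
      then have "a = 0" using mnat_zero_or by blast
      then show ?thesis using am[of 0 0] by simp
    qed
    then show ?thesis using \<open>b < c\<close> by (simp add: mnat_minus(2))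
  qed
qed

lemma mnat_zero_le [simp]: "0 \<le> (x::mnat)"
  using mnat_zero_or[of x] by auto

lemma mnat_not_less_zero [simp]: "\<not> x < (0::mnat)"
  by (simp add: not_less)

lemma mnat_le_zero [simp]: "x \<le> 0 \<longleftrightarrow> x = (0::mnat)"
  by (simp add: antisym_conv)

lemma mnat_less_Suc: "x < y + 1 \<longleftrightarrow> x \<le> (y::mnat)"
  using mnat_axioms(8) le_less by blast

lemma mnat_Suc_le: "x + 1 \<le> y \<longleftrightarrow> x < (y::mnat)"
  by (simp add: less_iff_succ_less_eq)

subsection \<open>Embedding into an ordered ring\<close>

text \<open>The decision procedure for linear arithmetic needs a ring.\<close>

definition mint_rel :: "mnat \<times> mnat \<Rightarrow> mnat \<times> mnat \<Rightarrow> bool" where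
  "mint_rel x y \<longleftrightarrow> fst x + snd y = fst y + snd x"

quotient_type mint = "mnat \<times> mnat" / mint_rel
proof (rule equivpI)
  show "reflp mint_rel" by (auto simp: reflp_def mint_rel_def)
  show "symp mint_rel" by (auto simp: symp_def mint_rel_def)
  show "transp mint_rel"
  proof (rule transpI)
    fix x y z assume "mint_rel x y" "mint_rel y z"
    then have "(fst x + snd z) + snd y = (fst z + snd x) + snd y"
      unfolding mint_rel_def by (metis add.assoc add.commute)
    then show "mint_rel x z" unfolding mint_rel_def by simp
  qed
qed

instantiation mint :: linordered_idom
begin

lift_definition zero_mint :: mint is "(0, 0)" .
lift_definition one_mint :: mint is "(1, 0)" .
lift_definition plus_mint :: "mint \<Rightarrow> mint \<Rightarrow> mint" is "\<lambda>x y. (fst x + fst y, snd x + snd y)"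
  by (simp add: mint_rel_def) (metis add.assoc add.commute)
lift_definition uminus_mint :: "mint \<Rightarrow> mint" is "\<lambda>x. (snd x, fst x)"
  by (simp add: mint_rel_def add.commute)
lift_definition minus_mint :: "mint \<Rightarrow> mint \<Rightarrow> mint" is "\<lambda>x y. (fst x + snd y, snd x + fst y)"
  by (simp add: mint_rel_def) (metis add.assoc add.commute)
lift_definition times_mint :: "mint \<Rightarrow> mint \<Rightarrow> mint" is
  "\<lambda>x y. (fst x * fst y + snd x * snd y, fst x * snd y + snd x * fst y)"
proof -
  fix x x' y y' assume *: "mint_rel x x'" "mint_rel y y'"
  obtain a b a' b' c d c' d' where xy: "x = (a, b)" "x' = (a', b')" "y = (c, d)" "y' = (c', d')"
    by (metis surj_pair)
  have 1: "a + b' = a' + b" and 2: "c + d' = c' + d" using * xy by (simp_all add: mint_rel_def)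
  \<comment> \<open>Well-definedness is shown one factor at a time: \<open>A\<close> replaces the
    first pair, \<open>B\<close> the second.\<close>
  have "(a * c + b * d) + (a' * d + b' * c) = (a + b') * c + (a' + b) * d" by (simp add: algebra_simps)
  also have "\<dots> = (a' + b) * c + (a + b') * d" unfolding 1 by simp
  also have "\<dots> = (a' * c + b' * d) + (a * d + b * c)" by (simp add: algebra_simps)
  finally have A: "mint_rel (a * c + b * d, a * d + b * c) (a' * c + b' * d, a' * d + b' * c)"
    by (simp add: mint_rel_def)
  have "(a' * c + b' * d) + (a' * d' + b' * c') = a' * (c + d') + b' * (c' + d)" by (simp add: algebra_simps)
  also have "\<dots> = a' * (c' + d) + b' * (c + d')" unfolding 2 by simp
  also have "\<dots> = (a' * c' + b' * d') + (a' * d + b' * c)" by (simp add: algebra_simps)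
  finally have B: "mint_rel (a' * c + b' * d, a' * d + b' * c) (a' * c' + b' * d', a' * d' + b' * c')"
    by (simp add: mint_rel_def)
  show "mint_rel (fst x * fst y + snd x * snd y, fst x * snd y + snd x * fst y)
      (fst x' * fst y' + snd x' * snd y', fst x' * snd y' + snd x' * fst y')"
    using equivp_transp[OF mint_equivp A B] by (simp add: xy)
qed
lift_definition less_mint :: "mint \<Rightarrow> mint \<Rightarrow> bool" is "\<lambda>x y. fst x + snd y < fst y + snd x"
proof -
  fix x x' y y' assume *: "mint_rel x x'" "mint_rel y y'"
  have "fst x + snd y < fst y + snd x \<longleftrightarrow> (fst x + snd y) + (snd x' + snd y') < (fst y + snd x) + (snd x' + snd y')"
    by simp
  also have "\<dots> \<longleftrightarrow> (fst x' + snd y') + (snd x + snd y) < (fst y' + snd x') + (snd x + snd y)"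
  proof -
    have "(fst x + snd y) + (snd x' + snd y') = (fst x + snd x') + (snd y + snd y')" by (simp only: ac_simps)
    also have "\<dots> = (fst x' + snd x) + (snd y + snd y')" using *(1) by (simp add: mint_rel_def)
    finally have 1: "(fst x + snd y) + (snd x' + snd y') = (fst x' + snd y') + (snd x + snd y)"
      by (simp only: ac_simps)
    have "(fst y + snd x) + (snd x' + snd y') = (fst y + snd y') + (snd x + snd x')" by (simp only: ac_simps)
    also have "\<dots> = (fst y' + snd y) + (snd x + snd x')" using *(2) by (simp add: mint_rel_def)
    finally have 2: "(fst y + snd x) + (snd x' + snd y') = (fst y' + snd x') + (snd x + snd y)"
      by (simp only: ac_simps)
    show ?thesis unfolding 1 2 ..
  qed
  finally show "(fst x + snd y < fst y + snd x) = (fst x' + snd y' < fst y' + snd x')" by simp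
qed
definition "x \<le> y \<longleftrightarrow> x < y \<or> x = (y::mint)"
definition abs_mint_eq: "\<bar>x::mint\<bar> = (if x < 0 then - x else x)"
definition sgn_mint_eq: "sgn (x::mint) = (if x = 0 then 0 else if 0 < x then 1 else - 1)"

instance
proof
  fix a b c :: mint
  show "a * b * c = a * (b * c)" "a * b = b * a" "1 * a = a" "a + b + c = a + (b + c)" "a + b = b + a"
    "0 + a = a" "- a + a = 0" "a - b = a + - b" "(a + b) * c = a * c + b * c" "(0::mint) \<noteq> 1"
    "a + b - a = b" "a - b - c = a - (b + c)" "0 * a = 0" "a * 0 = 0"
    by (transfer; simp add: mint_rel_def algebra_simps)+
  have irr: "\<not> a < a" for a :: mint by (transfer; simp)
  have tr: "a < b \<Longrightarrow> b < c \<Longrightarrow> a < c" for a b c :: mint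
  proof (transfer)
    fix a b c :: "mnat \<times> mnat"
    assume "fst a + snd b < fst b + snd a" "fst b + snd c < fst c + snd b"
    then have "(fst a + snd b) + (fst b + snd c) < (fst b + snd a) + (fst c + snd b)" by (rule add_strict_mono)
    then have "(fst a + snd c) + (fst b + snd b) < (fst c + snd a) + (fst b + snd b)" by (simp add: ac_simps)
    then show "fst a + snd c < fst c + snd a" by simp
  qed
  have lin: "a < b \<or> a = b \<or> b < a" for a b :: mint by (transfer; auto simp: mint_rel_def)
  show "(a < b) = (a \<le> b \<and> \<not> b \<le> a)" unfolding less_eq_mint_def by (metis irr tr)
  show "a \<le> a" unfolding less_eq_mint_def by blast
  show "a \<le> b \<Longrightarrow> b \<le> c \<Longrightarrow> a \<le> c" unfolding less_eq_mint_def by (metis tr)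
  show "a \<le> b \<Longrightarrow> b \<le> a \<Longrightarrow> a = b" unfolding less_eq_mint_def by (metis irr tr)
  show "a \<le> b \<or> b \<le> a" unfolding less_eq_mint_def using lin by blast
  have "a < b \<Longrightarrow> c + a < c + b"
  proof transfer
    fix a b c :: "mnat \<times> mnat" assume "fst a + snd b < fst b + snd a"
    then have "(fst c + snd c) + (fst a + snd b) < (fst c + snd c) + (fst b + snd a)" by simp
    then show "fst (fst c + fst a, snd c + snd a) + snd (fst c + fst b, snd c + snd b)
        < fst (fst c + fst b, snd c + snd b) + snd (fst c + fst a, snd c + snd a)"
      by (simp only: ac_simps fst_conv snd_conv)
  qed
  then show "a \<le> b \<Longrightarrow> c + a \<le> c + b" unfolding less_eq_mint_def by blast
  show "a < b \<Longrightarrow> 0 < c \<Longrightarrow> c * a < c * b"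
  proof transfer
    fix a b c :: "mnat \<times> mnat"
    assume ab: "fst a + snd b < fst b + snd a" and "fst (0, 0) + snd c < fst c + snd (0, 0)"
    then obtain d where d: "fst c = snd c + d" "0 < d"
      using mnat_le_add[of "snd c" "fst c"] by (auto simp: le_less)
    have "d * (fst a + snd b) < d * (fst b + snd a)" using ab d(2) by (rule mult_strict_left_mono)
    then have "snd c * (fst a + fst b + snd a + snd b) + d * (fst a + snd b)
        < snd c * (fst a + fst b + snd a + snd b) + d * (fst b + snd a)" by simp
    then show "fst (fst c * fst a + snd c * snd a, fst c * snd a + snd c * fst a) +
        snd (fst c * fst b + snd c * snd b, fst c * snd b + snd c * fst b)
        < fst (fst c * fst b + snd c * snd b, fst c * snd b + snd c * fst b) +
        snd (fst c * fst a + snd c * snd a, fst c * snd a + snd c * fst a)"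
      by (simp only: d(1) fst_conv snd_conv distrib_left distrib_right ac_simps)
  qed
  show "\<bar>a\<bar> = (if a < 0 then - a else a)" by (rule abs_mint_eq)
  show "sgn a = (if a = 0 then 0 else if 0 < a then 1 else - 1)" by (rule sgn_mint_eq)
qed

end

lift_definition emb :: "mnat \<Rightarrow> mint" is "\<lambda>x. (x, 0)" .

lemma emb_simps: "emb (x + y) = emb x + emb y" "emb (x * y) = emb x * emb y" "emb 0 = 0" "emb 1 = 1"
  by (transfer; simp add: mint_rel_def)+

lemma emb_less: "x < y \<longleftrightarrow> emb x < emb y" by (transfer; simp)
lemma emb_eq: "x = y \<longleftrightarrow> emb x = emb y" by (transfer; simp add: mint_rel_def)
lemma emb_le: "x \<le> y \<longleftrightarrow> emb x \<le> emb y" unfolding le_less emb_less emb_eq by simp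
lemma emb_nonneg: "0 \<le> emb x" using emb_le[of 0 x] by (simp add: emb_simps)

text \<open>Strict inequalities are turned into weak ones before embedding, since the ring is not known
  to be discrete.\<close>

lemmas emb = less_iff_succ_less_eq[where 'a = mnat] emb_le emb_eq emb_simps

section \<open>Sigma01 collection, Delta01 predicates, least witnesses\<close>

section \<open>Closure properties of definability\<close>

lemma d0_reidx: "d0 P \<Longrightarrow> d0 (\<lambda>e. P (\<lambda>n. e (h n)))"
  by (rule d0_subst[where g = "\<lambda>n e. e (h n)"]) (simp_all add: tmv_var)

lemma sig_reidx: "sig P \<Longrightarrow> sig (\<lambda>e. P (\<lambda>n. e (h n)))"
  by (rule sig_subst[where g = "\<lambda>n e. e (h n)"]) (simp_all add: tmv_var)

lemma d0_case1: "d0 Q \<Longrightarrow> d0 (\<lambda>e. Q (case_nat (e i) (\<lambda>n. e (h n))))"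
proof -
  assume "d0 Q"
  then have "d0 (\<lambda>e. Q (\<lambda>n. e (case_nat i h n)))" by (rule d0_reidx)
  moreover have "(\<lambda>n. e (case_nat i h n)) = case_nat (e i) (\<lambda>n. e (h n))" for e :: "nat \<Rightarrow> mnat"
    by (auto split: nat.splits)
  ultimately show ?thesis by simp
qed

lemma d0_case2: "d0 Q \<Longrightarrow> d0 (\<lambda>e. Q (case_nat (e i) (case_nat (e j) (\<lambda>n. e (h n)))))"
proof -
  assume "d0 Q"
  then have "d0 (\<lambda>e. Q (\<lambda>n. e (case_nat i (case_nat j h) n)))" by (rule d0_reidx)
  moreover have "(\<lambda>n. e (case_nat i (case_nat j h) n)) = case_nat (e i) (case_nat (e j) (\<lambda>n. e (h n)))"
    for e :: "nat \<Rightarrow> mnat"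
    by (auto split: nat.splits)
  ultimately show ?thesis by simp
qed

lemma mnat_bound2: "\<exists>z. x < z \<and> y < (z::mnat)"
  by (intro exI[of _ "x + y + 1"]) (simp add: mnat_less_Suc)

text \<open>Two unbounded quantifiers are merged by a common upper bound \<open>z\<close> of both
  witnesses; no pairing function is needed.\<close>

lemma sig_ex:
  assumes "sig (\<lambda>e. P (e 0) (\<lambda>n. e (Suc n)))"
  shows "sig (\<lambda>e. \<exists>x. P x e)"
proof -
  obtain Q where Q: "d0 Q" "(\<lambda>e. P (e 0) (\<lambda>n. e (Suc n))) = (\<lambda>e. \<exists>x. Q (case_nat x e))"
    using assms by (rule sigE)
  have P: "P x e = (\<exists>y. Q (case_nat y (case_nat x e)))" for x e
    using fun_cong[OF Q(2), of "case_nat x e"] by simp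
  have "d0 (\<lambda>e. \<exists>x. x < e 0 \<and> (\<exists>y. y < e 0 \<and> Q (case_nat y (case_nat x (\<lambda>n. e (Suc n))))))"
    by (intro d0_bex tmv_var d0_case2 Q(1))
  then show ?thesis
  proof (rule sigI)
    show "(\<exists>x. P x e) = (\<exists>z. \<exists>x. x < case_nat z e 0 \<and> (\<exists>y. y < case_nat z e 0 \<and>
        Q (case_nat y (case_nat x (\<lambda>n. case_nat z e (Suc n))))))" for e
      unfolding P using mnat_bound2 by simp blast
  qed
qed

lemma sig_conj: assumes "sig P" "sig Q" shows "sig (\<lambda>e. P e \<and> Q e)"
proof -
  obtain P' where P: "d0 P'" "P = (\<lambda>e. \<exists>x. P' (case_nat x e))" using assms(1) by (rule sigE)
  obtain Q' where Q: "d0 Q'" "Q = (\<lambda>e. \<exists>x. Q' (case_nat x e))" using assms(2) by (rule sigE)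
  have "sig (\<lambda>e. \<exists>x. \<exists>y. P' (case_nat x e) \<and> Q' (case_nat y e))"
    by (intro sig_ex sig_d0 d0_conj d0_case1 P(1) Q(1))
  then show ?thesis by (simp add: P Q)
qed

lemma sig_disj: assumes "sig P" "sig Q" shows "sig (\<lambda>e. P e \<or> Q e)"
proof -
  obtain P' where P: "d0 P'" "P = (\<lambda>e. \<exists>x. P' (case_nat x e))" using assms(1) by (rule sigE)
  obtain Q' where Q: "d0 Q'" "Q = (\<lambda>e. \<exists>x. Q' (case_nat x e))" using assms(2) by (rule sigE)
  have "sig (\<lambda>e. \<exists>x. P' (case_nat x e) \<or> Q' (case_nat x e))"
    by (intro sig_ex sig_d0 d0_disj d0_case1 P(1) Q(1))
  then show ?thesis by (simp add: P Q ex_disj_distrib)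
qed

text \<open>Collection for Sigma00 formulas, derived from Sigma01 induction on the length of the
  initial segment for which a common bound has been found.\<close>

lemma collection:
  assumes Q: "d0 Q" and ex: "\<And>x. x < b \<Longrightarrow> \<exists>y. Q (case_nat y (case_nat x e))"
  shows "\<exists>z. \<forall>x. x < b \<longrightarrow> (\<exists>y. y < z \<and> Q (case_nat y (case_nat x e)))"
proof -
  \<comment> \<open>The cap \<open>x < f 0\<close>, with \<open>f 0 = b\<close> later, makes the
    step from \<open>c\<close> to \<open>c + 1\<close> trivial when \<open>c\<close> has passed
    \<open>b\<close>, where no witness is assumed.\<close>
  define R where "R c f \<longleftrightarrow> (\<exists>z. \<forall>x. x < c \<longrightarrow> x < f 0 \<longrightarrow>
      (\<exists>y. y < z \<and> Q (case_nat y (case_nat x (\<lambda>n. f (Suc n))))))" for c f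
  have "sig (\<lambda>e. R (e 0) (\<lambda>n. e (Suc n)))"
    unfolding R_def by (intro sig_exD0 d0_ball d0_imp d0_less d0_bex tmv_var d0_case2 Q)
  moreover have "R 0 f" for f unfolding R_def by simp
  moreover have "R (c + 1) (case_nat b e)" if "R c (case_nat b e)" for c
  proof -
    obtain z where z: "\<forall>x. x < c \<longrightarrow> x < b \<longrightarrow> (\<exists>y. y < z \<and> Q (case_nat y (case_nat x e)))"
      using \<open>R c _\<close> unfolding R_def by auto
    obtain y where y: "c < b \<longrightarrow> Q (case_nat y (case_nat c e))" using ex by blast
    have "x < c + 1 \<longrightarrow> x < b \<longrightarrow> (\<exists>y'. y' < z + y + 1 \<and> Q (case_nat y' (case_nat x e)))" for x
    proof (intro impI)
      assume "x < c + 1" and xb: "x < b"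
      then consider "x < c" | "x = c" by (auto simp: mnat_less_Suc le_less)
      then show "\<exists>y'. y' < z + y + 1 \<and> Q (case_nat y' (case_nat x e))"
      proof cases
        case 1
        then obtain y' where y': "y' < z" "Q (case_nat y' (case_nat x e))" using z xb by blast
        then have "y' < z + y + 1" unfolding emb using emb_nonneg[of y] by linarith
        then show ?thesis using y'(2) by blast
      next
        case 2
        then have "y < z + y + 1" unfolding emb using emb_nonneg[of z] by linarith
        then show ?thesis using y 2 xb by blast
      qed
    qed
    then show ?thesis unfolding R_def by auto
  qed
  ultimately have "R c (case_nat b e)" for c
    using sig_induct[of "\<lambda>e. R (e 0) (\<lambda>n. e (Suc n))" "case_nat b e" c] by simp
  from this[of b] show ?thesis unfolding R_def by auto
qed

text \<open>Collection moves the existential quantifier in front of the bounded universal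
  one.\<close>

lemma sig_ball_var:
  assumes "sig (\<lambda>e. P (e 0) (\<lambda>n. e (Suc n)))"
  shows "sig (\<lambda>e. \<forall>x. x < e k \<longrightarrow> P x e)"
proof -
  obtain Q where Q: "d0 Q" "(\<lambda>e. P (e 0) (\<lambda>n. e (Suc n))) = (\<lambda>e. \<exists>x. Q (case_nat x e))"
    using assms by (rule sigE)
  have P: "P x e = (\<exists>y. Q (case_nat y (case_nat x e)))" for x e
    using fun_cong[OF Q(2), of "case_nat x e"] by simp
  have "(\<forall>x. x < e k \<longrightarrow> P x e) = (\<exists>z. \<forall>x. x < e k \<longrightarrow> (\<exists>y. y < z \<and> Q (case_nat y (case_nat x e))))" for e
    unfolding P using collection[OF Q(1), of "e k" e] by blast
  moreover have "sig (\<lambda>e. \<exists>z. \<forall>x. x < e k \<longrightarrow> (\<exists>y. y < z \<and> Q (case_nat y (case_nat x e))))"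
    by (intro sig_exD0 d0_ball d0_bex tmv_var d0_case2 Q(1))
  ultimately show ?thesis by simp
qed

text \<open>The graph is Sigma01. As the function is total, the complement of the graph is Sigma01
  too, so values may be inserted into decidable predicates.\<close>

definition fn :: "((nat \<Rightarrow> mnat) \<Rightarrow> mnat) \<Rightarrow> bool" where
  "fn f \<longleftrightarrow> sig (\<lambda>e. e 0 = f (\<lambda>n. e (Suc n)))"

definition dec :: "((nat \<Rightarrow> mnat) \<Rightarrow> bool) \<Rightarrow> bool" where
  "dec P \<longleftrightarrow> sig P \<and> sig (\<lambda>e. \<not> P e)"

lemma decI: "d0 P \<Longrightarrow> dec P"
  unfolding dec_def by (intro conjI sig_d0 d0_not)

lemma dec_sig: "dec P \<Longrightarrow> sig P" unfolding dec_def by blast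

lemma fn_reidx: "fn f \<Longrightarrow> fn (\<lambda>e. f (\<lambda>n. e (h n)))"
  unfolding fn_def using sig_reidx[of "\<lambda>e. e 0 = f (\<lambda>n. e (Suc n))" "case_nat 0 (\<lambda>n. Suc (h n))"] by simp

lemma fn_shift: "fn f \<Longrightarrow> fn (\<lambda>e. f (\<lambda>n. e (Suc n)))"
  by (rule fn_reidx)

lemma fn_var: "fn (\<lambda>e. e n)"
  unfolding fn_def by (intro sig_d0 d0_eq tmv_var)

text \<open>The value is introduced by an existential quantifier over its Sigma01 graph.\<close>

lemma sig_app:
  assumes "sig (\<lambda>e. R (e 0) (\<lambda>n. e (Suc n)))" "fn f"
  shows "sig (\<lambda>e. R (f e) e)"
proof -
  have "sig (\<lambda>e. \<exists>y. y = f e \<and> R y e)"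
    by (rule sig_ex, rule sig_conj) (use assms in \<open>simp_all add: fn_def\<close>)
  then show ?thesis by simp
qed

lemma sig_app1: "sig (\<lambda>e. R (e 0)) \<Longrightarrow> fn f \<Longrightarrow> sig (\<lambda>e. R (f e))"
  using sig_app[of "\<lambda>y e. R y"] by simp

lemma sig_app2:
  assumes "sig (\<lambda>e. R (e 0) (e (Suc 0)))" "fn f" "fn g"
  shows "sig (\<lambda>e. R (f e) (g e))"
proof (rule sig_app[of "\<lambda>y e. R y (g e)", OF _ assms(2)])
  have "sig (\<lambda>e. R (e (Suc 0)) (e 0))"
    using sig_reidx[OF assms(1), of "\<lambda>n. if n = 0 then Suc 0 else 0"] by simp
  then show "sig (\<lambda>e. R (e 0) (g (\<lambda>n. e (Suc n))))"
    using sig_app[of "\<lambda>y e. R (e 0) y" "\<lambda>e. g (\<lambda>n. e (Suc n))"] fn_shift[OF assms(3)] by simp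
qed

lemma sig_app3:
  assumes "sig (\<lambda>e. R (e 0) (e (Suc 0)) (e (Suc (Suc 0))))" "fn f" "fn g" "fn h"
  shows "sig (\<lambda>e. R (f e) (g e) (h e))"
proof (rule sig_app[of "\<lambda>y e. R y (g e) (h e)", OF _ assms(2)])
  have "sig (\<lambda>e. R (e (Suc (Suc 0))) (e (Suc 0)) (e 0))"
    using sig_reidx[OF assms(1), of "\<lambda>n. if n = 0 then Suc (Suc 0) else if n = Suc 0 then Suc 0 else 0"] by simp
  then have "sig (\<lambda>e. R (e (Suc 0)) (e 0) (h (\<lambda>n. e (Suc (Suc n)))))"
    using sig_app[of "\<lambda>y e. R (e (Suc 0)) (e 0) y" "\<lambda>e. h (\<lambda>n. e (Suc (Suc n)))"]
      fn_reidx[OF assms(4), of "\<lambda>n. Suc (Suc n)"] by simp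
  then show "sig (\<lambda>e. R (e 0) (g (\<lambda>n. e (Suc n))) (h (\<lambda>n. e (Suc n))))"
    using sig_app[of "\<lambda>y e. R (e 0) y (h (\<lambda>n. e (Suc n)))" "\<lambda>e. g (\<lambda>n. e (Suc n))"]
      fn_shift[OF assms(3)] by simp
qed

lemma dec_app1: "dec (\<lambda>e. R (e 0)) \<Longrightarrow> fn f \<Longrightarrow> dec (\<lambda>e. R (f e))"
  using sig_app1[of R f] sig_app1[of "\<lambda>y. \<not> R y" f] by (simp add: dec_def)

lemma dec_app2: "dec (\<lambda>e. R (e 0) (e (Suc 0))) \<Longrightarrow> fn f \<Longrightarrow> fn g \<Longrightarrow> dec (\<lambda>e. R (f e) (g e))"
  using sig_app2[of R f g] sig_app2[of "\<lambda>x y. \<not> R x y" f g] by (simp add: dec_def)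

lemma fn_app1: "fn (\<lambda>e. F (e 0)) \<Longrightarrow> fn f \<Longrightarrow> fn (\<lambda>e. F (f e))"
  unfolding fn_def
  using sig_app2[of "\<lambda>x y. x = F y" "\<lambda>e. e 0" "\<lambda>e. f (\<lambda>n. e (Suc n))"] fn_shift[of f]
  by (simp add: fn_var fn_def)

lemma fn_app2: "fn (\<lambda>e. F (e 0) (e (Suc 0))) \<Longrightarrow> fn f \<Longrightarrow> fn g \<Longrightarrow> fn (\<lambda>e. F (f e) (g e))"
proof -
  assume F: "fn (\<lambda>e. F (e 0) (e (Suc 0)))" and f: "fn f" and g: "fn g"
  have "sig (\<lambda>e. e 0 = F (f (\<lambda>n. e (Suc n))) (g (\<lambda>n. e (Suc n))))"
    by (rule sig_app3[of "\<lambda>x y z. x = F y z", OF F[unfolded fn_def] fn_var fn_shift[OF f] fn_shift[OF g]])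
  then show ?thesis by (simp add: fn_def)
qed

lemma fn_add: "fn f \<Longrightarrow> fn g \<Longrightarrow> fn (\<lambda>e. f e + g e)"
  by (rule fn_app2[of "(+)"]) (auto simp: fn_def intro!: sig_d0 d0_intros)

lemma fn_mult: "fn f \<Longrightarrow> fn g \<Longrightarrow> fn (\<lambda>e. f e * g e)"
  by (rule fn_app2[of "(*)"]) (auto simp: fn_def intro!: sig_d0 d0_intros)

lemma mnat_eq_minus_iff: "z = x - y \<longleftrightarrow> x = y + z \<or> x < y \<and> z = (0::mnat)"
proof (cases "x < y")
  case True
  then have "x \<noteq> y + z" unfolding emb using emb_nonneg[of z] by linarith
  then show ?thesis using True mnat_minus(2) by auto
next
  case False
  then obtain d where "x = y + d" using mnat_le_add by (meson not_less)
  then show ?thesis by auto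
qed

lemma fn_minus: "fn f \<Longrightarrow> fn g \<Longrightarrow> fn (\<lambda>e. f e - g e)"
  by (rule fn_app2[of "(-)"]) (auto simp: fn_def mnat_eq_minus_iff intro!: sig_d0 d0_intros)

lemma singleton_Sets: "{c} \<in> Sets"
proof -
  have "dec (\<lambda>e. e 0 = e (Suc 0))" by (intro decI d0_intros)
  then have "{x. x = c} \<in> Sets"
    using comprehension[of "\<lambda>e. e 0 = e (Suc 0)" "\<lambda>_. c"] by (simp add: dec_def)
  then show ?thesis by simp
qed

lemma fn_const: "fn (\<lambda>e. c)"
proof -
  have "d0 (\<lambda>e. e 0 \<in> {c})" by (rule d0_mem[OF tmv_var singleton_Sets])
  then show ?thesis unfolding fn_def using sig_d0 by simp
qed

lemma dec_const: "dec (\<lambda>e. b)"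
  by (cases b) (use decI[OF d0_False] decI[OF d0_not[OF d0_False]] in simp_all)

lemma dec_not: "dec P \<Longrightarrow> dec (\<lambda>e. \<not> P e)"
  by (simp add: dec_def)

lemma dec_conj: "dec P \<Longrightarrow> dec Q \<Longrightarrow> dec (\<lambda>e. P e \<and> Q e)"
  unfolding dec_def de_Morgan_conj by (intro conjI sig_conj sig_disj) simp_all

lemma dec_disj: "dec P \<Longrightarrow> dec Q \<Longrightarrow> dec (\<lambda>e. P e \<or> Q e)"
  unfolding dec_def de_Morgan_disj by (intro conjI sig_conj sig_disj) simp_all

lemma dec_imp: "dec P \<Longrightarrow> dec Q \<Longrightarrow> dec (\<lambda>e. P e \<longrightarrow> Q e)"
  unfolding imp_conv_disj by (intro dec_disj dec_not)

lemma dec_iff: "dec P \<Longrightarrow> dec Q \<Longrightarrow> dec (\<lambda>e. P e \<longleftrightarrow> Q e)"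
  unfolding iff_conv_conj_imp by (intro dec_conj dec_imp)

lemma dec_eq: "fn f \<Longrightarrow> fn g \<Longrightarrow> dec (\<lambda>e. f e = g e)"
  by (rule dec_app2[of "(=)"]) (intro decI d0_intros)

lemma dec_less: "fn f \<Longrightarrow> fn g \<Longrightarrow> dec (\<lambda>e. f e < g e)"
  by (rule dec_app2[of "(<)"]) (intro decI d0_intros)

lemma dec_le: "fn f \<Longrightarrow> fn g \<Longrightarrow> dec (\<lambda>e. f e \<le> g e)"
  unfolding le_less by (intro dec_disj dec_less dec_eq)

lemma dec_mem: "X \<in> Sets \<Longrightarrow> fn f \<Longrightarrow> dec (\<lambda>e. f e \<in> X)"
  by (rule dec_app1) (intro decI d0_intros)

lemma sig_ball:
  assumes "fn f" "sig (\<lambda>e. P (e 0) (\<lambda>n. e (Suc n)))"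
  shows "sig (\<lambda>e. \<forall>x. x < f e \<longrightarrow> P x e)"
proof (rule sig_app[of "\<lambda>y e. \<forall>x. x < y \<longrightarrow> P x e", OF _ assms(1)])
  have "sig (\<lambda>e. P (e 0) (\<lambda>n. e (Suc (Suc n))))"
    using sig_reidx[OF assms(2), of "case_nat 0 (\<lambda>n. Suc (Suc n))"] by simp
  then show "sig (\<lambda>e. \<forall>x. x < e 0 \<longrightarrow> P x (\<lambda>n. e (Suc n)))"
    using sig_ball_var[of "\<lambda>x e. P x (\<lambda>n. e (Suc n))" 0] by simp
qed

lemma sig_bex:
  assumes "fn f" "sig (\<lambda>e. P (e 0) (\<lambda>n. e (Suc n)))"
  shows "sig (\<lambda>e. \<exists>x. x < f e \<and> P x e)"
proof (intro sig_ex sig_conj assms(2))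
  show "sig (\<lambda>e. e 0 < f (\<lambda>n. e (Suc n)))"
    by (rule dec_sig, rule dec_less[OF fn_var fn_shift[OF assms(1)]])
qed

lemma dec_ball:
  assumes "fn f" "dec (\<lambda>e. P (e 0) (\<lambda>n. e (Suc n)))"
  shows "dec (\<lambda>e. \<forall>x. x < f e \<longrightarrow> P x e)"
  using sig_ball[OF assms(1), of P] sig_bex[OF assms(1), of "\<lambda>x e. \<not> P x e"] assms(2) by (simp add: dec_def)

lemma dec_bex:
  assumes "fn f" "dec (\<lambda>e. P (e 0) (\<lambda>n. e (Suc n)))"
  shows "dec (\<lambda>e. \<exists>x. x < f e \<and> P x e)"
  using sig_bex[OF assms(1), of P] sig_ball[OF assms(1), of "\<lambda>x e. \<not> P x e"] assms(2) by (simp add: dec_def)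

lemmas fn_intros = fn_var fn_const fn_add fn_mult fn_minus
lemmas dec_intros = dec_const dec_ball dec_bex dec_not dec_conj dec_disj dec_imp dec_iff dec_eq dec_less dec_le
  dec_mem fn_intros

lemma set_exists: "dec (\<lambda>e. P (e 0)) \<Longrightarrow> {x. P x} \<in> Sets"
  using comprehension[of "\<lambda>e. P (e 0)"] by (simp add: dec_def)

lemma mnat_induct:
  assumes "sig (\<lambda>e. P (e 0))" "P 0" "\<And>x. P x \<Longrightarrow> P (x + 1)"
  shows "P x"
  using sig_induct[of "\<lambda>e. P (e 0)" "\<lambda>_. 0" x] assms by simp

lemma dec_case1: "dec P \<Longrightarrow> dec (\<lambda>e. P (case_nat (e i) (\<lambda>n. e (h n))))"
proof -
  assume "dec P"
  then have "dec (\<lambda>e. P (\<lambda>n. e (case_nat i h n)))"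
    unfolding dec_def using sig_reidx[of P] sig_reidx[of "\<lambda>e. \<not> P e"] by blast
  moreover have "(\<lambda>n. e (case_nat i h n)) = case_nat (e i) (\<lambda>n. e (h n))" for e :: "nat \<Rightarrow> mnat"
    by (auto split: nat.splits)
  ultimately show ?thesis by simp
qed

text \<open>Least number principle: otherwise "no witness below \<open>z\<close>" would be
  inductive, hence true of every \<open>z\<close>.\<close>

lemma least_exists_env:
  assumes "dec P" "P (case_nat x e)"
  shows "\<exists>x. P (case_nat x e) \<and> (\<forall>y. y < x \<longrightarrow> \<not> P (case_nat y e))"
proof (rule ccontr)
  assume *: "\<not> ?thesis"
  define Q where "Q E \<longleftrightarrow> (\<forall>y. y < E 0 \<longrightarrow> \<not> P (case_nat y (\<lambda>n. E (Suc n))))" for E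
  have "dec Q" unfolding Q_def using assms(1) by (intro dec_intros dec_case1)
  have "Q (case_nat z e)" for z
  proof (rule sig_induct[OF dec_sig[OF \<open>dec Q\<close>]])
    show "Q (case_nat (z + 1) e)" if "Q (case_nat z e)" for z
      using that * by (auto simp: Q_def mnat_less_Suc le_less)
  qed (simp add: Q_def)
  from this[of "x + 1"] show False using assms(2) by (simp add: Q_def mnat_less_Suc)
qed

lemma least_exists:
  assumes "dec (\<lambda>e. P (e 0))" "P x"
  shows "\<exists>x. P x \<and> (\<forall>y. y < x \<longrightarrow> \<not> P y)"
  using least_exists_env[OF assms(1), of x "\<lambda>_. 0"] assms(2) by simp

lemma Least_dec:
  assumes "dec (\<lambda>e. P (e 0))" "P x"
  shows "P (LEAST x. P x)" "y < (LEAST x. P x) \<Longrightarrow> \<not> P y" "(LEAST x. P x) \<le> x"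
proof -
  obtain z where z: "P z" "\<forall>y. y < z \<longrightarrow> \<not> P y" using least_exists[OF assms] by blast
  then have "(LEAST x. P x) = z" by (intro Least_equality) (auto simp: not_less[symmetric])
  then show "P (LEAST x. P x)" "y < (LEAST x. P x) \<Longrightarrow> \<not> P y" "(LEAST x. P x) \<le> x"
    using z assms(2) by (auto simp: not_less[symmetric])
qed

lemma mnat_less_induct:
  assumes "dec (\<lambda>e. P (e 0))" "\<And>x. (\<And>y. y < x \<Longrightarrow> P y) \<Longrightarrow> P x"
  shows "P x"
  using least_exists[OF dec_not[OF assms(1)], of x] assms(2) by blast

text \<open>The maximum is found as the least upper bound; \<open>b\<close> serves to bound the
  quantifier over the members.\<close>

lemma greatest_exists:
  assumes "dec (\<lambda>e. P (e 0))" "P x" "\<And>x. P x \<Longrightarrow> x \<le> b"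
  shows "\<exists>x. P x \<and> (\<forall>y. P y \<longrightarrow> y \<le> x)"
proof -
  have "dec (\<lambda>e. \<forall>y. y < b + 1 \<longrightarrow> P y \<longrightarrow> y \<le> e 0)" by (intro dec_intros assms(1))
  moreover have "\<forall>y. y < b + 1 \<longrightarrow> P y \<longrightarrow> y \<le> b" using assms(3) by blast
  ultimately obtain z where z: "\<forall>y. y < b + 1 \<longrightarrow> P y \<longrightarrow> y \<le> z"
      "\<And>w. w < z \<Longrightarrow> \<not> (\<forall>y. y < b + 1 \<longrightarrow> P y \<longrightarrow> y \<le> w)"
    using least_exists[of "\<lambda>z. \<forall>y. y < b + 1 \<longrightarrow> P y \<longrightarrow> y \<le> z" b] by blast
  have z1: "P y \<Longrightarrow> y \<le> z" for y using z(1) assms(3) by (auto simp: mnat_less_Suc)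
  have "P z"
  proof (cases "z = 0")
    case True
    then show ?thesis using z1[OF assms(2)] assms(2) by simp
  next
    case False
    then obtain w where w: "z = w + 1" using mnat_pos_Suc mnat_zero_or by blast
    then have "w < z" by (simp add: mnat_less_Suc)
    then obtain y where "P y" "w < y" using z(2) by (auto simp: not_le)
    then have "y = z" using z1[of y] w by (auto simp: mnat_Suc_le[symmetric])
    then show ?thesis using \<open>P y\<close> by simp
  qed
  then show ?thesis using z1 by blast
qed

text \<open>Unbounded search: minimality is a bounded condition, so the graph stays decidable. This
  is how the new functions of the development are obtained.\<close>

lemma fn_Least:
  assumes P: "dec (\<lambda>e. P (e 0) (\<lambda>n. e (Suc n)))" and ex: "\<And>e. \<exists>x. P x e"
  shows "fn (\<lambda>e. LEAST x. P x e)"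
proof -
  have *: "z = (LEAST x. P x e) \<longleftrightarrow> P z e \<and> (\<forall>y. y < z \<longrightarrow> \<not> P y e)" for z e
  proof -
    obtain x where x: "P x e" "\<forall>y. y < x \<longrightarrow> \<not> P y e"
      using least_exists_env[OF P, of _ e] ex[of e] by auto
    have least: "(LEAST x. P x e) = w" if "P w e" "\<forall>y. y < w \<longrightarrow> \<not> P y e" for w
      using that by (intro Least_equality) (auto simp: not_less[symmetric])
    show ?thesis using least[OF x] least[of z] x by blast
  qed
  have "dec (\<lambda>e. P (e 0) (\<lambda>n. e (Suc n)) \<and> (\<forall>y. y < e 0 \<longrightarrow> \<not> P y (\<lambda>n. e (Suc n))))"
    using dec_case1[OF P, of 0 "\<lambda>n. Suc (Suc n)"] by (intro dec_intros P) simp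
  then show ?thesis unfolding fn_def * by (rule dec_sig)
qed

lemma fn_if: "dec P \<Longrightarrow> fn f \<Longrightarrow> fn g \<Longrightarrow> fn (\<lambda>e. if P e then f e else g e)"
proof -
  assume P: "dec P" and f: "fn f" and g: "fn g"
  have "sig (\<lambda>e. P (\<lambda>n. e (Suc n)) \<and> e 0 = f (\<lambda>n. e (Suc n)) \<or> \<not> P (\<lambda>n. e (Suc n)) \<and> e 0 = g (\<lambda>n. e (Suc n)))"
    using P f g unfolding dec_def fn_def
    by (intro sig_disj sig_conj sig_reidx[of _ Suc]) (auto intro: sig_reidx[of P Suc] sig_reidx[of "\<lambda>e. \<not> P e" Suc])
  moreover have "(e 0 = (if P (\<lambda>n. e (Suc n)) then f (\<lambda>n. e (Suc n)) else g (\<lambda>n. e (Suc n)))) =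
    (P (\<lambda>n. e (Suc n)) \<and> e 0 = f (\<lambda>n. e (Suc n)) \<or> \<not> P (\<lambda>n. e (Suc n)) \<and> e 0 = g (\<lambda>n. e (Suc n)))" for e by auto
  ultimately show ?thesis unfolding fn_def by simp
qed

lemma fn_bounded:
  assumes "fn (\<lambda>e. f (e 0))"
  shows "\<exists>z. \<forall>i. i < b \<longrightarrow> f i < z"
proof (rule mnat_induct[of "\<lambda>b. \<exists>z. \<forall>i. i < b \<longrightarrow> f i < z"])
  show "sig (\<lambda>e. \<exists>z. \<forall>i. i < e 0 \<longrightarrow> f i < z)"
    by (intro sig_ex dec_sig dec_intros assms)
  fix b assume "\<exists>z. \<forall>i. i < b \<longrightarrow> f i < z"
  then obtain z where z: "\<forall>i. i < b \<longrightarrow> f i < z" by blast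
  obtain w where "z < w" "f b < w" using mnat_bound2 by blast
  then have "\<forall>i. i < b + 1 \<longrightarrow> f i < w" using z by (auto simp: mnat_less_Suc le_less)
  then show "\<exists>z. \<forall>i. i < b + 1 \<longrightarrow> f i < z" by blast
qed simp

section \<open>Goedel coding of finite sets by divisibility\<close>

section \<open>Pairs and codes of finite sets\<close>

definition pr :: "mnat \<Rightarrow> mnat \<Rightarrow> mnat" where
  "pr i j = (i + j) * (i + j) + i"

lemma fn_pr: "fn f \<Longrightarrow> fn g \<Longrightarrow> fn (\<lambda>e. pr (f e) (g e))"
  unfolding pr_def by (intro fn_intros)

lemma mnat_less_one [simp]: "x < 1 \<longleftrightarrow> x = (0::mnat)"
  using mnat_less_Suc[of x 0] by simp

lemma mnat_pos_iff: "0 < x \<longleftrightarrow> x \<noteq> (0::mnat)"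
  using mnat_zero_or[of x] by auto

lemma mnat_less_add_iff: "x < y \<longleftrightarrow> (\<exists>d. y = x + d + (1::mnat))"
proof
  assume "x < y"
  then have "x + 1 \<le> y" by (simp add: mnat_Suc_le)
  then obtain d where "y = x + 1 + d" using mnat_le_add by blast
  then have "y = x + d + 1" by (simp add: ac_simps)
  then show "\<exists>d. y = x + d + 1" ..
next
  assume "\<exists>d. y = x + d + 1"
  then obtain d where "y = x + d + 1" ..
  then show "x < y" unfolding emb using emb_nonneg[of d] by linarith
qed

lemma mnat_le_add_iff: "x \<le> y \<longleftrightarrow> (\<exists>d. y = x + (d::mnat))"
  using mnat_le_add by auto

text \<open>Since \<open>i\<close> is at most \<open>i + j\<close>, the value of
  \<open>pr i j\<close> lies below the next square, that of \<open>i + j + 1\<close>. Injectivity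
  follows from this.\<close>

lemma pr_less: "i + j < k + l \<Longrightarrow> pr i j < pr k l"
proof -
  assume "i + j < k + l"
  then obtain d where d: "k + l = (i + j) + d + 1" by (auto simp: mnat_less_add_iff)
  \<comment> \<open>The summand in parentheses is the difference of the two values, written without
    subtraction.\<close>
  have "pr k l = pr i j + ((d * d + d + (i + j) * d + (i + j) * d + d + j + (i + j) + k) + 1)"
    unfolding pr_def d by (simp add: algebra_simps)
  then show ?thesis unfolding mnat_less_add_iff[of "pr i j"] by (metis add.assoc)
qed

lemma pr_inject [simp]: "pr i j = pr k l \<longleftrightarrow> i = k \<and> j = l"
proof
  assume *: "pr i j = pr k l"
  then have "i + j = k + l" using pr_less[of i j k l] pr_less[of k l i j] by force
  moreover from this have "i = k" using * unfolding pr_def by simp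
  ultimately show "i = k \<and> j = l" by simp
qed simp

lemma mnat_le_square: "(x::mnat) \<le> x * x"
proof (cases "x = 0")
  case False
  then obtain y where "x = y + 1" using mnat_pos_Suc mnat_zero_or by blast
  then have "x * x = x + y * x" by (simp add: algebra_simps)
  then show ?thesis unfolding mnat_le_add_iff by blast
qed simp

lemma pr_ge: "i \<le> pr i j" "j \<le> pr i j"
proof -
  show "i \<le> pr i j" unfolding pr_def mnat_le_add_iff by (metis add.commute)
  obtain d where "(i + j) * (i + j) = (i + j) + d" using mnat_le_square mnat_le_add_iff by metis
  then have "pr i j = j + (i + d + i)" unfolding pr_def by (simp add: ac_simps)
  then show "j \<le> pr i j" unfolding mnat_le_add_iff by blast
qed

lemma pr_mono: "i \<le> k \<Longrightarrow> j \<le> l \<Longrightarrow> pr i j \<le> pr k l"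
  unfolding pr_def by (intro add_mono mult_mono) auto

definition el :: "mnat \<Rightarrow> mnat \<Rightarrow> bool" where
  "el i x \<longleftrightarrow> (\<exists>k m n. x = pr k (pr m n) \<and> i < k \<and> (m * (i + 1) + 1) dvd n)"

definition repr :: "mnat \<Rightarrow> bool" where
  "repr x \<longleftrightarrow> (\<exists>k m n. x = pr k (pr m n))"

definition fcode :: "mnat \<Rightarrow> bool" where
  "fcode x \<longleftrightarrow> repr x \<and> (\<forall>y. y < x \<and> repr y \<longrightarrow> \<not> (\<forall>i. el i y \<longleftrightarrow> el i x))"

lemma el_pr: "el i (pr k (pr m n)) \<longleftrightarrow> i < k \<and> (m * (i + 1) + 1) dvd n"
  unfolding el_def by simp

lemma el_less: "el i x \<Longrightarrow> i < x"
  unfolding el_def using pr_ge(1) less_le_trans by blast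

text \<open>A quotient can be chosen at most as large as the dividend; for divisor 0 the quotient 0
  will do.\<close>

lemma dec_dvd: assumes "fn f" "fn g" shows "dec (\<lambda>e. f e dvd g e)"
proof -
  have "x dvd y \<longleftrightarrow> (\<exists>q. q < y + 1 \<and> y = x * q)" for x y :: mnat
  proof
    assume "x dvd y"
    then obtain q where q: "y = x * q" by blast
    show "\<exists>q. q < y + 1 \<and> y = x * q"
    proof (cases "x = 0")
      case True
      then show ?thesis using q by (intro exI[of _ 0]) (simp add: mnat_less_Suc)
    next
      case False
      then obtain x' where "x = x' + 1" using mnat_pos_Suc mnat_zero_or by blast
      then have "y = q + x' * q" using q by (simp add: algebra_simps)
      then show ?thesis using q by (auto simp: mnat_less_Suc mnat_le_add_iff)
    qed
  qed auto
  moreover have "dec (\<lambda>e. \<exists>q. q < g e + 1 \<and> g e = f e * q)"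
    using assms by (intro dec_intros fn_shift)
  ultimately show ?thesis by simp
qed

lemma pr_pr_ge: "k \<le> pr k (pr m n)" "m \<le> pr k (pr m n)" "n \<le> pr k (pr m n)"
  using pr_ge(1)[of k "pr m n"] pr_ge(2)[of "pr m n" k] pr_ge(1)[of m n] pr_ge(2)[of n m] by auto

lemma dec_el: "fn f \<Longrightarrow> fn g \<Longrightarrow> dec (\<lambda>e. el (f e) (g e))"
proof (rule dec_app2[of el])
  have "el i x \<longleftrightarrow> (\<exists>k. k < x + 1 \<and> (\<exists>m. m < x + 1 \<and> (\<exists>n. n < x + 1 \<and>
      x = pr k (pr m n) \<and> i < k \<and> (m * (i + 1) + 1) dvd n)))" for i x
    unfolding el_def mnat_less_Suc using pr_pr_ge by blast
  moreover have "dec (\<lambda>e. \<exists>k. k < e (Suc 0) + 1 \<and> (\<exists>m. m < e (Suc 0) + 1 \<and> (\<exists>n. n < e (Suc 0) + 1 \<and>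
      e (Suc 0) = pr k (pr m n) \<and> e 0 < k \<and> (m * (e 0 + 1) + 1) dvd n)))"
    by (intro dec_intros dec_dvd fn_pr)
  ultimately show "dec (\<lambda>e. el (e 0) (e (Suc 0)))" by simp
qed

lemma dec_repr: "fn f \<Longrightarrow> dec (\<lambda>e. repr (f e))"
proof (rule dec_app1[of repr])
  have "repr x \<longleftrightarrow> (\<exists>k. k < x + 1 \<and> (\<exists>m. m < x + 1 \<and> (\<exists>n. n < x + 1 \<and> x = pr k (pr m n))))" for x
    unfolding repr_def mnat_less_Suc using pr_pr_ge by blast
  moreover have "dec (\<lambda>e. \<exists>k. k < e 0 + 1 \<and> (\<exists>m. m < e 0 + 1 \<and> (\<exists>n. n < e 0 + 1 \<and> e 0 = pr k (pr m n))))"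
    by (intro dec_intros fn_pr)
  ultimately show "dec (\<lambda>e. repr (e 0))" by simp
qed

lemma dec_fcode: "fn f \<Longrightarrow> dec (\<lambda>e. fcode (f e))"
proof (rule dec_app1[of fcode])
  have "(\<forall>i. el i y \<longleftrightarrow> el i x) \<longleftrightarrow> (\<forall>i. i < x \<longrightarrow> (el i y \<longleftrightarrow> el i x))" if "y < x" for x y
    using el_less[of _ x] el_less[of _ y] that by (meson less_trans)
  then have "fcode x \<longleftrightarrow> repr x \<and> (\<forall>y. y < x \<longrightarrow> repr y \<longrightarrow> \<not> (\<forall>i. i < x \<longrightarrow> (el i y \<longleftrightarrow> el i x)))" for x
    unfolding fcode_def by blast
  moreover have "dec (\<lambda>e. repr (e 0) \<and> (\<forall>y. y < e 0 \<longrightarrow> repr y \<longrightarrow> \<not> (\<forall>i. i < e 0 \<longrightarrow> (el i y \<longleftrightarrow> el i (e 0)))))"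
    by (intro dec_intros dec_repr dec_el)
  ultimately show "dec (\<lambda>e. fcode (e 0))" by simp
qed

lemma fcode_unique: "fcode x \<Longrightarrow> fcode y \<Longrightarrow> (\<And>i. el i x \<longleftrightarrow> el i y) \<Longrightarrow> x = y"
  unfolding fcode_def by (metis linorder_neqE)

text \<open>Stands in for a factorial: a number divisible by all positive \<open>d < k\<close> makes
  the moduli \<open>prm m i\<close> with \<open>i < k\<close> pairwise coprime.\<close>

definition modulus :: "mnat \<Rightarrow> mnat \<Rightarrow> bool" where
  "modulus k m \<longleftrightarrow> 0 < m \<and> (\<forall>d. d < k \<longrightarrow> 0 < d \<longrightarrow> d dvd m)"

lemma modulus_exists: "\<exists>m. modulus k m"
proof (rule mnat_induct[of "\<lambda>k. \<exists>m. modulus k m"])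
  show "sig (\<lambda>e. \<exists>m. modulus (e 0) m)"
    unfolding modulus_def by (intro sig_ex dec_sig dec_intros dec_dvd)
  show "\<exists>m. modulus 0 m" unfolding modulus_def by (intro exI[of _ 1]) simp
  fix k assume "\<exists>m. modulus k m"
  then obtain m where m: "modulus k m" ..
  show "\<exists>m. modulus (k + 1) m"
  proof (cases "k = 0")
    case True
    then show ?thesis using m by (auto simp: modulus_def)
  next
    case False
    then have "0 < m * k" using m by (auto simp: modulus_def mnat_pos_iff)
    then show ?thesis
      using m by (intro exI[of _ "m * k"]) (auto simp: modulus_def mnat_less_Suc le_less)
  qed
qed

text \<open>The moduli of Goedel's beta function, the same numbers whose divisibility defines
  \<open>el\<close>.\<close>

definition prm :: "mnat \<Rightarrow> mnat \<Rightarrow> mnat" where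
  "prm m i = m * (i + 1) + 1"

lemma prm_pos: "0 < prm m i"
  unfolding prm_def by (rule mnat_zero_less_Suc)

lemma mult_bezout1: "p * u = q * v + 1 \<Longrightarrow> n * p * u = q * (n * v) + (n::mnat)"
proof -
  assume "p * u = q * v + 1"
  then have "n * (p * u) = n * (q * v + 1)" by (rule arg_cong)
  then show ?thesis by (simp only: distrib_left mult_1_right mult.assoc mult.left_commute[of q n])
qed

lemma mult_bezout2: "q * u + p = p * v + 1 \<Longrightarrow> q * (n * u) + n * p = n * p * v + (n::mnat)"
proof -
  assume "q * u + p = p * v + 1"
  then have "n * (q * u + p) = n * (p * v + 1)" by (rule arg_cong)
  then show ?thesis by (simp only: distrib_left mult_1_right mult.assoc mult.left_commute[of q n])
qed

text \<open>Bezout coefficients can be written down explicitly because every difference \<open>j - i\<close> divides \<open>m\<close>.\<close>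

lemma prm_coprime:
  assumes m: "modulus k m" and ij: "i < k" "j < k" "i \<noteq> j" and dvd: "prm m i dvd n * prm m j"
  shows "prm m i dvd n"
proof -
  have q: "\<exists>q. m = d * q" if "0 < d" "d < k" for d
    using m that unfolding modulus_def by blast
  show ?thesis
  proof (cases "i < j")
    case True
    then obtain c where "j = i + c + 1" by (auto simp: mnat_less_add_iff)
    then have j: "j = i + (c + 1)" by (simp add: ac_simps)
    have "c + 1 \<le> j" unfolding j by simp
    then have "c + 1 < k" using ij(2) by simp
    then obtain q where q: "m = (c + 1) * q" using q[of "c + 1"] by (auto simp: mnat_less_Suc)
    \<comment> \<open>Write \<open>p i\<close> for \<open>prm m i\<close>. Then
      \<open>(j + 1) * p i - (i + 1) * p j = j - i = c + 1\<close>, and multiplication by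
      \<open>(j + 1) * q\<close> turns this into \<open>m * (j + 1) = p j - 1\<close>. The identity
      results by moving negative terms to the other side.\<close>
    have "prm m j * (1 + (i + 1) * (j + 1) * q) = prm m i * ((j + 1) * (j + 1) * q) + 1"
      unfolding prm_def q j by (simp add: algebra_simps)
    then have "n * prm m j * (1 + (i + 1) * (j + 1) * q) = prm m i * (n * ((j + 1) * (j + 1) * q)) + n"
      by (rule mult_bezout1)
    moreover have "prm m i dvd n * prm m j * (1 + (i + 1) * (j + 1) * q)" using dvd by (rule dvd_mult2)
    ultimately have "prm m i dvd prm m i * (n * ((j + 1) * (j + 1) * q)) + n" by (simp only:)
    then show ?thesis by (simp only: dvd_add_right_iff dvd_triv_left)
  next
    case False
    then have "j < i" using ij(3) by simp
    then obtain c where "i = j + c + 1" by (auto simp: mnat_less_add_iff)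
    then have i: "i = j + (c + 1)" by (simp add: ac_simps)
    have "c + 1 \<le> i" unfolding i by simp
    then have "c + 1 < k" using ij(1) by simp
    then obtain q where q: "m = (c + 1) * q" using q[of "c + 1"] by (auto simp: mnat_less_Suc)
    \<comment> \<open>The same computation with \<open>j - i = -(c + 1)\<close>; the changed sign
      leads to the second Bezout form.\<close>
    have "prm m i * ((j + 1) * (j + 1) * q) + prm m j = prm m j * ((i + 1) * (j + 1) * q) + 1"
      unfolding prm_def q i by (simp add: algebra_simps)
    then have *: "prm m i * (n * ((j + 1) * (j + 1) * q)) + n * prm m j = n * prm m j * ((i + 1) * (j + 1) * q) + n"
      by (rule mult_bezout2)
    have "prm m i dvd prm m i * (n * ((j + 1) * (j + 1) * q)) + n * prm m j"
      using dvd by (intro dvd_add dvd_triv_left)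
    moreover have "prm m i dvd n * prm m j * ((i + 1) * (j + 1) * q)" using dvd by (rule dvd_mult2)
    ultimately show ?thesis unfolding * by (simp only: dvd_add_right_iff)
  qed
qed

definition common :: "mnat \<Rightarrow> mnat \<Rightarrow> mnat \<Rightarrow> bool" where
  "common k m N \<longleftrightarrow> 0 < N \<and> (\<forall>i. i < k \<longrightarrow> prm m i dvd N)"

lemma fn_prm: "fn f \<Longrightarrow> fn g \<Longrightarrow> fn (\<lambda>e. prm (f e) (g e))"
  unfolding prm_def by (intro fn_intros)

lemma common_exists: "\<exists>N. common k m N"
proof (rule mnat_induct[of "\<lambda>k. \<exists>N. common k m N"])
  show "sig (\<lambda>e. \<exists>N. common (e 0) m N)"
    unfolding common_def by (intro sig_ex dec_sig dec_intros dec_dvd fn_prm)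
  show "\<exists>N. common 0 m N" unfolding common_def by (intro exI[of _ 1]) simp
  fix k assume "\<exists>N. common k m N"
  then obtain N where N: "common k m N" ..
  then have "0 < N * prm m k" using prm_pos[of m k] by (simp add: common_def mnat_pos_iff)
  then show "\<exists>N. common (k + 1) m N"
    using N by (intro exI[of _ "N * prm m k"]) (auto simp: common_def mnat_less_Suc le_less)
qed

text \<open>The least common multiple of the moduli selected by \<open>P\<close>. Minimization
  avoids a product over \<open>P\<close>, which would need recursion.\<close>

definition lcode :: "mnat \<Rightarrow> mnat \<Rightarrow> (mnat \<Rightarrow> bool) \<Rightarrow> mnat" where
  "lcode k m P = (LEAST n. 0 < n \<and> (\<forall>i. i < k \<longrightarrow> P i \<longrightarrow> prm m i dvd n))"

text \<open>Minimality does the work: if the modulus of some \<open>i\<close> outside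
  \<open>P\<close> divided the number, it could be cancelled, and by coprimality the smaller
  quotient would still be a multiple of all required moduli. The bound \<open>N\<close> is
  independent of \<open>P\<close>.\<close>

lemma lcode:
  assumes m: "modulus k m" and N: "common k m N" and P: "dec (\<lambda>e. P (e 0))"
  shows "lcode k m P \<le> N" "0 < lcode k m P" "i < k \<Longrightarrow> prm m i dvd lcode k m P \<longleftrightarrow> P i"
    "0 < n \<Longrightarrow> (\<And>i. i < k \<Longrightarrow> P i \<Longrightarrow> prm m i dvd n) \<Longrightarrow> lcode k m P \<le> n"
proof -
  let ?R = "\<lambda>n. 0 < n \<and> (\<forall>i. i < k \<longrightarrow> P i \<longrightarrow> prm m i dvd n)"
  have R: "dec (\<lambda>e. ?R (e 0))"
    by (intro dec_intros dec_dvd fn_prm P)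
  have "?R N" using N unfolding common_def by blast
  note L = Least_dec[of ?R, OF R this, folded lcode_def]
  show "lcode k m P \<le> N" "0 < lcode k m P" using L by blast+
  show le: "lcode k m P \<le> n" if "0 < n" "\<And>i. i < k \<Longrightarrow> P i \<Longrightarrow> prm m i dvd n" for n
    using Least_dec(3)[of ?R, OF R, of n] that unfolding lcode_def by blast
  show "prm m i dvd lcode k m P \<longleftrightarrow> P i" if i: "i < k"
  proof
    assume "prm m i dvd lcode k m P"
    then obtain n where n: "lcode k m P = n * prm m i" by (metis dvdE mult.commute)
    show "P i"
    proof (rule ccontr)
      assume "\<not> P i"
      have "prm m j dvd n" if "j < k" "P j" for j
      proof -
        have "i \<noteq> j" using \<open>\<not> P i\<close> \<open>P j\<close> by blast
        moreover have "prm m j dvd n * prm m i" using L(1) that n by auto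
        ultimately show ?thesis using prm_coprime[OF m that(1) i] by blast
      qed
      moreover have "0 < n" using n L(1) by (auto simp: mnat_pos_iff)
      ultimately have "lcode k m P \<le> n" by (rule le[rotated])
      moreover have "n < n * prm m i"
      proof -
        have "0 < n * (m * (i + 1))" using \<open>0 < n\<close> m mnat_zero_less_Suc[of i] by (simp add: modulus_def mnat_pos_iff)
        moreover have "n * prm m i = n + n * (m * (i + 1))" unfolding prm_def by (simp add: algebra_simps)
        ultimately show ?thesis by simp
      qed
      ultimately show False using n by simp
    qed
  qed (use L(1) i in blast)
qed

text \<open>Makes \<open>lcode\<close> a measure that grows strictly with the coded set, in place of
  cardinality.\<close>

lemma lcode_strict_mono:
  assumes m: "modulus k m" and N: "common k m N" and P: "dec (\<lambda>e. P (e 0))" "dec (\<lambda>e. Q (e 0))"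
    and le: "\<And>i. i < k \<Longrightarrow> P i \<Longrightarrow> Q i" and i: "i < k" "Q i" "\<not> P i"
  shows "lcode k m P < lcode k m Q"
proof -
  have "lcode k m P \<le> lcode k m Q"
    using lcode[OF m N P(1)] lcode[OF m N P(2)] le by blast
  moreover have "lcode k m P \<noteq> lcode k m Q"
    using lcode(3)[OF m N P(1) i(1)] lcode(3)[OF m N P(2) i(1)] i by metis
  ultimately show ?thesis by simp
qed

text \<open>The bound is uniform in \<open>P\<close>: every decidable subset of the first
  \<open>k\<close> numbers has its code below it. This is the form in which "finitely many subsets"
  is used.\<close>

lemma finite_codes:
  "\<exists>B. \<forall>P. dec (\<lambda>e. P (e 0)) \<longrightarrow> (\<exists>x. x < B \<and> fcode x \<and> (\<forall>i. el i x \<longleftrightarrow> i < k \<and> P i))"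
proof -
  obtain m where m: "modulus k m" using modulus_exists by blast
  obtain N where N: "common k m N" using common_exists by blast
  have "\<exists>x. x < pr k (pr m N) + 1 \<and> fcode x \<and> (\<forall>i. el i x \<longleftrightarrow> i < k \<and> P i)"
    if P: "dec (\<lambda>e. P (e 0))" for P
  proof -
    let ?R = "\<lambda>x. repr x \<and> (\<forall>i. el i x \<longleftrightarrow> i < k \<and> P i)"
    \<comment> \<open>Members of a code are smaller than the code, so comparing members is a bounded
      matter.\<close>
    have R: "?R x \<longleftrightarrow> repr x \<and> (\<forall>i. i < x + k \<longrightarrow> (el i x \<longleftrightarrow> i < k \<and> P i))" for x
    proof -
      have "i < x + k" if "i < x \<or> i < k" for i
        using that unfolding emb using emb_nonneg[of x] emb_nonneg[of k] by linarith
      then show ?thesis using el_less by blast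
    qed
    have "dec (\<lambda>e. ?R (e 0))" unfolding R by (intro dec_intros dec_repr dec_el P)
    moreover have "?R (pr k (pr m (lcode k m P)))"
      using lcode(3)[OF m N P] unfolding repr_def el_pr prm_def by blast
    ultimately have "\<exists>x. ?R x \<and> (\<forall>y. y < x \<longrightarrow> \<not> ?R y)" by (rule least_exists[of ?R])
    then obtain x where x: "?R x" "\<And>y. y < x \<Longrightarrow> \<not> ?R y" by blast
    have "fcode x" unfolding fcode_def using x(1,2) by blast
    have "x \<le> pr k (pr m (lcode k m P))" using x(2) \<open>?R (pr k (pr m (lcode k m P)))\<close> not_less by blast
    also have "\<dots> \<le> pr k (pr m N)"
      by (intro pr_mono order.refl lcode(1)[OF m N P])
    finally show ?thesis using x(1) \<open>fcode x\<close> unfolding mnat_less_Suc by blast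
  qed
  then show ?thesis by blast
qed

section \<open>Translating object formulas into predicates on the model\<close>

section \<open>Evaluation of formulas with named variables\<close>

text \<open>A world is an environment together with the depths \<open>d\<close> and \<open>e\<close> at which a named formula is
  turned into a formula; passing a quantifier leads to an extension. Denotations are required to
  persist in all extensions.\<close>

datatype world = World (dn: nat) (en: "nat \<Rightarrow> mnat") (ds: nat) (es: "nat \<Rightarrow> mnat set")

definition ext :: "world \<Rightarrow> world \<Rightarrow> bool" where
  "ext w w' \<longleftrightarrow> dn w \<le> dn w' \<and> (\<forall>n. en w' (n + (dn w' - dn w)) = en w n) \<and>
     ds w \<le> ds w' \<and> (\<forall>n. es w' (n + (ds w' - ds w)) = es w n)"

definition tden :: "world \<Rightarrow> ntm \<Rightarrow> mnat \<Rightarrow> bool" where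
  "tden w t v \<longleftrightarrow> (\<forall>w'. ext w w' \<longrightarrow> val mm (en w') (t (dn w')) = v)"

definition sden :: "world \<Rightarrow> nset \<Rightarrow> mnat set \<Rightarrow> bool" where
  "sden w X S \<longleftrightarrow> (\<forall>w'. ext w w' \<longrightarrow> es w' (X (ds w')) = S)"

definition fden :: "world \<Rightarrow> nfm \<Rightarrow> bool \<Rightarrow> bool" where
  "fden w P b \<longleftrightarrow> (\<forall>w'. ext w w' \<longrightarrow> sat mm (en w') (es w') (P (dn w') (ds w')) = b)"

definition cden :: "world \<Rightarrow> nclass \<Rightarrow> (mnat \<Rightarrow> bool) \<Rightarrow> bool" where
  "cden w U S \<longleftrightarrow> (\<forall>w' t v. ext w w' \<longrightarrow> tden w' t v \<longrightarrow> fden w' (U t) (S v))"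

lemma ext_refl: "ext w w" by (simp add: ext_def)

lemma ext_trans: assumes "ext u v" "ext v w" shows "ext u w"
proof -
  have "dn u \<le> dn v" "dn v \<le> dn w" "ds u \<le> ds v" "ds v \<le> ds w" using assms by (auto simp: ext_def)
  then have eq: "n + (dn w - dn u) = (n + (dn v - dn u)) + (dn w - dn v)"
     "n + (ds w - ds u) = (n + (ds v - ds u)) + (ds w - ds v)" for n by auto
  have "en w (n + (dn w - dn u)) = en u n" "es w (n + (ds w - ds u)) = es u n" for n
    unfolding eq using assms by (simp_all only: ext_def)
  moreover have "dn u \<le> dn w" "ds u \<le> ds w"
    using \<open>dn u \<le> dn v\<close> \<open>dn v \<le> dn w\<close> \<open>ds u \<le> ds v\<close> \<open>ds v \<le> ds w\<close> by simp_all
  ultimately show ?thesis by (simp only: ext_def simp_thms)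
qed

lemma tden_mono: "tden w t v \<Longrightarrow> ext w w' \<Longrightarrow> tden w' t v" unfolding tden_def using ext_trans by blast
lemma sden_mono: "sden w t v \<Longrightarrow> ext w w' \<Longrightarrow> sden w' t v" unfolding sden_def using ext_trans by blast
lemma cden_mono: "cden w t v \<Longrightarrow> ext w w' \<Longrightarrow> cden w' t v" unfolding cden_def using ext_trans by blast

lemma cdenD: "cden w U S \<Longrightarrow> ext w w' \<Longrightarrow> tden w' t v \<Longrightarrow> fden w' (U t) (S v)"
  unfolding cden_def by blast

lemma cdenI: "(\<And>w' t v. ext w w' \<Longrightarrow> tden w' t v \<Longrightarrow> fden w' (U t) (S v)) \<Longrightarrow> cden w U S"
  unfolding cden_def by blast

lemma fden_nAll:
  assumes "\<And>w' v x. ext w w' \<Longrightarrow> tden w' v x \<Longrightarrow> fden w' (P v) (b x)"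
  shows "fden w (nAll P) (\<forall>x. b x)"
  unfolding fden_def
proof (intro allI impI)
  fix w' assume w: "ext w w'"
  \<comment> \<open>The index that the binder computes at depth \<open>d\<close>; in every extension
    of the world \<open>?w\<close> below it points to the slot holding \<open>x\<close>.\<close>
  let ?v = "\<lambda>d. Var (d - Suc (dn w'))"
  have "sat mm (case_nat x (en w')) (es w') (P ?v (Suc (dn w')) (ds w')) = b x" for x
  proof -
    let ?w = "World (Suc (dn w')) (case_nat x (en w')) (ds w') (es w')"
    have e: "ext w' ?w" by (simp add: ext_def)
    have "tden ?w ?v x" unfolding tden_def ext_def
    proof (intro allI impI, elim conjE)
      fix u assume "\<forall>n. en u (n + (dn u - dn ?w)) = en ?w n"
      from spec[OF this, of 0] show "val mm (en u) (Var (dn u - Suc (dn w'))) = x" by simp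
    qed
    from assms[OF ext_trans[OF w e] this] show ?thesis unfolding fden_def using ext_refl by fastforce
  qed
  then show "sat mm (en w') (es w') (nAll P (dn w') (ds w')) = (\<forall>x. b x)" by (simp add: nAll_def)
qed

lemma fden_nAllS:
  assumes "\<And>w' X S. ext w w' \<Longrightarrow> sden w' X S \<Longrightarrow> fden w' (P X) (b S)"
  shows "fden w (nAllS P) (\<forall>S\<in>Sets. b S)"
  unfolding fden_def
proof (intro allI impI)
  fix w' assume w: "ext w w'"
  let ?v = "\<lambda>e. e - Suc (ds w')"
  have "sat mm (en w') (case_nat S (es w')) (P ?v (dn w') (Suc (ds w'))) = b S" for S
  proof -
    let ?w = "World (dn w') (en w') (Suc (ds w')) (case_nat S (es w'))"
    have e: "ext w' ?w" by (simp add: ext_def)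
    have "sden ?w ?v S" unfolding sden_def ext_def
    proof (intro allI impI, elim conjE)
      fix u assume "\<forall>n. es u (n + (ds u - ds ?w)) = es ?w n"
      from spec[OF this, of 0] show "es u (ds u - Suc (ds w')) = S" by simp
    qed
    from assms[OF ext_trans[OF w e] this] show ?thesis unfolding fden_def using ext_refl by fastforce
  qed
  then show "sat mm (en w') (es w') (nAllS P (dn w') (ds w')) = (\<forall>S\<in>Sets. b S)" by (simp add: nAllS_def)
qed

lemma fden_nNeg: "fden w P a \<Longrightarrow> fden w (nNeg P) (\<not> a)" by (simp add: fden_def nNeg_def)
lemma fden_nImp: "fden w P a \<Longrightarrow> fden w Q b \<Longrightarrow> fden w (nImp P Q) (a \<longrightarrow> b)" by (simp add: fden_def nImp_def)
lemma fden_nConj: "fden w P a \<Longrightarrow> fden w Q b \<Longrightarrow> fden w (nConj P Q) (a \<and> b)" by (simp add: fden_def nConj_def)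
lemma fden_nDisj: "fden w P a \<Longrightarrow> fden w Q b \<Longrightarrow> fden w (nDisj P Q) (a \<or> b)" by (simp add: fden_def nDisj_def)
lemma fden_nIff: "fden w P a \<Longrightarrow> fden w Q b \<Longrightarrow> fden w (nIff P Q) (a \<longleftrightarrow> b)" by (simp add: fden_def nIff_def)

lemma fden_nEx:
  assumes "\<And>w' v x. ext w w' \<Longrightarrow> tden w' v x \<Longrightarrow> fden w' (P v) (b x)"
  shows "fden w (nEx P) (\<exists>x. b x)"
proof -
  have "fden w (nNeg (nAll (\<lambda>v. nNeg (P v)))) (\<not> (\<forall>x. \<not> b x))"
    by (intro fden_nNeg fden_nAll assms)
  then show ?thesis by (simp add: nNeg_def nAll_def nEx_def Exists_def)
qed

lemma fden_nExS:
  assumes "\<And>w' X S. ext w w' \<Longrightarrow> sden w' X S \<Longrightarrow> fden w' (P X) (b S)"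
  shows "fden w (nExS P) (\<exists>S\<in>Sets. b S)"
proof -
  have "fden w (nNeg (nAllS (\<lambda>v. nNeg (P v)))) (\<not> (\<forall>S\<in>Sets. \<not> b S))"
    by (intro fden_nNeg fden_nAllS assms)
  then show ?thesis by (simp add: nNeg_def nAllS_def nExS_def ExistsS_def)
qed

lemma fden_nEq: "tden w s x \<Longrightarrow> tden w t y \<Longrightarrow> fden w (nEq s t) (x = y)"
  by (simp add: fden_def tden_def nEq_def)
lemma fden_nLess: "tden w s x \<Longrightarrow> tden w t y \<Longrightarrow> fden w (nLess s t) (x < y)"
  by (simp add: fden_def tden_def nLess_def)
lemma fden_nLe: "tden w s x \<Longrightarrow> tden w t y \<Longrightarrow> fden w (nLe s t) (x \<le> y)"
  unfolding nLe_def le_less by (intro fden_nDisj fden_nLess fden_nEq)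
lemma fden_nMem: "tden w s x \<Longrightarrow> sden w X S \<Longrightarrow> fden w (nMem s X) (x \<in> S)"
  by (simp add: fden_def tden_def sden_def nMem_def)
lemma tden_nZero: "tden w nZero 0" by (simp add: tden_def nZero_def)
lemma tden_nOne: "tden w nOne 1" by (simp add: tden_def nOne_def)
lemma tden_nAdd: "tden w s x \<Longrightarrow> tden w t y \<Longrightarrow> tden w (nAdd s t) (x + y)" by (simp add: tden_def nAdd_def)
lemma tden_nMul: "tden w s x \<Longrightarrow> tden w t y \<Longrightarrow> tden w (nMul s t) (x * y)" by (simp add: tden_def nMul_def)
lemma tden_pair: "tden w s x \<Longrightarrow> tden w t y \<Longrightarrow> tden w (pair s t) (pr x y)"
  unfolding pair_def pr_def by (intro tden_nAdd tden_nMul)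

named_theorems den
lemmas [den] = fden_nAll fden_nAllS fden_nNeg fden_nImp fden_nConj fden_nDisj fden_nIff fden_nEx fden_nExS
  fden_nEq fden_nLess fden_nLe fden_nMem tden_nZero tden_nOne tden_nAdd tden_nMul tden_pair
lemmas den_lift = cdenD tden_mono sden_mono cden_mono

text \<open>The pattern of all translation lemmas: \<open>den\<close> follows the syntax of the
  formula, and the remaining goals express that denotations of variables persist along
  \<open>ext\<close>.\<close>

lemma fden_represents [den]: "tden w t x \<Longrightarrow> fden w (represents t) (repr x)"
  unfolding represents_def repr_def
  by (intro den) (assumption | erule den_lift | rule ext_refl | erule ext_trans)+

lemma fden_elt [den]: "tden w s i \<Longrightarrow> tden w t x \<Longrightarrow> fden w (elt s t) (el i x)"
  unfolding elt_def el_def dvd_def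
  by (intro den) (assumption | erule den_lift | rule ext_refl | erule ext_trans)+

lemma fden_finset_code [den]: "tden w t x \<Longrightarrow> fden w (finset_code t) (fcode x)"
  unfolding finset_code_def fcode_def
  by (intro den) (assumption | erule den_lift | rule ext_refl | erule ext_trans)+

subsection \<open>The notions of the theorem inside the model\<close>

text \<open>The semantic counterparts copy the object definitions quantifier by quantifier, so that
  translation is purely syntax-directed; convenient characterizations are derived
  afterwards.\<close>

definition Mdiagram :: "mnat \<Rightarrow> bool" where
  "Mdiagram D \<longleftrightarrow> (fcode D \<and>
     (\<exists>k. 0 < k \<and>
        (\<forall>p. el p D \<longrightarrow> (\<exists>i. \<exists>r. p = pr i r \<and> 0 < i \<and> i \<le> k \<and> 0 < r)) \<and>
        (\<forall>i. 0 < i \<and> i \<le> k \<longrightarrow> (\<exists>r. el (pr i r) D))) \<and>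
     (\<forall>i. \<forall>r. \<forall>s. el (pr i r) D \<and> el (pr i s) D \<longrightarrow> r = s) \<and>
     (\<forall>i. \<forall>j. \<forall>r. \<forall>s. i < j \<and> el (pr i r) D \<and> el (pr j s) D \<longrightarrow> s \<le> r))"

lemma fden_diagram [den]: "tden w D' D \<Longrightarrow> fden w (diagram D') (Mdiagram D)"
  unfolding diagram_def Mdiagram_def
  by (intro den) (assumption | erule den_lift | rule ext_refl | erule ext_trans)+

definition Mrow :: "mnat \<Rightarrow> mnat \<Rightarrow> mnat \<Rightarrow> bool" where
  "Mrow D i r \<longleftrightarrow> (el (pr i r) D \<or> (r = 0 \<and> \<not> (\<exists>s. el (pr i s) D)))"

lemma fden_row [den]: "tden w D' D \<Longrightarrow> tden w i' i \<Longrightarrow> tden w r' r \<Longrightarrow> fden w (row D' i' r') (Mrow D i r)"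
  unfolding row_def Mrow_def
  by (intro den) (assumption | erule den_lift | rule ext_refl | erule ext_trans)+

definition Mcol :: "mnat \<Rightarrow> mnat \<Rightarrow> mnat \<Rightarrow> bool" where
  "Mcol D j c \<longleftrightarrow> (\<forall>i. 0 < i \<longrightarrow> (i \<le> c \<longleftrightarrow> (\<exists>r. Mrow D i r \<and> j \<le> r)))"

lemma fden_col [den]: "tden w D' D \<Longrightarrow> tden w j' j \<Longrightarrow> tden w c' c \<Longrightarrow> fden w (col D' j' c') (Mcol D j c)"
  unfolding col_def Mcol_def
  by (intro den) (assumption | erule den_lift | rule ext_refl | erule ext_trans)+

definition Mdle :: "mnat \<Rightarrow> mnat \<Rightarrow> bool" where
  "Mdle D E \<longleftrightarrow> (\<forall>i. \<forall>r. \<forall>s. 0 < i \<and> Mrow D i r \<and> Mrow E i s \<longrightarrow> r \<le> s)"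

lemma fden_dle [den]: "tden w D' D \<Longrightarrow> tden w E' E \<Longrightarrow> fden w (dle D' E') (Mdle D E)"
  unfolding dle_def Mdle_def
  by (intro den) (assumption | erule den_lift | rule ext_refl | erule ext_trans)+

definition Mdless :: "mnat \<Rightarrow> mnat \<Rightarrow> bool" where
  "Mdless D E \<longleftrightarrow> (Mdle D E \<and> \<not> (D = E))"

lemma fden_dless [den]: "tden w D' D \<Longrightarrow> tden w E' E \<Longrightarrow> fden w (dless D' E') (Mdless D E)"
  unfolding dless_def Mdless_def
  by (intro den) (assumption | erule den_lift | rule ext_refl | erule ext_trans)+

definition Mis_max :: "mnat \<Rightarrow> mnat \<Rightarrow> mnat \<Rightarrow> bool" where
  "Mis_max r s t \<longleftrightarrow> ((r \<le> s \<and> t = s) \<or> (s \<le> r \<and> t = r))"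

lemma fden_is_max [den]: "tden w r' r \<Longrightarrow> tden w s' s \<Longrightarrow> tden w t' t \<Longrightarrow> fden w (is_max r' s' t') (Mis_max r s t)"
  unfolding is_max_def Mis_max_def
  by (intro den) (assumption | erule den_lift | rule ext_refl | erule ext_trans)+

definition Mdunion :: "mnat \<Rightarrow> mnat \<Rightarrow> mnat \<Rightarrow> bool" where
  "Mdunion D E F \<longleftrightarrow> (Mdiagram F \<and>
     (\<forall>i. \<forall>r. \<forall>s. \<forall>t. 0 < i \<and> Mrow D i r \<and> Mrow E i s \<and> Mrow F i t \<longrightarrow> Mis_max r s t))"

lemma fden_dunion [den]: "tden w D' D \<Longrightarrow> tden w E' E \<Longrightarrow> tden w F' F \<Longrightarrow> fden w (dunion D' E' F') (Mdunion D E F)"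
  unfolding dunion_def Mdunion_def
  by (intro den) (assumption | erule den_lift | rule ext_refl | erule ext_trans)+

definition Mdrow :: "mnat \<Rightarrow> mnat \<Rightarrow> bool" where
  "Mdrow D F \<longleftrightarrow> (Mdiagram F \<and>
     (\<forall>r. \<forall>t. Mrow D (1 + 1) r \<and> Mrow F 1 t \<longrightarrow> Mis_max r 1 t) \<and>
     (\<forall>i. \<forall>r. 1 < i \<longrightarrow> (Mrow F i r \<longleftrightarrow> Mrow D i r)))"

lemma fden_drow [den]: "tden w D' D \<Longrightarrow> tden w F' F \<Longrightarrow> fden w (drow D' F') (Mdrow D F)"
  unfolding drow_def Mdrow_def
  by (intro den) (assumption | erule den_lift | rule ext_refl | erule ext_trans)+

definition Mdcol :: "mnat \<Rightarrow> mnat \<Rightarrow> bool" where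
  "Mdcol D F \<longleftrightarrow> (Mdiagram F \<and>
     (\<forall>c. \<forall>t. Mcol D (1 + 1) c \<and> Mcol F 1 t \<longrightarrow> Mis_max c 1 t) \<and>
     (\<forall>j. \<forall>c. 1 < j \<longrightarrow> (Mcol F j c \<longleftrightarrow> Mcol D j c)))"

lemma fden_dcol [den]: "tden w D' D \<Longrightarrow> tden w F' F \<Longrightarrow> fden w (dcol D' F') (Mdcol D F)"
  unfolding dcol_def Mdcol_def
  by (intro den) (assumption | erule den_lift | rule ext_refl | erule ext_trans)+

definition Mclass_le :: "(mnat \<Rightarrow> bool) \<Rightarrow> (mnat \<Rightarrow> bool) \<Rightarrow> bool" where
  "Mclass_le U V \<longleftrightarrow> (\<forall>n. U n \<longrightarrow> V n)"

lemma fden_class_le [den]: "cden w U' U \<Longrightarrow> cden w V' V \<Longrightarrow> fden w (class_le U' V') (Mclass_le U V)"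
  unfolding class_le_def Mclass_le_def
  by (intro den) (assumption | erule den_lift | rule ext_refl | erule ext_trans)+

definition Mclass_less :: "(mnat \<Rightarrow> bool) \<Rightarrow> (mnat \<Rightarrow> bool) \<Rightarrow> bool" where
  "Mclass_less U V \<longleftrightarrow> (Mclass_le U V \<and> \<not> Mclass_le V U)"

lemma fden_class_less [den]: "cden w U' U \<Longrightarrow> cden w V' V \<Longrightarrow> fden w (class_less U' V') (Mclass_less U V)"
  unfolding class_less_def Mclass_less_def
  by (intro den) (assumption | erule den_lift | rule ext_refl | erule ext_trans)+

definition Mclass_eq :: "(mnat \<Rightarrow> bool) \<Rightarrow> (mnat \<Rightarrow> bool) \<Rightarrow> bool" where
  "Mclass_eq U V \<longleftrightarrow> (\<forall>n. U n \<longleftrightarrow> V n)"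

lemma fden_class_eq [den]: "cden w U' U \<Longrightarrow> cden w V' V \<Longrightarrow> fden w (class_eq U' V') (Mclass_eq U V)"
  unfolding class_eq_def Mclass_eq_def
  by (intro den) (assumption | erule den_lift | rule ext_refl | erule ext_trans)+

definition Mfinite_set :: "mnat set \<Rightarrow> bool" where
  "Mfinite_set X \<longleftrightarrow> (\<exists>b. \<forall>n. n \<in> X \<longrightarrow> n < b)"

lemma fden_finite_set [den]: "sden w X' X \<Longrightarrow> fden w (finite_set X') (Mfinite_set X)"
  unfolding finite_set_def Mfinite_set_def
  by (intro den) (assumption | erule den_lift | rule ext_refl | erule ext_trans)+

definition Mclosed_class :: "(mnat \<Rightarrow> bool) \<Rightarrow> bool" where
  "Mclosed_class U \<longleftrightarrow> (Mclass_le U Mdiagram \<and>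
     (\<forall>D. Mdiagram D \<longrightarrow> (U D \<longleftrightarrow> (\<forall>E. Mdiagram E \<and> Mdless D E \<longrightarrow> U E))))"

definition Mdiagram_sequence :: "mnat set \<Rightarrow> bool" where
  "Mdiagram_sequence X \<longleftrightarrow> ((\<forall>p. p \<in> X \<longrightarrow> (\<exists>i. \<exists>D. p = pr i D \<and> 0 < i \<and> Mdiagram D)) \<and>
      (\<forall>i. 0 < i \<longrightarrow> (\<exists>D. pr i D \<in> X)) \<and>
      (\<forall>i. \<forall>D. \<forall>E. pr i D \<in> X \<and> pr i E \<in> X \<longrightarrow> D = E))"

lemma fden_diagram_sequence [den]: "sden w X' X \<Longrightarrow> fden w (diagram_sequence X') (Mdiagram_sequence X)"
  unfolding diagram_sequence_def Mdiagram_sequence_def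
  by (intro den) (assumption | erule den_lift | rule ext_refl | erule ext_trans)+

definition Mset_class :: "mnat set \<Rightarrow> mnat \<Rightarrow> bool" where
  "Mset_class X = (\<lambda>n. n \<in> X)"
definition Mucl :: "(mnat \<Rightarrow> bool) \<Rightarrow> mnat \<Rightarrow> bool" where
  "Mucl U = (\<lambda>E. Mdiagram E \<and> (\<exists>D. U D \<and> Mdle D E))"
definition Mcl :: "mnat set \<Rightarrow> mnat \<Rightarrow> bool" where
  "Mcl X = Mucl (\<lambda>F. \<exists>D. \<exists>E. \<exists>G. \<exists>H. D \<in> X \<and> E \<in> X \<and> Mdrow D G \<and> Mdcol E H \<and> Mdunion G H F)"
definition Mfinitely_generated :: "(mnat \<Rightarrow> bool) \<Rightarrow> bool" where
  "Mfinitely_generated U \<longleftrightarrow>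
     (\<exists>X\<in>Sets. Mfinite_set X \<and> Mclass_le (Mset_class X) Mdiagram \<and> Mclass_eq U (Mcl X))"
definition Mrange_class :: "mnat set \<Rightarrow> mnat \<Rightarrow> bool" where
  "Mrange_class X = (\<lambda>D. \<exists>i. 0 < i \<and> pr i D \<in> X)"
definition Msection_class :: "mnat set \<Rightarrow> mnat \<Rightarrow> mnat \<Rightarrow> bool" where
  "Msection_class X i = (\<lambda>n. pr i n \<in> X)"
definition Mascending :: "mnat set \<Rightarrow> bool" where
  "Mascending X \<longleftrightarrow> (\<forall>i. \<forall>j. 0 < i \<and> i < j \<longrightarrow> Mclass_less (Msection_class X i) (Msection_class X j))"

lemma cden_set_class [den]: "sden w X S \<Longrightarrow> cden w (set_class X) (Mset_class S)"
  unfolding set_class_def Mset_class_def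
  by (intro cdenI den) (assumption | erule den_lift | rule ext_refl | erule ext_trans)+

lemma cden_ucl [den]: "cden w U S \<Longrightarrow> cden w (ucl U) (Mucl S)"
  unfolding ucl_def Mucl_def
  by (intro cdenI den) (assumption | erule den_lift | rule ext_refl | erule ext_trans)+

lemma cden_cl [den]: "sden w X S \<Longrightarrow> cden w (cl X) (Mcl S)"
  unfolding cl_def Mcl_def
  by (intro cdenI den) (assumption | erule den_lift | rule ext_refl | erule ext_trans)+

lemma cden_diagram [den]: "cden w diagram Mdiagram"
  by (intro cdenI den) (assumption | erule den_lift | rule ext_refl | erule ext_trans)+

lemma fden_closed_class [den]: "cden w U S \<Longrightarrow> fden w (closed_class U) (Mclosed_class S)"
  unfolding closed_class_def Mclosed_class_def
  by (intro den) (assumption | erule den_lift | rule ext_refl | erule ext_trans)+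

lemma fden_finitely_generated [den]: "cden w U S \<Longrightarrow> fden w (finitely_generated U) (Mfinitely_generated S)"
  unfolding finitely_generated_def Mfinitely_generated_def
  by (intro den) (assumption | erule den_lift | rule ext_refl | erule ext_trans)+

lemma cden_range_class [den]: "sden w X S \<Longrightarrow> cden w (range_class X) (Mrange_class S)"
  unfolding range_class_def Mrange_class_def
  by (intro cdenI den) (assumption | erule den_lift | rule ext_refl | erule ext_trans)+

lemma cden_section_class [den]: "sden w X S \<Longrightarrow> tden w t i \<Longrightarrow> cden w (section_class X t) (Msection_class S i)"
  unfolding section_class_def Msection_class_def
  by (intro cdenI den) (assumption | erule den_lift | rule ext_refl | erule ext_trans)+

lemma fden_ascending [den]: "sden w X S \<Longrightarrow> fden w (ascending X) (Mascending S)"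
  unfolding ascending_def Mascending_def
  by (intro den) (assumption | erule den_lift | rule ext_refl | erule ext_trans)+

definition MWPO :: bool where
  "MWPO \<longleftrightarrow> (\<forall>X\<in>Sets. Mdiagram_sequence X \<longrightarrow>
     (\<exists>i. \<exists>j. \<exists>D. \<exists>E. 0 < i \<and> i < j \<and> pr i D \<in> X \<and> pr j E \<in> X \<and> Mdle D E))"
definition Mno_ascending :: bool where
  "Mno_ascending \<longleftrightarrow> \<not> (\<exists>X\<in>Sets. Mascending X \<and> (\<forall>i. 0 < i \<longrightarrow> Mclosed_class (Msection_class X i)))"
definition Mno_ascending_fg :: bool where
  "Mno_ascending_fg \<longleftrightarrow> \<not> (\<exists>X\<in>Sets. Mascending X \<and>
     (\<forall>i. 0 < i \<longrightarrow> Mclosed_class (Msection_class X i) \<and> Mfinitely_generated (Msection_class X i)))"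
definition Mclosed_sets_fg :: bool where
  "Mclosed_sets_fg \<longleftrightarrow> (\<forall>X\<in>Sets. Mclosed_class (Mset_class X) \<longrightarrow> Mfinitely_generated (Mset_class X))"
definition Mclosed_sequences_fg :: bool where
  "Mclosed_sequences_fg \<longleftrightarrow> (\<forall>X\<in>Sets. Mdiagram_sequence X \<and> Mclosed_class (Mrange_class X) \<longrightarrow>
     Mfinitely_generated (Mrange_class X))"

lemma fden_WPO [den]: "fden w WPO_D MWPO"
  unfolding WPO_D_def MWPO_def
  by (intro den) (assumption | erule den_lift | rule ext_refl | erule ext_trans)+

lemma fden_no_ascending [den]: "fden w no_ascending_closed Mno_ascending"
  unfolding no_ascending_closed_def Mno_ascending_def
  by (intro den) (assumption | erule den_lift | rule ext_refl | erule ext_trans)+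

lemma fden_no_ascending_fg [den]: "fden w no_ascending_fg_closed Mno_ascending_fg"
  unfolding no_ascending_fg_closed_def Mno_ascending_fg_def
  by (intro den) (assumption | erule den_lift | rule ext_refl | erule ext_trans)+

lemma fden_closed_sets_fg [den]: "fden w closed_sets_fg Mclosed_sets_fg"
  unfolding closed_sets_fg_def Mclosed_sets_fg_def
  by (intro den) (assumption | erule den_lift | rule ext_refl | erule ext_trans)+

lemma fden_closed_sequences_fg [den]: "fden w closed_sequences_fg Mclosed_sequences_fg"
  unfolding closed_sequences_fg_def Mclosed_sequences_fg_def
  by (intro den) (assumption | erule den_lift | rule ext_refl | erule ext_trans)+

lemma fden_sentence: "(\<And>w. fden w P b) \<Longrightarrow> sat mm e r (sentence P) = b"
  unfolding sentence_def fden_def using ext_refl[of "World 0 e 0 r"] by fastforce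

lemmas sat_statements =
  fden_sentence[OF fden_WPO] fden_sentence[OF fden_no_ascending] fden_sentence[OF fden_no_ascending_fg]
  fden_sentence[OF fden_closed_sets_fg] fden_sentence[OF fden_closed_sequences_fg]

section \<open>Row functions and the construction of diagrams\<close>

section \<open>Diagrams\<close>

text \<open>The second disjunct makes the search total: if the row is absent, it holds of 0.
  Bounding \<open>s\<close> by the code keeps the condition decidable.\<close>

definition rw :: "mnat \<Rightarrow> mnat \<Rightarrow> mnat" where
  "rw D i = (LEAST r. el (pr i r) D \<or> (\<forall>s. s < D \<longrightarrow> \<not> el (pr i s) D))"

lemma el_pr_less: "el (pr i r) D \<Longrightarrow> i < D" "el (pr i r) D \<Longrightarrow> r < D"
  using el_less[of "pr i r" D] pr_ge[of i r] pr_ge(2)[of r i] by auto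

lemma fn_rw: "fn f \<Longrightarrow> fn g \<Longrightarrow> fn (\<lambda>e. rw (f e) (g e))"
proof (rule fn_app2[of rw])
  show "fn (\<lambda>e. rw (e 0) (e (Suc 0)))"
    unfolding rw_def by (rule fn_Least) (intro dec_intros dec_el fn_pr, blast)
qed

lemma rw_cases:
  "el (pr i (rw D i)) D \<or> rw D i = 0 \<and> (\<forall>s. \<not> el (pr i s) D)"
proof -
  let ?P = "\<lambda>r. el (pr i r) D \<or> (\<forall>s. s < D \<longrightarrow> \<not> el (pr i s) D)"
  have d: "dec (\<lambda>e. ?P (e 0))" by (intro dec_intros dec_el fn_pr)
  show ?thesis
  proof (cases "\<exists>s. s < D \<and> el (pr i s) D")
    case True
    then obtain s where "?P s" by blast
    from Least_dec(1)[of ?P, OF d this] show ?thesis using True unfolding rw_def by blast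
  next
    case False
    then have "?P 0" by blast
    from Least_dec(3)[of ?P, OF d this] have "rw D i = 0" unfolding rw_def by simp
    then show ?thesis using False el_pr_less by blast
  qed
qed

lemma rw_zero: "D \<le> i \<Longrightarrow> rw D i = 0"
  using rw_cases[of i D] el_pr_less by force

lemma rw_le: "rw D i \<le> D"
  using rw_cases[of i D] el_pr_less by force

lemma MdiagramD:
  assumes "Mdiagram D"
  shows "fcode D"
    "el p D \<Longrightarrow> \<exists>i r. p = pr i r \<and> 0 < i \<and> 0 < r"
    "el (pr i r) D \<Longrightarrow> 0 < i" "el (pr i r) D \<Longrightarrow> 0 < r"
    "el (pr i r) D \<Longrightarrow> el (pr i s) D \<Longrightarrow> r = s"
    "i < j \<Longrightarrow> el (pr i r) D \<Longrightarrow> el (pr j s) D \<Longrightarrow> s \<le> r"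
    "el (pr i r) D \<Longrightarrow> 0 < j \<Longrightarrow> j \<le> i \<Longrightarrow> \<exists>s. el (pr j s) D"
    "\<exists>r. el (pr 1 r) D"
proof -
  note A = assms[unfolded Mdiagram_def]
  show "fcode D" "el (pr i r) D \<Longrightarrow> el (pr i s) D \<Longrightarrow> r = s"
    "i < j \<Longrightarrow> el (pr i r) D \<Longrightarrow> el (pr j s) D \<Longrightarrow> s \<le> r" using A by blast+
  obtain k where k: "0 < k" "\<And>p. el p D \<Longrightarrow> \<exists>i. \<exists>r. p = pr i r \<and> 0 < i \<and> i \<le> k \<and> 0 < r"
    "\<And>i. 0 < i \<Longrightarrow> i \<le> k \<Longrightarrow> \<exists>r. el (pr i r) D" using A by blast
  show "el p D \<Longrightarrow> \<exists>i r. p = pr i r \<and> 0 < i \<and> 0 < r" using k(2) by blast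
  show "el (pr i r) D \<Longrightarrow> 0 < i" "el (pr i r) D \<Longrightarrow> 0 < r" using k(2)[of "pr i r"] by auto
  show "\<exists>s. el (pr j s) D" if "el (pr i r) D" "0 < j" "j \<le> i"
    using k(2)[OF that(1)] k(3)[OF that(2)] that(3) by auto
  show "\<exists>r. el (pr 1 r) D" using k(1) k(3)[of 1] mnat_Suc_le[of 0 k] by simp
qed

lemma Mrow_rw: "Mdiagram D \<Longrightarrow> Mrow D i r \<longleftrightarrow> r = rw D i"
  using rw_cases[of i D] MdiagramD(5)[of D i r "rw D i"] unfolding Mrow_def by auto

lemma el_rw: "Mdiagram D \<Longrightarrow> el (pr i r) D \<longleftrightarrow> 0 < i \<and> 0 < r \<and> r = rw D i"
  using rw_cases[of i D] MdiagramD(3,4)[of D i r] MdiagramD(5)[of D i r "rw D i"] by auto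

lemma rw_antimono: assumes "Mdiagram D" "0 < i" "i \<le> j" shows "rw D j \<le> rw D i"
proof (cases "i = j \<or> rw D j = 0")
  case False
  then have j: "el (pr j (rw D j)) D" "i < j" using rw_cases[of j D] assms(3) by auto
  then obtain s where s: "el (pr i s) D" using MdiagramD(7)[OF assms(1) j(1) assms(2,3)] by blast
  then have "s = rw D i" using el_rw[OF assms(1)] by blast
  then show ?thesis using MdiagramD(6)[OF assms(1) j(2) s j(1)] by simp
qed auto

lemma rw_1_pos: assumes "Mdiagram D" shows "0 < rw D 1"
proof -
  obtain r where "el (pr 1 r) D" using MdiagramD(8)[OF assms] by (rule exE)
  then show ?thesis using el_rw[OF assms, of 1 r] by blast
qed

lemma diagram_eqI: "Mdiagram D \<Longrightarrow> Mdiagram E \<Longrightarrow> (\<And>i. 0 < i \<Longrightarrow> rw D i = rw E i) \<Longrightarrow> D = E"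
proof (rule fcode_unique)
  assume D: "Mdiagram D" "Mdiagram E" and eq: "\<And>i. 0 < i \<Longrightarrow> rw D i = rw E i"
  show "fcode D" "fcode E" using D MdiagramD(1) by blast+
  fix p
  show "el p D \<longleftrightarrow> el p E"
    using MdiagramD(2)[OF D(1), of p] MdiagramD(2)[OF D(2), of p] el_rw[OF D(1)] el_rw[OF D(2)] eq by metis
qed

text \<open>Row indices, row lengths and the number of rows are all smaller than the code, so every
  quantifier can be bounded by it.\<close>

lemma dec_Mdiagram: "fn f \<Longrightarrow> dec (\<lambda>e. Mdiagram (f e))"
proof (rule dec_app1[of Mdiagram])
  have "Mdiagram D \<longleftrightarrow> fcode D \<and>
     (\<exists>k. k < D \<and> 0 < k \<and>
        (\<forall>p. p < D \<longrightarrow> el p D \<longrightarrow> (\<exists>i. i < D \<and> (\<exists>r. r < D \<and> p = pr i r \<and> 0 < i \<and> i \<le> k \<and> 0 < r))) \<and>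
        (\<forall>i. i < D \<longrightarrow> 0 < i \<and> i \<le> k \<longrightarrow> (\<exists>r. r < D \<and> el (pr i r) D))) \<and>
     (\<forall>i. i < D \<longrightarrow> (\<forall>r. r < D \<longrightarrow> (\<forall>s. s < D \<longrightarrow> el (pr i r) D \<and> el (pr i s) D \<longrightarrow> r = s))) \<and>
     (\<forall>i. i < D \<longrightarrow> (\<forall>j. j < D \<longrightarrow> (\<forall>r. r < D \<longrightarrow> (\<forall>s. s < D \<longrightarrow>
        i < j \<and> el (pr i r) D \<and> el (pr j s) D \<longrightarrow> s \<le> r))))" (is "_ \<longleftrightarrow> _ \<and> ?K' \<and> ?U' \<and> ?A'") for D
  proof -
    have U: "(\<forall>i r s. el (pr i r) D \<and> el (pr i s) D \<longrightarrow> r = s) \<longleftrightarrow> ?U'"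
    proof (intro iffI allI impI)
      fix i r s assume U: ?U' and *: "el (pr i r) D \<and> el (pr i s) D"
      then have "i < D" "r < D" "s < D" using el_pr_less by auto
      then show "r = s" using U * by simp
    qed simp
    have A: "(\<forall>i j r s. i < j \<and> el (pr i r) D \<and> el (pr j s) D \<longrightarrow> s \<le> r) \<longleftrightarrow> ?A'"
    proof (intro iffI allI impI)
      fix i j r s assume A: ?A' and *: "i < j \<and> el (pr i r) D \<and> el (pr j s) D"
      then have "i < D" "j < D" "r < D" "s < D" using el_pr_less by auto
      then show "s \<le> r" using A * by simp
    qed simp
    have K: "(0 < k \<and>
        (\<forall>p. el p D \<longrightarrow> (\<exists>i. \<exists>r. p = pr i r \<and> 0 < i \<and> i \<le> k \<and> 0 < r)) \<and>
        (\<forall>i. 0 < i \<and> i \<le> k \<longrightarrow> (\<exists>r. el (pr i r) D))) \<longleftrightarrow> k < D \<and> 0 < k \<and>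
        (\<forall>p. p < D \<longrightarrow> el p D \<longrightarrow> (\<exists>i. i < D \<and> (\<exists>r. r < D \<and> p = pr i r \<and> 0 < i \<and> i \<le> k \<and> 0 < r))) \<and>
        (\<forall>i. i < D \<longrightarrow> 0 < i \<and> i \<le> k \<longrightarrow> (\<exists>r. r < D \<and> el (pr i r) D))" (is "?L \<longleftrightarrow> ?R") for k
    proof
      assume L: ?L
      then have "k < D" using el_pr_less(1) by blast
      moreover have "\<exists>i. i < D \<and> (\<exists>r. r < D \<and> p = pr i r \<and> 0 < i \<and> i \<le> k \<and> 0 < r)" if "el p D" for p
        using L that el_pr_less by blast
      moreover have "\<exists>r. r < D \<and> el (pr i r) D" if "0 < i" "i \<le> k" for i
        using L that el_pr_less(2) by blast
      ultimately show ?R using L by blast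
    next
      assume R: ?R
      have "\<exists>i r. p = pr i r \<and> 0 < i \<and> i \<le> k \<and> 0 < r" if "el p D" for p
        using R that el_less by blast
      moreover have "\<exists>r. el (pr i r) D" if "0 < i" "i \<le> k" for i
        using R that le_less_trans by blast
      ultimately show ?L using R by blast
    qed
    show ?thesis unfolding Mdiagram_def U A K ..
  qed
  moreover have "dec (\<lambda>e. fcode (e 0) \<and>
     (\<exists>k. k < e 0 \<and> 0 < k \<and>
        (\<forall>p. p < e 0 \<longrightarrow> el p (e 0) \<longrightarrow> (\<exists>i. i < e 0 \<and> (\<exists>r. r < e 0 \<and> p = pr i r \<and> 0 < i \<and> i \<le> k \<and> 0 < r))) \<and>
        (\<forall>i. i < e 0 \<longrightarrow> 0 < i \<and> i \<le> k \<longrightarrow> (\<exists>r. r < e 0 \<and> el (pr i r) (e 0)))) \<and>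
     (\<forall>i. i < e 0 \<longrightarrow> (\<forall>r. r < e 0 \<longrightarrow> (\<forall>s. s < e 0 \<longrightarrow> el (pr i r) (e 0) \<and> el (pr i s) (e 0) \<longrightarrow> r = s))) \<and>
     (\<forall>i. i < e 0 \<longrightarrow> (\<forall>j. j < e 0 \<longrightarrow> (\<forall>r. r < e 0 \<longrightarrow> (\<forall>s. s < e 0 \<longrightarrow>
        i < j \<and> el (pr i r) (e 0) \<and> el (pr j s) (e 0) \<longrightarrow> s \<le> r)))))"
    by (intro dec_intros dec_el dec_fcode fn_pr)
  ultimately show "dec (\<lambda>e. Mdiagram (e 0))" by simp
qed

subsection \<open>Diagrams with prescribed rows\<close>

definition shape :: "(mnat \<Rightarrow> mnat) \<Rightarrow> mnat \<Rightarrow> bool" where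
  "shape g h \<longleftrightarrow> fn (\<lambda>e. g (e 0)) \<and> 0 < h \<and> g h = 0 \<and> 0 < g 1 \<and> (\<forall>i j. 0 < i \<longrightarrow> i \<le> j \<longrightarrow> g j \<le> g i)"

lemma shape_rw: "Mdiagram D \<Longrightarrow> rw D h = 0 \<Longrightarrow> 0 < h \<Longrightarrow> shape (rw D) h"
  unfolding shape_def using rw_1_pos rw_antimono by (auto intro: fn_rw fn_intros)

lemma shape_zero: "shape g h \<Longrightarrow> h \<le> i \<Longrightarrow> g i = 0"
  unfolding shape_def by (metis mnat_le_zero)

text \<open>The pairs of such a diagram lie below \<open>pr h a + 1\<close>, so
  \<open>finite_codes\<close> bounds the code by a number that depends on the rectangle only. This
  replaces the finiteness of the set of diagrams in a rectangle.\<close>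

lemma diagram_exists_bounded:
  "\<exists>B. \<forall>g. shape g h \<and> g 1 \<le> a \<longrightarrow> (\<exists>D. D < B \<and> Mdiagram D \<and> (\<forall>i. 0 < i \<longrightarrow> rw D i = g i))"
proof -
  obtain B where B: "\<forall>P. dec (\<lambda>e. P (e 0)) \<longrightarrow> (\<exists>x. x < B \<and> fcode x \<and> (\<forall>i. el i x \<longleftrightarrow> i < pr h a + 1 \<and> P i))"
    using finite_codes by blast
  have "\<exists>D. D < B \<and> Mdiagram D \<and> (\<forall>i. 0 < i \<longrightarrow> rw D i = g i)" if g: "shape g h" "g 1 \<le> a" for g
  proof -
    have fng: "fn f \<Longrightarrow> fn (\<lambda>e. g (f e))" for f using g(1) fn_app1 unfolding shape_def by blast
    have anti: "0 < i \<Longrightarrow> i \<le> j \<Longrightarrow> g j \<le> g i" for i j using g(1) unfolding shape_def by blast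
    have zero: "g i \<noteq> 0 \<Longrightarrow> i < h" for i using shape_zero[OF g(1)] not_less by blast
    define P where "P p \<longleftrightarrow> (\<exists>i. i < p + 1 \<and> 0 < i \<and> 0 < g i \<and> p = pr i (g i))" for p
    have P: "P p \<longleftrightarrow> (\<exists>i. 0 < i \<and> 0 < g i \<and> p = pr i (g i))" for p
      unfolding P_def mnat_less_Suc using pr_ge(1) by blast
    have "dec (\<lambda>e. P (e 0))" unfolding P_def by (intro dec_intros fn_pr fng)
    then obtain x where x: "x < B" "fcode x" "\<And>i. el i x \<longleftrightarrow> i < pr h a + 1 \<and> P i" using B by blast
    have "p < pr h a + 1" if Pp: "P p" for p
    proof -
      obtain i where i: "0 < i" "0 < g i" "p = pr i (g i)" using Pp P by blast
      have "i \<le> h" using zero[of i] i(2) by (simp add: mnat_pos_iff)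
      moreover have "1 \<le> i" using i(1) mnat_Suc_le[of 0 i] by simp
      then have "g i \<le> a" using anti[of 1 i] g(2) by auto
      ultimately show ?thesis unfolding i(3) mnat_less_Suc by (rule pr_mono)
    qed
    then have el: "el p x \<longleftrightarrow> (\<exists>i. 0 < i \<and> 0 < g i \<and> p = pr i (g i))" for p using x(3) P by blast
    have el2: "el (pr i r) x \<longleftrightarrow> 0 < i \<and> 0 < r \<and> r = g i" for i r unfolding el pr_inject by blast
    \<comment> \<open>The last index with a positive value is the number of rows.\<close>
    have "\<exists>k. (0 < k \<and> 0 < g k) \<and> (\<forall>y. 0 < y \<and> 0 < g y \<longrightarrow> y \<le> k)"
    proof (rule greatest_exists)
      show "dec (\<lambda>e. 0 < e 0 \<and> 0 < g (e 0))" by (intro dec_intros fng)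
      show "0 < (1::mnat) \<and> 0 < g 1" using g(1) unfolding shape_def by simp
      show "0 < y \<and> 0 < g y \<Longrightarrow> y \<le> h" for y using zero[of y] by (simp add: mnat_pos_iff)
    qed
    then obtain k where k: "0 < k" "0 < g k" "\<And>y. 0 < y \<Longrightarrow> 0 < g y \<Longrightarrow> y \<le> k" by blast
    have "Mdiagram x"
      unfolding Mdiagram_def
    proof (intro conjI exI[of _ k])
      show "\<forall>p. el p x \<longrightarrow> (\<exists>i r. p = pr i r \<and> 0 < i \<and> i \<le> k \<and> 0 < r)" using el k(3) by blast
      show "\<forall>i. 0 < i \<and> i \<le> k \<longrightarrow> (\<exists>r. el (pr i r) x)" unfolding el2 using anti k(2) less_le_trans by blast
      show "\<forall>i r s. el (pr i r) x \<and> el (pr i s) x \<longrightarrow> r = s" unfolding el2 by blast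
      show "\<forall>i j r s. i < j \<and> el (pr i r) x \<and> el (pr j s) x \<longrightarrow> s \<le> r" unfolding el2 using anti by auto
    qed (use x k in auto)
    moreover have "rw x i = g i" if "0 < i" for i
      using rw_cases[of i x] that unfolding el2 by (auto simp: mnat_pos_iff)
    ultimately show ?thesis using x(1) by blast
  qed
  then show ?thesis by blast
qed

text \<open>From \<open>D + h\<close> on both row functions vanish, so the bound makes the search
  condition decidable without weakening it (\<open>mkd_aux\<close>).\<close>

definition mkd :: "(mnat \<Rightarrow> mnat) \<Rightarrow> mnat \<Rightarrow> mnat" where
  "mkd g h = (LEAST D. Mdiagram D \<and> (\<forall>i. i < D + h \<longrightarrow> 0 < i \<longrightarrow> rw D i = g i))"

lemma mkd_aux:
  assumes "shape g h"
  shows "(\<forall>i. i < D + h \<longrightarrow> 0 < i \<longrightarrow> rw D i = g i) \<longleftrightarrow> (\<forall>i. 0 < i \<longrightarrow> rw D i = g i)"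
proof -
  have "i < D + h" if "rw D i \<noteq> g i" for i
  proof (rule ccontr)
    assume "\<not> i < D + h"
    then have "D + h \<le> i" by simp
    then have "D \<le> i" "h \<le> i" unfolding emb using emb_nonneg[of D] emb_nonneg[of h] by linarith+
    then show False using that rw_zero shape_zero[OF assms] by simp
  qed
  then show ?thesis by blast
qed

lemma mkd_exists: "shape g h \<Longrightarrow> \<exists>D. Mdiagram D \<and> (\<forall>i. i < D + h \<longrightarrow> 0 < i \<longrightarrow> rw D i = g i)"
  using diagram_exists_bounded[of h "g 1"] mkd_aux by blast

lemma mkd:
  assumes "shape g h"
  shows "Mdiagram (mkd g h)" "0 < i \<Longrightarrow> rw (mkd g h) i = g i"
proof -
  let ?P = "\<lambda>D. Mdiagram D \<and> (\<forall>i. i < D + h \<longrightarrow> 0 < i \<longrightarrow> rw D i = g i)"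
  have fng: "fn f \<Longrightarrow> fn (\<lambda>e. g (f e))" for f using assms fn_app1 unfolding shape_def by blast
  have "dec (\<lambda>e. ?P (e 0))" by (intro dec_intros dec_Mdiagram fn_rw fng)
  then have "?P (mkd g h)" unfolding mkd_def using mkd_exists[OF assms] Least_dec(1)[of ?P] by blast
  then show "Mdiagram (mkd g h)" "0 < i \<Longrightarrow> rw (mkd g h) i = g i" using mkd_aux[OF assms] by blast+
qed

text \<open>Uniformity in the parameter \<open>c\<close> turns a family of shapes into a definable
  sequence of diagrams.\<close>

lemma fn_mkd:
  assumes "fn (\<lambda>e. g (e 0) (e (Suc 0)))" "fn (\<lambda>e. h (e 0))" "\<And>c. shape (g c) (h c)"
  shows "fn (\<lambda>e. mkd (g (e 0)) (h (e 0)))"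
  unfolding mkd_def
proof (rule fn_Least)
  show "\<exists>D. Mdiagram D \<and> (\<forall>i. i < D + h (e 0) \<longrightarrow> 0 < i \<longrightarrow> rw D i = g (e 0) i)" for e :: "nat \<Rightarrow> mnat"
    by (rule mkd_exists[OF assms(3)])
  show "dec (\<lambda>e. Mdiagram (e 0) \<and> (\<forall>i. i < e 0 + h (e (Suc 0)) \<longrightarrow> 0 < i \<longrightarrow> rw (e 0) i = g (e (Suc 0)) i))"
    by (intro dec_intros dec_Mdiagram fn_rw fn_app2[OF assms(1)] fn_app1[OF assms(2)])
qed

subsection \<open>Comparing diagrams\<close>

definition dl :: "mnat \<Rightarrow> mnat \<Rightarrow> bool" where
  "dl D E \<longleftrightarrow> (\<forall>i. 0 < i \<longrightarrow> rw D i \<le> rw E i)"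

text \<open>\<open>ler D E\<close> and \<open>lec D E\<close> express that \<open>(D)\<^sub>r\<close> and \<open>(D)\<^sub>c\<close>, respectively, are below \<open>E\<close>.\<close>

definition ler :: "mnat \<Rightarrow> mnat \<Rightarrow> bool" where
  "ler D E \<longleftrightarrow> (\<forall>i. 1 < i \<longrightarrow> rw D i \<le> rw E i)"

definition lec :: "mnat \<Rightarrow> mnat \<Rightarrow> bool" where
  "lec D E \<longleftrightarrow> (\<forall>i. 0 < i \<longrightarrow> 1 < rw D i \<longrightarrow> rw D i \<le> rw E i)"

lemma Mdle_iff: "Mdiagram D \<Longrightarrow> Mdiagram E \<Longrightarrow> Mdle D E \<longleftrightarrow> dl D E"
  unfolding Mdle_def dl_def by (simp add: Mrow_rw)

text \<open>Rows whose index reaches the code are empty, so comparisons of diagrams are bounded and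
  thereby decidable.\<close>

lemma rw_ball: "(\<forall>i. Q i \<longrightarrow> rw D i \<le> F i) \<longleftrightarrow> (\<forall>i. i < D \<longrightarrow> Q i \<longrightarrow> rw D i \<le> F i)"
  using rw_zero[of D] by (metis mnat_zero_le not_less)

lemma dec_dl: "fn f \<Longrightarrow> fn g \<Longrightarrow> dec (\<lambda>e. dl (f e) (g e))"
  by (rule dec_app2[of dl]) (unfold dl_def rw_ball, intro dec_intros fn_rw)

lemma dec_ler: "fn f \<Longrightarrow> fn g \<Longrightarrow> dec (\<lambda>e. ler (f e) (g e))"
  by (rule dec_app2[of ler]) (unfold ler_def rw_ball, intro dec_intros fn_rw)

lemma lec_iff: "lec D E \<longleftrightarrow> (\<forall>i. i < D \<longrightarrow> 0 < i \<and> 1 < rw D i \<longrightarrow> rw D i \<le> rw E i)"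
  unfolding lec_def rw_ball[symmetric] by blast

lemma dec_lec: "fn f \<Longrightarrow> fn g \<Longrightarrow> dec (\<lambda>e. lec (f e) (g e))"
  by (rule dec_app2[of lec]) (unfold lec_iff, intro dec_intros fn_rw)

lemma dl_trans: "dl D E \<Longrightarrow> dl E F \<Longrightarrow> dl D F" unfolding dl_def by (blast intro: order.trans)
lemma dl_refl: "dl D D" unfolding dl_def by blast
lemma ler_trans: "ler D E \<Longrightarrow> ler E F \<Longrightarrow> ler D F" unfolding ler_def by (blast intro: order.trans)
lemma lec_trans: "lec D E \<Longrightarrow> lec E F \<Longrightarrow> lec D F" unfolding lec_def by (blast intro: order.trans less_le_trans)
lemma mnat_one_less: "1 < i \<Longrightarrow> 0 < (i::mnat)" by (rule less_trans[OF zero_less_one])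
lemma dl_ler: "dl D E \<Longrightarrow> ler D E" unfolding dl_def ler_def using mnat_one_less by blast
lemma dl_lec: "dl D E \<Longrightarrow> lec D E" unfolding dl_def lec_def by blast

section \<open>The closure operator in terms of rows\<close>

subsection \<open>The closure operator\<close>

lemma Mcol_iff: "Mdiagram D \<Longrightarrow> Mcol D j c \<longleftrightarrow> (\<forall>i. 0 < i \<longrightarrow> (i \<le> c \<longleftrightarrow> j \<le> rw D i))"
  unfolding Mcol_def by (simp add: Mrow_rw)

text \<open>The length of a column is the greatest index of a row that meets it, or 0 if there is
  none.\<close>

lemma Mcol_exists: assumes D: "Mdiagram D" and j: "0 < j" shows "\<exists>c. Mcol D j c"
proof (cases "\<exists>i. 0 < i \<and> j \<le> rw D i")
  case True
  then obtain i where i: "0 < i \<and> j \<le> rw D i" by blast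
  have "\<exists>c. (0 < c \<and> j \<le> rw D c) \<and> (\<forall>y. 0 < y \<and> j \<le> rw D y \<longrightarrow> y \<le> c)"
  proof (rule greatest_exists)
    show "dec (\<lambda>e. 0 < e 0 \<and> j \<le> rw D (e 0))" by (intro dec_intros fn_rw)
    show "0 < y \<and> j \<le> rw D y \<Longrightarrow> y \<le> D" for y using rw_zero[of D y] j by (metis linear mnat_le_zero less_irrefl)
  qed (rule i)
  then obtain c where c: "0 < c" "j \<le> rw D c" "\<And>y. 0 < y \<Longrightarrow> j \<le> rw D y \<Longrightarrow> y \<le> c" by blast
  have "j \<le> rw D i" if "0 < i" "i \<le> c" for i using rw_antimono[OF D that] c(2) by simp
  then show ?thesis unfolding Mcol_iff[OF D] using c(3) by blast
next
  case False
  then show ?thesis unfolding Mcol_iff[OF D] by (intro exI[of _ 0]) (auto simp: mnat_pos_iff)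
qed

lemma mnat_max: "Mis_max r s t \<longleftrightarrow> t = max r s"
  unfolding Mis_max_def by (auto simp: max_def)

lemma fn_max: "fn f \<Longrightarrow> fn g \<Longrightarrow> fn (\<lambda>e. max (f e) (g e))"
  unfolding max_def by (intro fn_if dec_intros)

lemma mnat_pos_one: "0 < (i::mnat) \<longleftrightarrow> 1 \<le> i"
  using mnat_Suc_le[of 0 i] by simp

lemma Mdrow_exists:
  assumes D: "Mdiagram D"
  obtains G where "Mdrow D G" "rw G 1 = max (rw D (1 + 1)) 1" "\<And>i. 1 < i \<Longrightarrow> rw G i = rw D i"
proof -
  define g where "g i = (if i = 1 then max (rw D (1 + 1)) 1 else rw D i)" for i
  have "shape g (D + 1 + 1)"
    unfolding shape_def
  proof (intro conjI allI impI)
    show "fn (\<lambda>e. g (e 0))" unfolding g_def by (intro fn_if fn_max fn_rw dec_intros)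
    show "0 < D + 1 + 1" by (rule mnat_zero_less_Suc)
    \<comment> \<open>The height has to differ from 1, where the row is never empty, and to lie
      beyond the rows of \<open>D\<close>.\<close>
    have "D + 1 + 1 \<noteq> 1" "D \<le> D + 1 + 1" unfolding emb using emb_nonneg[of D] by linarith+
    then show "g (D + 1 + 1) = 0" using rw_zero unfolding g_def by simp
    show "0 < g 1" unfolding g_def by (simp add: less_max_iff_disj)
    fix i j :: mnat assume i: "0 < i" "i \<le> j"
    show "g j \<le> g i"
    proof (cases "i = 1 \<and> j \<noteq> 1")
      case True
      then have "1 + 1 \<le> j" unfolding mnat_Suc_le using i by auto
      moreover have "0 < (1::mnat) + 1" by (rule mnat_zero_less_Suc)
      ultimately have "rw D j \<le> rw D (1 + 1)" using rw_antimono[OF D] by blast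
      then show ?thesis using True unfolding g_def by (simp add: le_max_iff_disj)
    next
      case False
      then have "j = 1 \<longrightarrow> i = 1" using i mnat_pos_one[of i] by auto
      then show ?thesis using False rw_antimono[OF D i] unfolding g_def by auto
    qed
  qed
  note G = mkd[OF this]
  let ?G = "mkd g (D + 1 + 1)"
  have 1: "rw ?G 1 = max (rw D (1 + 1)) 1" "\<And>i. 1 < i \<Longrightarrow> rw ?G i = rw D i"
    using G(2) mnat_one_less unfolding g_def by auto
  moreover have "Mdrow D ?G"
    unfolding Mdrow_def mnat_max using 1 G(1) by (simp add: Mrow_rw D)
  ultimately show ?thesis using that by blast
qed

text \<open>Cutting column 1 to the length of column 2 removes exactly the rows of length 1, except
  that one box is kept if nothing else remains. Hence \<open>(D)_c\<close> can be described by
  rows.\<close>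

lemma Mdcol_exists:
  assumes D: "Mdiagram D"
  obtains G where "Mdcol D G" "\<And>i. 0 < i \<Longrightarrow> rw G i = (if 1 < rw D i then rw D i else if i = 1 then 1 else 0)"
proof -
  define g where "g i = (if 1 < rw D i then rw D i else if i = 1 then 1 else 0)" for i
  have "shape g (D + 1 + 1)"
    unfolding shape_def
  proof (intro conjI allI impI)
    show "fn (\<lambda>e. g (e 0))" unfolding g_def by (intro fn_if fn_rw dec_intros)
    show "0 < D + 1 + 1" by (rule mnat_zero_less_Suc)
    have "D + 1 + 1 \<noteq> 1" "D \<le> D + 1 + 1" unfolding emb using emb_nonneg[of D] by linarith+
    then show "g (D + 1 + 1) = 0" using rw_zero unfolding g_def by simp
    show "0 < g 1" unfolding g_def using mnat_one_less[of "rw D 1"] by simp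
    fix i j :: mnat assume i: "0 < i" "i \<le> j"
    then have "j = 1 \<longrightarrow> i = 1" using mnat_pos_one[of i] by auto
    then show "g j \<le> g i" using rw_antimono[OF D i] unfolding g_def by auto
  qed
  note G = mkd[OF this]
  let ?G = "mkd g (D + 1 + 1)"
  have 1: "\<And>i. 0 < i \<Longrightarrow> rw ?G i = (if 1 < rw D i then rw D i else if i = 1 then 1 else 0)"
    using G(2) unfolding g_def by blast
  have "Mdcol D ?G"
    unfolding Mdcol_def
  proof (intro conjI allI impI)
    show "Mdiagram ?G" by (rule G(1))
    fix j c :: mnat assume j: "1 < j"
    have "j \<le> rw ?G i \<longleftrightarrow> j \<le> rw D i" if "0 < i" for i
      unfolding 1[OF that] using j by auto
    then show "Mcol ?G j c \<longleftrightarrow> Mcol D j c" unfolding Mcol_iff[OF D] Mcol_iff[OF G(1)] by simp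
  next
    fix c t assume "Mcol D (1 + 1) c \<and> Mcol ?G 1 t"
    then have c: "\<And>i. 0 < i \<Longrightarrow> i \<le> c \<longleftrightarrow> 1 + 1 \<le> rw D i" and t: "\<And>i. 0 < i \<Longrightarrow> i \<le> t \<longleftrightarrow> 1 \<le> rw ?G i"
      unfolding Mcol_iff[OF D] Mcol_iff[OF G(1)] by auto
    have "1 \<le> rw ?G i \<longleftrightarrow> 1 + 1 \<le> rw D i \<or> i = 1" if "0 < i" for i
      unfolding 1[OF that] mnat_Suc_le[of 1] by auto
    then have *: "i \<le> t \<longleftrightarrow> i \<le> c \<or> i = 1" if "0 < i" for i using c t that by blast
    have t1: "1 \<le> t" using *[of 1] by simp
    then have t2: "t \<le> c \<or> t = 1" using *[of t] by (simp add: mnat_pos_one)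
    have "c \<le> t" using *[of c] by (cases "c = 0") (auto simp: mnat_pos_iff)
    then show "Mis_max c 1 t" unfolding mnat_max using t1 t2 by (auto simp: max_def)
  qed
  then show ?thesis using that 1 by blast
qed

lemma Mdunion_exists:
  assumes D: "Mdiagram D" and E: "Mdiagram E"
  obtains F where "Mdunion D E F" "\<And>i. 0 < i \<Longrightarrow> rw F i = max (rw D i) (rw E i)"
proof -
  define g where "g i = max (rw D i) (rw E i)" for i
  have "shape g (D + E + 1)"
    unfolding shape_def
  proof (intro conjI allI impI)
    show "fn (\<lambda>e. g (e 0))" unfolding g_def by (intro fn_max fn_rw dec_intros)
    show "0 < D + E + 1" by (rule mnat_zero_less_Suc)
    have "D \<le> D + E + 1" "E \<le> D + E + 1" unfolding emb using emb_nonneg[of D] emb_nonneg[of E] by linarith+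
    then show "g (D + E + 1) = 0" using rw_zero unfolding g_def by simp
    show "0 < g 1" unfolding g_def using rw_1_pos[OF D] by (simp add: less_max_iff_disj)
    fix i j :: mnat assume i: "0 < i" "i \<le> j"
    show "g j \<le> g i" using rw_antimono[OF D i] rw_antimono[OF E i] unfolding g_def by (simp add: max.coboundedI1 max.coboundedI2)
  qed
  note G = mkd[OF this]
  let ?G = "mkd g (D + E + 1)"
  have 1: "\<And>i. 0 < i \<Longrightarrow> rw ?G i = max (rw D i) (rw E i)" using G(2) unfolding g_def by blast
  moreover have "Mdunion D E ?G"
    unfolding Mdunion_def mnat_max using 1 G(1) by (simp add: Mrow_rw D E)
  ultimately show ?thesis using that by blast
qed

text \<open>To be above a union is to be above both parts. The new first row of \<open>(D)_r\<close>
  costs nothing, since \<open>E\<close> is nonempty with decreasing rows, and neither does the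
  single box that \<open>(D')_c\<close> may keep. What remains is \<open>ler\<close> and
  \<open>lec\<close>.\<close>

lemma Mcl_iff:
  assumes X: "\<And>D. D \<in> X \<Longrightarrow> Mdiagram D"
  shows "Mcl X E \<longleftrightarrow> Mdiagram E \<and> (\<exists>D\<in>X. \<exists>D'\<in>X. ler D E \<and> lec D' E)"
proof
  assume "Mcl X E"
  then obtain F D D' G H where E: "Mdiagram E" and FE: "Mdle F E" and D: "D \<in> X" "D' \<in> X"
    and G: "Mdrow D G" and H: "Mdcol D' H" and F: "Mdunion G H F"
    unfolding Mcl_def Mucl_def by blast
  have d: "Mdiagram D" "Mdiagram D'" "Mdiagram G" "Mdiagram H" "Mdiagram F"
    using X D G H F unfolding Mdrow_def Mdcol_def Mdunion_def by blast+
  have FE: "rw F i \<le> rw E i" if "0 < i" for i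
    using FE that d(5) E by (simp add: Mdle_iff dl_def)
  have "\<forall>i r s t. 0 < i \<and> Mrow G i r \<and> Mrow H i s \<and> Mrow F i t \<longrightarrow> Mis_max r s t"
    using F unfolding Mdunion_def by blast
  then have Fmax: "rw F i = max (rw G i) (rw H i)" if "0 < i" for i
    using that unfolding mnat_max by (simp add: Mrow_rw d)
  have "ler D E"
    unfolding ler_def
  proof (intro allI impI)
    fix i :: mnat assume i: "1 < i"
    have "\<forall>i r. 1 < i \<longrightarrow> (Mrow G i r \<longleftrightarrow> Mrow D i r)" using G unfolding Mdrow_def by blast
    then have "Mrow G i (rw G i) \<longleftrightarrow> Mrow D i (rw G i)" using i by blast
    then have "rw G i = rw D i" by (simp add: Mrow_rw d)
    then show "rw D i \<le> rw E i" using Fmax[of i] FE[of i] mnat_one_less[OF i] by simp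
  qed
  moreover have "lec D' E"
    unfolding lec_def
  proof (intro allI impI)
    fix i assume i: "0 < i" "1 < rw D' i"
    \<comment> \<open>Column number \<open>rw D' i\<close> is not the first one, so
      \<open>D'\<close> and \<open>H\<close> share it; as row \<open>i\<close> of \<open>D'\<close>
      meets this column, row \<open>i\<close> of \<open>H\<close> does too.\<close>
    obtain c where c: "Mcol D' (rw D' i) c" using Mcol_exists[OF d(2)] mnat_one_less[OF i(2)] by blast
    have "\<forall>j c. 1 < j \<longrightarrow> (Mcol H j c \<longleftrightarrow> Mcol D' j c)" using H unfolding Mdcol_def by blast
    then have "Mcol H (rw D' i) c" using c i(2) by blast
    then have "rw D' i \<le> rw H i" using c i(1) unfolding Mcol_iff[OF d(2)] Mcol_iff[OF d(4)] by blast
    then show "rw D' i \<le> rw E i" using Fmax[OF i(1)] FE[OF i(1)] by (auto intro: order.trans)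
  qed
  ultimately show "Mdiagram E \<and> (\<exists>D\<in>X. \<exists>D'\<in>X. ler D E \<and> lec D' E)" using E D by blast
next
  assume "Mdiagram E \<and> (\<exists>D\<in>X. \<exists>D'\<in>X. ler D E \<and> lec D' E)"
  then obtain D D' where E: "Mdiagram E" and D: "D \<in> X" "D' \<in> X" and le: "ler D E" "lec D' E" by blast
  obtain G where G: "Mdrow D G" "rw G 1 = max (rw D (1 + 1)) 1" "\<And>i. 1 < i \<Longrightarrow> rw G i = rw D i"
    using Mdrow_exists[OF X[OF D(1)]] by blast
  obtain H where H: "Mdcol D' H"
    "\<And>i. 0 < i \<Longrightarrow> rw H i = (if 1 < rw D' i then rw D' i else if i = 1 then 1 else 0)"
    using Mdcol_exists[OF X[OF D(2)]] by blast
  have GH: "Mdiagram G" "Mdiagram H" using G(1) H(1) unfolding Mdrow_def Mdcol_def by blast+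
  obtain F where F: "Mdunion G H F" "\<And>i. 0 < i \<Longrightarrow> rw F i = max (rw G i) (rw H i)"
    using Mdunion_exists[OF GH] by blast
  have E1: "1 \<le> rw E 1" using rw_1_pos[OF E] mnat_pos_one by blast
  have "rw G i \<le> rw E i" if "0 < i" for i
  proof (cases "i = 1")
    case True
    have "1 < (1::mnat) + 1" by (simp add: mnat_less_Suc)
    then have "rw D (1 + 1) \<le> rw E (1 + 1)" using le(1) unfolding ler_def by blast
    also have "\<dots> \<le> rw E 1" by (rule rw_antimono[OF E]) simp_all
    finally show ?thesis using True G(2) E1 by simp
  next
    case False
    then have "1 < i" using that mnat_pos_one[of i] by simp
    then show ?thesis using G(3) le(1) unfolding ler_def by simp
  qed
  moreover have "rw H i \<le> rw E i" if "0 < i" for i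
    using H(2)[OF that] le(2) that E1 unfolding lec_def by auto
  ultimately have "dl F E" unfolding dl_def using F(2) by simp
  moreover have "Mdiagram F" using F(1) unfolding Mdunion_def by blast
  ultimately have "Mdle F E" using Mdle_iff E by blast
  then show "Mcl X E" unfolding Mcl_def Mucl_def using E D G(1) H(1) F(1) by blast
qed

section \<open>Closed classes and their generation from above\<close>

subsection \<open>Closed classes\<close>

lemma Mclosed_iff:
  "Mclosed_class U \<longleftrightarrow> (\<forall>D. U D \<longrightarrow> Mdiagram D) \<and>
     (\<forall>D. Mdiagram D \<longrightarrow> (U D \<longleftrightarrow> (\<forall>E. Mdiagram E \<and> dl D E \<and> D \<noteq> E \<longrightarrow> U E)))"
  unfolding Mclosed_class_def Mclass_le_def Mdless_def using Mdle_iff by (simp cong: conj_cong)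

lemma closed_diagram: "Mclosed_class U \<Longrightarrow> U D \<Longrightarrow> Mdiagram D"
  unfolding Mclosed_iff by blast

lemma closed_up: "Mclosed_class U \<Longrightarrow> U D \<Longrightarrow> Mdiagram E \<Longrightarrow> dl D E \<Longrightarrow> U E"
  unfolding Mclosed_iff by blast

lemma closed_below:
  "Mclosed_class U \<Longrightarrow> Mdiagram D \<Longrightarrow> (\<And>E. Mdiagram E \<Longrightarrow> dl D E \<Longrightarrow> D \<noteq> E \<Longrightarrow> U E) \<Longrightarrow> U D"
  unfolding Mclosed_iff by blast

text \<open>The boxes of \<open>F\<close>, coded as pairs and with bounded quantifiers, so that
  \<open>lcode\<close> applies to this decidable set.\<close>

definition box :: "mnat \<Rightarrow> mnat \<Rightarrow> bool" where
  "box F p \<longleftrightarrow> (\<exists>i. i < p + 1 \<and> (\<exists>j. j < p + 1 \<and> p = pr i j \<and> 0 < i \<and> 0 < j \<and> j \<le> rw F i))"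

lemma box_pr: "box F (pr i j) \<longleftrightarrow> 0 < i \<and> 0 < j \<and> j \<le> rw F i"
  unfolding box_def mnat_less_Suc using pr_ge by auto

lemma box_cases: "box F p \<Longrightarrow> \<exists>i j. p = pr i j \<and> 0 < i \<and> 0 < j \<and> j \<le> rw F i"
  unfolding box_def by blast

lemma dec_box: "fn f \<Longrightarrow> fn g \<Longrightarrow> dec (\<lambda>e. box (f e) (g e))"
  by (rule dec_app2[of box]) (unfold box_def, intro dec_intros fn_pr fn_rw)

text \<open>All diagrams outside \<open>U\<close> and above \<open>E\<close> lie in the rectangle of the first row of \<open>D\<close> and the
  first column of \<open>D'\<close>, hence have bounded codes. They are exhausted by downward induction on a
  strictly monotone measure, the least common multiple of the moduli of the boxes.\<close>

lemma closed_generates: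
  assumes U: "Mclosed_class U" and sigU: "sig (\<lambda>e. U (e 0))"
    and D: "U D" and D': "U D'" and E: "Mdiagram E" and le: "ler D E" "lec D' E"
  shows "U E"
proof -
  have dD: "Mdiagram D" "Mdiagram D'" using closed_diagram[OF U] D D' by blast+
  define a where "a = rw D 1"
  \<comment> \<open>The code of \<open>D'\<close> is a crude bound for its number of rows.\<close>
  define h where "h = D'"
  have h0: "0 < h"
    using rw_zero[of D' 1] rw_1_pos[OF dD(2)] unfolding h_def mnat_pos_iff by auto
  \<comment> \<open>A diagram above \<open>E\<close> and outside \<open>U\<close> lies above neither
    \<open>D\<close> nor \<open>D'\<close>. Since \<open>ler D F\<close> holds, \<open>D\<close> can
    fail only in row 1, which bounds that row of \<open>F\<close>; since \<open>lec D' F\<close>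
    holds, \<open>D'\<close> fails in a row of length 1, which must be empty in
    \<open>F\<close>.\<close>
  have out: "rw F 1 \<le> a \<and> rw F h = 0" if F: "Mdiagram F" "dl E F" "\<not> U F" for F
  proof
    have "\<not> dl D F" "\<not> dl D' F" using closed_up[OF U] D D' F by blast+
    then obtain i where i: "0 < i" "\<not> rw D i \<le> rw F i" unfolding dl_def by blast
    have "ler D F" using ler_trans[OF le(1) dl_ler[OF F(2)]] .
    then have "\<not> 1 < i" using i unfolding ler_def by blast
    then have "i = 1" using i(1) mnat_pos_one[of i] by simp
    then show "rw F 1 \<le> a" using i unfolding a_def by simp
    obtain i where i: "0 < i" "\<not> rw D' i \<le> rw F i" using \<open>\<not> dl D' F\<close> unfolding dl_def by blast
    have "lec D' F" using lec_trans[OF le(2) dl_lec[OF F(2)]] .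
    then have "\<not> 1 < rw D' i" using i unfolding lec_def by blast
    then have "rw F i < 1" using i(2) by (meson less_le_trans not_le not_less)
    then have F0: "rw F i = 0" by simp
    have "rw D' i \<noteq> 0" using i(2) by auto
    then have "i \<le> h" using rw_zero[of D' i] unfolding h_def by (meson linear)
    then show "rw F h = 0" using rw_antimono[OF F(1) i(1)] F0 by (metis mnat_le_zero)
  qed
  obtain B where B: "\<And>g. shape g h \<Longrightarrow> g 1 \<le> a \<Longrightarrow> \<exists>D. D < B \<and> Mdiagram D \<and> (\<forall>i. 0 < i \<longrightarrow> rw D i = g i)"
    using diagram_exists_bounded[of h a] by blast
  have outB: "F < B" if F: "Mdiagram F" "dl E F" "\<not> U F" for F
  proof -
    have "shape (rw F) h" "rw F 1 \<le> a" using shape_rw[OF F(1) _ h0] out[OF F] by blast+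
    then obtain F' where F': "F' < B" "Mdiagram F'" "\<forall>i. 0 < i \<longrightarrow> rw F' i = rw F i" using B by blast
    then have "F' = F" using diagram_eqI F(1) by blast
    then show ?thesis using F'(1) by simp
  qed
  \<comment> \<open>All boxes of the rectangle with \<open>h\<close> rows and \<open>a\<close>
    columns have pair codes below \<open>k\<close>.\<close>
  define k where "k = pr h a + 1"
  obtain m where m: "modulus k m" using modulus_exists by blast
  obtain N where N: "common k m N" using common_exists by blast
  define \<mu> where "\<mu> F = lcode k m (box F)" for F
  have db: "dec (\<lambda>e. box F (e 0))" for F by (intro dec_box fn_intros)
  have "fn (\<lambda>e. \<mu> (e 0))"
    unfolding \<mu>_def lcode_def
  proof (rule fn_Least)
    show "\<exists>n. 0 < n \<and> (\<forall>i. i < k \<longrightarrow> box (e 0) i \<longrightarrow> prm m i dvd n)" for e :: "nat \<Rightarrow> mnat"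
      using N unfolding common_def by blast
    show "dec (\<lambda>e. 0 < e 0 \<and> (\<forall>i. i < k \<longrightarrow> box (e (Suc 0)) i \<longrightarrow> prm m i dvd e 0))"
      by (intro dec_intros dec_box dec_dvd fn_prm)
  qed
  then have fn\<mu>: "fn f \<Longrightarrow> fn (\<lambda>e. \<mu> (f e))" for f by (rule fn_app1)
  have strict: "\<mu> F < \<mu> F'" if F: "Mdiagram F" and F': "Mdiagram F'" "\<not> U F'" "dl E F'" "dl F F'" "F \<noteq> F'" for F F'
  proof -
    obtain i where i: "0 < i" "rw F i \<noteq> rw F' i" using diagram_eqI[OF F F'(1)] F'(5) by blast
    then have lt: "rw F i < rw F' i" using F'(4) unfolding dl_def by (auto simp: le_less)
    have o: "rw F' 1 \<le> a" "rw F' h = 0" using out[OF F'(1,3,2)] by blast+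
    have "1 \<le> i" using i(1) mnat_pos_one by blast
    then have "rw F' i \<le> a" using rw_antimono[OF F'(1) zero_less_one, of i] o(1) by simp
    moreover have "i \<le> h"
    proof (rule ccontr)
      assume "\<not> i \<le> h"
      then have "rw F' i \<le> rw F' h" by (intro rw_antimono[OF F'(1) h0]) simp
      then show False using lt o(2) by simp
    qed
    ultimately have "pr i (rw F' i) < k" unfolding k_def mnat_less_Suc by (intro pr_mono)
    moreover have "box F' (pr i (rw F' i))" "\<not> box F (pr i (rw F' i))"
      using i(1) lt unfolding box_pr by (auto simp: mnat_pos_iff)
    moreover have "box F p \<Longrightarrow> box F' p" for p
    proof -
      assume "box F p"
      then obtain i j where p: "p = pr i j" "0 < i" "0 < j" "j \<le> rw F i" using box_cases by blast
      then have "j \<le> rw F' i" using F'(4) order.trans unfolding dl_def by blast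
      then show ?thesis using p box_pr by blast
    qed
    ultimately show ?thesis unfolding \<mu>_def by (intro lcode_strict_mono[OF m N db db]) auto
  qed
  \<comment> \<open>\<open>N\<close> bounds all measures, so the statement is vacuous for
    \<open>w = 0\<close>, and each step of \<open>w\<close> admits one smaller value of the measure.
    At \<open>w + 1\<close>, a diagram strictly above \<open>F\<close> and outside \<open>U\<close>
    would have a larger measure and so be covered already. The negated part is decidable, hence the
    statement is Sigma01 although \<open>U\<close> itself need not be decidable.\<close>
  have "\<forall>F. F < B \<longrightarrow> \<not> (Mdiagram F \<and> dl E F \<and> N < \<mu> F + w) \<or> U F" for w
  proof (rule mnat_induct[of "\<lambda>w. \<forall>F. F < B \<longrightarrow> \<not> (Mdiagram F \<and> dl E F \<and> N < \<mu> F + w) \<or> U F"])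
    show "sig (\<lambda>e. \<forall>F. F < B \<longrightarrow> \<not> (Mdiagram F \<and> dl E F \<and> N < \<mu> F + e 0) \<or> U F)"
    proof (intro sig_ball fn_const sig_disj)
      show "sig (\<lambda>e. \<not> (Mdiagram (e 0) \<and> dl E (e 0) \<and> N < \<mu> (e 0) + e (Suc 0)))"
        by (intro dec_sig dec_intros dec_Mdiagram dec_dl fn\<mu>)
      show "sig (\<lambda>e. U (e 0))" by (rule sigU)
    qed
    show "\<forall>F. F < B \<longrightarrow> \<not> (Mdiagram F \<and> dl E F \<and> N < \<mu> F + 0) \<or> U F"
      using lcode(1)[OF m N db] unfolding \<mu>_def by (simp add: not_less)
    fix w assume IH: "\<forall>F. F < B \<longrightarrow> \<not> (Mdiagram F \<and> dl E F \<and> N < \<mu> F + w) \<or> U F"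
    have "U F" if F: "Mdiagram F" "dl E F" "N < \<mu> F + (w + 1)" for F
    proof (rule closed_below[OF U F(1)])
      fix F' assume F': "Mdiagram F'" "dl F F'" "F \<noteq> F'"
      show "U F'"
      proof (rule ccontr)
        assume n: "\<not> U F'"
        have "dl E F'" using dl_trans[OF F(2) F'(2)] .
        then have "\<mu> F < \<mu> F'" "F' < B" using strict[OF F(1) F'(1) n] F' outB[OF F'(1) _ n] by blast+
        moreover have "N < \<mu> F' + w"
          using \<open>\<mu> F < \<mu> F'\<close> F(3) unfolding emb by linarith
        ultimately show False using IH n F'(1) \<open>dl E F'\<close> by blast
      qed
    qed
    then show "\<forall>F. F < B \<longrightarrow> \<not> (Mdiagram F \<and> dl E F \<and> N < \<mu> F + (w + 1)) \<or> U F" by blast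
  qed
  from this[of "N + 1"] have *: "E < B \<Longrightarrow> N < \<mu> E + (N + 1) \<Longrightarrow> U E" using E dl_refl by blast
  have "N < \<mu> E + (N + 1)" unfolding emb using emb_nonneg[of "\<mu> E"] by linarith
  then show ?thesis using * outB[OF E dl_refl] by blast
qed

text \<open>Produces the strictly larger diagram on which closedness is tested in
  \<open>closed_ucl\<close>: one more box in row 1, the other rows unchanged.\<close>

lemma add_box_row:
  assumes E: "Mdiagram E"
  obtains F where "Mdiagram F" "dl E F" "E \<noteq> F" "ler F E"
proof -
  define g where "g i = (if i = 1 then rw E 1 + 1 else rw E i)" for i
  have sh: "shape g (E + 1 + 1)"
    unfolding shape_def
  proof (intro conjI allI impI)
    show "fn (\<lambda>e. g (e 0))" unfolding g_def by (intro fn_if fn_rw dec_intros)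
    show "0 < E + 1 + 1" by (rule mnat_zero_less_Suc)
    have "E + 1 + 1 \<noteq> 1" "E \<le> E + 1 + 1" unfolding emb using emb_nonneg[of E] by linarith+
    then show "g (E + 1 + 1) = 0" using rw_zero unfolding g_def by simp
    show "0 < g 1" unfolding g_def using mnat_zero_less_Suc by simp
    fix i j :: mnat assume i: "0 < i" "i \<le> j"
    then have "j = 1 \<longrightarrow> i = 1" using mnat_pos_one[of i] by auto
    moreover have "rw E j \<le> rw E i" using rw_antimono[OF E i] .
    moreover have "rw E i \<le> rw E i + 1" by simp
    ultimately show "g j \<le> g i" unfolding g_def by (auto intro: order.trans)
  qed
  let ?F = "mkd g (E + 1 + 1)"
  have F: "rw ?F i = (if i = 1 then rw E 1 + 1 else rw E i)" if "0 < i" for i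
    using mkd(2)[OF sh that] unfolding g_def .
  show ?thesis
  proof (rule that[OF mkd(1)[OF sh]])
    show "dl E ?F" unfolding dl_def using F by simp
    show "E \<noteq> ?F" using F[of 1] by auto
    show "ler ?F E" unfolding ler_def using F mnat_one_less by auto
  qed
qed

text \<open>If all diagrams strictly above \<open>E\<close> belong to the class, so does the one
  with an additional box in row 1. A member of \<open>S\<close> below it satisfies
  \<open>ler\<close> with respect to \<open>E\<close>, and so lies below \<open>E\<close> by
  assumption.\<close>

lemma closed_ucl:
  assumes s: "\<And>D E. S D \<Longrightarrow> Mdiagram E \<Longrightarrow> ler D E \<Longrightarrow> dl D E"
  shows "Mclosed_class (\<lambda>E. Mdiagram E \<and> (\<exists>D. S D \<and> dl D E))"
  unfolding Mclosed_iff
proof (intro conjI allI impI iffI)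
  fix E assume E: "Mdiagram E" and all: "\<forall>F. Mdiagram F \<and> dl E F \<and> E \<noteq> F \<longrightarrow> Mdiagram F \<and> (\<exists>D. S D \<and> dl D F)"
  obtain F where F: "Mdiagram F" "dl E F" "E \<noteq> F" "ler F E" using add_box_row[OF E] by blast
  then obtain D where D: "S D" "dl D F" using all by blast
  then have "ler D E" using ler_trans[OF dl_ler F(4)] by blast
  then show "\<exists>D. S D \<and> dl D E" using s D(1) E by blast
qed (use dl_trans in blast)+

section \<open>Sequences as definable functions\<close>

subsection \<open>Sequences of diagrams\<close>

text \<open>Re-indexed from 0, a sequence becomes a total function on the model: \<open>d i\<close>
  is term number \<open>i + 1\<close>.\<close>

lemma sequence_fn:
  assumes X: "X \<in> Sets" "Mdiagram_sequence X"
  obtains d where "fn (\<lambda>e. d (e 0))" "\<And>i. Mdiagram (d i)" "\<And>i D. pr (i + 1) D \<in> X \<longleftrightarrow> D = d i"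
proof -
  have "\<exists>D. pr (i + 1) D \<in> X" for i
    using X(2) mnat_zero_less_Suc unfolding Mdiagram_sequence_def by blast
  define d where "d i = (LEAST D. pr (i + 1) D \<in> X)" for i
  have "fn (\<lambda>e. d (e 0))"
    unfolding d_def by (rule fn_Least) (intro dec_intros X fn_pr, fact)
  moreover have "dec (\<lambda>e. pr (i + 1) (e 0) \<in> X)" for i by (intro dec_intros X fn_pr)
  then have d: "pr (i + 1) (d i) \<in> X" for i
    unfolding d_def using Least_dec(1)[of "\<lambda>D. pr (i + 1) D \<in> X"] \<open>\<And>i. \<exists>D. pr (i + 1) D \<in> X\<close> by blast
  have "Mdiagram (d i)" for i
    using X(2) d[of i] unfolding Mdiagram_sequence_def by (metis pr_inject)
  moreover have "pr (i + 1) D \<in> X \<longleftrightarrow> D = d i" for i D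
    using X(2) d[of i] unfolding Mdiagram_sequence_def by blast
  ultimately show ?thesis using that by blast
qed

lemma fn_sequence:
  assumes d: "fn (\<lambda>e. d (e 0))" "\<And>i. Mdiagram (d i)"
  obtains X where "X \<in> Sets" "Mdiagram_sequence X" "\<And>i D. pr (i + 1) D \<in> X \<longleftrightarrow> D = d i"
proof -
  have fnd: "fn f \<Longrightarrow> fn (\<lambda>e. d (f e))" for f using fn_app1 d(1) by blast
  define X where "X = {p. \<exists>i. i < p + 1 \<and> p = pr (i + 1) (d i)}"
  have X: "X \<in> Sets" unfolding X_def by (rule set_exists) (intro dec_intros fn_pr fnd)
  have "i \<le> pr (i + 1) D" for i D using pr_ge(1)[of "i + 1" D] by (metis less_imp_le less_le_trans mnat_less_Suc_self)
  then have X_iff: "p \<in> X \<longleftrightarrow> (\<exists>i. p = pr (i + 1) (d i))" for p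
    unfolding X_def mem_Collect_eq mnat_less_Suc by blast
  have "Mdiagram_sequence X"
    unfolding Mdiagram_sequence_def
  proof (intro conjI allI impI)
    fix p assume "p \<in> X"
    then obtain i where "p = pr (i + 1) (d i)" using X_iff by blast
    then show "\<exists>i D. p = pr i D \<and> 0 < i \<and> Mdiagram D" using d(2) mnat_zero_less_Suc by blast
  next
    fix i :: mnat assume "0 < i"
    then obtain j where "i = j + 1" using mnat_pos_Suc by blast
    then show "\<exists>D. pr i D \<in> X" using X_iff by blast
  qed (auto simp: X_iff)
  moreover have "pr (i + 1) D \<in> X \<longleftrightarrow> D = d i" for i D unfolding X_iff by auto
  ultimately show ?thesis using X that by blast
qed

lemma MWPO_iff:
  "MWPO \<longleftrightarrow> (\<forall>d. fn (\<lambda>e. d (e 0)) \<longrightarrow> (\<forall>i. Mdiagram (d i)) \<longrightarrow> (\<exists>i j. i < j \<and> dl (d i) (d j)))"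
proof
  assume W: MWPO
  show "\<forall>d. fn (\<lambda>e. d (e 0)) \<longrightarrow> (\<forall>i. Mdiagram (d i)) \<longrightarrow> (\<exists>i j. i < j \<and> dl (d i) (d j))"
  proof (intro allI impI)
    fix d assume d: "fn (\<lambda>e. d (e 0))" "\<forall>i. Mdiagram (d i)"
    obtain X where X: "X \<in> Sets" "Mdiagram_sequence X" "\<And>i D. pr (i + 1) D \<in> X \<longleftrightarrow> D = d i"
      using fn_sequence[of d] d by blast
    then obtain i j D E where ij: "0 < i" "i < j" "pr i D \<in> X" "pr j E \<in> X" "Mdle D E"
      using W unfolding MWPO_def by blast
    obtain i' where i': "i = i' + 1" using mnat_pos_Suc ij(1) by blast
    obtain j' where j': "j = j' + 1" using mnat_pos_Suc less_trans[OF ij(1,2)] by blast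
    have "D = d i'" "E = d j'" using X(3) ij(3,4) i' j' by auto
    then show "\<exists>i j. i < j \<and> dl (d i) (d j)" using ij(2,5) i' j' Mdle_iff d(2) by auto
  qed
next
  assume W: "\<forall>d. fn (\<lambda>e. d (e 0)) \<longrightarrow> (\<forall>i. Mdiagram (d i)) \<longrightarrow> (\<exists>i j. i < j \<and> dl (d i) (d j))"
  show MWPO
    unfolding MWPO_def
  proof (intro ballI impI)
    fix X assume X: "X \<in> Sets" "Mdiagram_sequence X"
    obtain d where d: "fn (\<lambda>e. d (e 0))" "\<And>i. Mdiagram (d i)" "\<And>i D. pr (i + 1) D \<in> X \<longleftrightarrow> D = d i"
      using sequence_fn[OF X] by blast
    then obtain i j where ij: "i < j" "dl (d i) (d j)" using W by blast
    have "0 < i + 1" "i + 1 < j + 1" "pr (i + 1) (d i) \<in> X" "pr (j + 1) (d j) \<in> X" "Mdle (d i) (d j)"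
      using ij d Mdle_iff mnat_zero_less_Suc by auto
    then show "\<exists>i j D E. 0 < i \<and> i < j \<and> pr i D \<in> X \<and> pr j E \<in> X \<and> Mdle D E" by blast
  qed
qed

lemma range_iff: "Mdiagram_sequence X \<Longrightarrow> (\<And>i D. pr (i + 1) D \<in> X \<longleftrightarrow> D = d i) \<Longrightarrow>
    Mrange_class X D \<longleftrightarrow> (\<exists>i. D = d i)"
  unfolding Mrange_class_def using mnat_pos_Suc mnat_zero_less_Suc by metis

section \<open>Repeating rows to make upward closures closed\<close>

subsection \<open>Adding long rows\<close>

text \<open>\<open>star c D\<close> repeats the first row and the first column, so that closing under the operator
  \<open>cl\<close> adds nothing to the upward closure, and its first row is longer than \<open>c\<close>, which makes the
  upward closure of a sequence \<open>star i (D\<^sub>i)\<close> decidable.\<close>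

definition star_row :: "mnat \<Rightarrow> mnat \<Rightarrow> mnat \<Rightarrow> mnat" where
  "star_row c D j = (if j \<le> 1 + 1 then c + rw D 1 + 1
     else if rw D (j - (1 + 1)) = 0 then 0 else rw D (j - (1 + 1)) + 1)"

text \<open>Two rows are put on top, and \<open>D\<close> has no row \<open>D + 1\<close>; this
  gives the height.\<close>

definition star :: "mnat \<Rightarrow> mnat \<Rightarrow> mnat" where
  "star c D = mkd (star_row c D) (D + 1 + (1 + 1))"

lemma star_row_low: "j \<le> 1 + 1 \<Longrightarrow> star_row c D j = c + rw D 1 + 1"
  unfolding star_row_def by simp

lemma star_row_high: "0 < j \<Longrightarrow> star_row c D (j + (1 + 1)) = (if rw D j = 0 then 0 else rw D j + 1)"
proof -
  assume "0 < j"
  then have "\<not> j + (1 + 1) \<le> 1 + 1" unfolding emb by linarith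
  then show ?thesis unfolding star_row_def by simp
qed

lemma mnat_shift2: "1 + 1 < j \<Longrightarrow> \<exists>i. j = i + (1 + 1) \<and> 0 < (i::mnat)"
proof -
  assume "1 + 1 < j"
  then obtain d where "j = 1 + 1 + d + 1" unfolding mnat_less_add_iff by blast
  then have "j = (d + 1) + (1 + 1)" by (simp add: ac_simps)
  then show ?thesis using mnat_zero_less_Suc by blast
qed

lemma star_shape: assumes D: "Mdiagram D" shows "shape (star_row c D) (D + 1 + (1 + 1))"
  unfolding shape_def
proof (intro conjI allI impI)
  show "fn (\<lambda>e. star_row c D (e 0))" unfolding star_row_def by (intro fn_if fn_rw dec_intros)
  show "0 < D + 1 + (1 + 1)" unfolding emb using emb_nonneg[of D] by linarith
  have "rw D (D + 1) = 0" by (rule rw_zero) simp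
  then show "star_row c D (D + 1 + (1 + 1)) = 0" using star_row_high[of "D + 1" c D] mnat_zero_less_Suc by simp
  show "0 < star_row c D 1" using star_row_low[of 1 c D] mnat_zero_less_Suc by simp
  fix i j :: mnat assume i: "0 < i" "i \<le> j"
  have le: "rw D (j - (1 + 1)) \<le> rw D 1" if j: "1 + 1 < j" for j
  proof -
    obtain k where k: "j = k + (1 + 1)" "0 < k" using mnat_shift2[OF j] by blast
    have "rw D k \<le> rw D 1" using rw_antimono[OF D zero_less_one] k(2) mnat_pos_one by blast
    then show ?thesis using k(1) by simp
  qed
  consider "j \<le> 1 + 1" | "i \<le> 1 + 1" "1 + 1 < j" | "1 + 1 < i" using not_le by blast
  then show "star_row c D j \<le> star_row c D i"
  proof cases
    case 1
    then show ?thesis using i star_row_low order.trans by auto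
  next
    case 2
    have "rw D (j - (1 + 1)) + 1 \<le> c + rw D 1 + 1"
      using le[OF 2(2)] unfolding emb using emb_nonneg[of c] by linarith
    then show ?thesis using 2 unfolding star_row_def by auto
  next
    case 3
    obtain k where k: "i = k + (1 + 1)" "0 < k" using mnat_shift2[OF 3] by blast
    have "1 + 1 < j" using 3 i(2) by (rule less_le_trans)
    then obtain l where l: "j = l + (1 + 1)" "0 < l" using mnat_shift2 by blast
    have "rw D l \<le> rw D k" using rw_antimono[OF D k(2)] i(2) k(1) l(1) by simp
    then show ?thesis unfolding k(1) l(1) star_row_high[OF k(2)] star_row_high[OF l(2)] by auto
  qed
qed

lemma star:
  assumes "Mdiagram D"
  shows "Mdiagram (star c D)" "0 < i \<Longrightarrow> rw (star c D) i = star_row c D i"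
  using mkd[OF star_shape[OF assms]] unfolding star_def by blast+

lemma star_above: "Mdiagram D \<Longrightarrow> c < rw (star c D) 1"
proof -
  assume D: "Mdiagram D"
  have "rw (star c D) 1 = c + rw D 1 + 1" using star(2)[OF D, of 1] star_row_low[of 1] by simp
  then show ?thesis unfolding mnat_less_add_iff by blast
qed

lemma fn_star:
  assumes "fn (\<lambda>e. d (e 0))" "\<And>i. Mdiagram (d i)"
  shows "fn (\<lambda>e. star (e 0) (d (e 0)))"
  unfolding star_def
proof (rule fn_mkd[of "\<lambda>c. star_row c (d c)" "\<lambda>c. d c + 1 + (1 + 1)"])
  have fnd: "fn f \<Longrightarrow> fn (\<lambda>e. d (f e))" for f using fn_app1 assms(1) by blast
  show "fn (\<lambda>e. star_row (e 0) (d (e 0)) (e (Suc 0)))"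
    unfolding star_row_def by (intro fn_if fn_rw dec_intros fnd)
  show "fn (\<lambda>e. d (e 0) + 1 + (1 + 1))" by (intro fn_intros fnd)
  show "shape (star_row c (d c)) (d c + 1 + (1 + 1))" for c by (rule star_shape[OF assms(2)])
qed

text \<open>The rows from 3 on determine \<open>D\<close>, and lengthening all nonempty rows by 1
  does not affect comparisons. So a bad sequence stays bad whatever first rows are put on
  top.\<close>

lemma star_dl:
  assumes D: "Mdiagram D" and E: "Mdiagram E" and le: "dl (star c D) (star c' E)"
  shows "dl D E"
  unfolding dl_def
proof (intro allI impI)
  fix i :: mnat assume i: "0 < i"
  have "0 < i + (1 + 1)" unfolding emb using i emb_nonneg[of i] by linarith
  then have "star_row c D (i + (1 + 1)) \<le> star_row c' E (i + (1 + 1))"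
    using le star(2)[OF D] star(2)[OF E] unfolding dl_def by simp
  then show "rw D i \<le> rw E i"
    unfolding star_row_high[OF i] using mnat_axioms(1)[of "rw D i"] by (auto split: if_splits)
qed

text \<open>Rows 1 and 2 of the modified diagram are equal, so row 2 of \<open>E\<close> already
  bounds row 1, and row 1 of \<open>E\<close> is at least as long.\<close>

lemma star_ler:
  assumes D: "Mdiagram D" and E: "Mdiagram E" and le: "ler (star c D) E"
  shows "dl (star c D) E"
  unfolding dl_def
proof (intro allI impI)
  fix i :: mnat assume i: "0 < i"
  show "rw (star c D) i \<le> rw E i"
  proof (cases "i = 1")
    case True
    have 2: "1 < (1::mnat) + 1" by (simp add: mnat_less_Suc)
    have "rw (star c D) 1 = rw (star c D) (1 + 1)"
      using star(2)[OF D] star_row_low[of 1] star_row_low[of "1 + 1"] mnat_zero_less_Suc[of 1] by simp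
    also have "\<dots> \<le> rw E (1 + 1)" using le 2 unfolding ler_def by blast
    also have "\<dots> \<le> rw E 1" by (rule rw_antimono[OF E]) simp_all
    finally show ?thesis using True by simp
  next
    case False
    then show ?thesis using le i mnat_pos_one[of i] unfolding ler_def by simp
  qed
qed

lemma star_diff_ascending:
  assumes d: "\<And>i. Mdiagram (d i)" and bad: "\<And>i j. i < j \<Longrightarrow> \<not> dl (d i) (d j)" and "i < j"
  shows "\<not> dl (star i (d i)) (star j (d j))"
  using star_dl d bad \<open>i < j\<close> by blast

section \<open>The two cycles of implications\<close>

subsection \<open>The implications\<close>

lemma WPO_imp_no_ascending: assumes MWPO shows Mno_ascending
  unfolding Mno_ascending_def
proof
  assume "\<exists>X\<in>Sets. Mascending X \<and> (\<forall>i. 0 < i \<longrightarrow> Mclosed_class (Msection_class X i))"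
  then obtain X where X: "X \<in> Sets" and asc: "Mascending X"
    and cl: "\<And>i. 0 < i \<Longrightarrow> Mclosed_class (Msection_class X i)" by blast
  have up: "pr j n \<in> X" if "0 < i" "i \<le> j" "pr i n \<in> X" for i j n
  proof (cases "i = j")
    case False
    then have "i < j" using that(2) by simp
    then show ?thesis
      using asc that unfolding Mascending_def Mclass_less_def Mclass_le_def Msection_class_def by blast
  qed (use that in simp)
  have new: "\<exists>n. pr (i + 1 + 1) n \<in> X \<and> pr (i + 1) n \<notin> X" for i
  proof -
    have "0 < i + 1 \<and> i + 1 < i + 1 + 1" using mnat_zero_less_Suc mnat_less_Suc_self by blast
    then show ?thesis
      using asc unfolding Mascending_def Mclass_less_def Mclass_le_def Msection_class_def by blast
  qed
  \<comment> \<open>Sections are indexed from 1 and the sequence from 0, hence the shift: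
    \<open>d i\<close> enters between the sections \<open>i + 1\<close> and
    \<open>i + 2\<close>.\<close>
  define d where "d i = (LEAST n. pr (i + 1 + 1) n \<in> X \<and> pr (i + 1) n \<notin> X)" for i
  have "fn (\<lambda>e. d (e 0))"
    unfolding d_def by (rule fn_Least) (intro dec_intros X fn_pr, rule new)
  moreover have "dec (\<lambda>e. pr (i + 1 + 1) (e 0) \<in> X \<and> pr (i + 1) (e 0) \<notin> X)" for i
    by (intro dec_intros X fn_pr)
  then have d: "pr (i + 1 + 1) (d i) \<in> X \<and> pr (i + 1) (d i) \<notin> X" for i
    unfolding d_def using new Least_dec(1)[of "\<lambda>n. pr (i + 1 + 1) n \<in> X \<and> pr (i + 1) n \<notin> X"] by blast
  have "Mdiagram (d i)" for i
    using closed_diagram[OF cl[of "i + 1 + 1"]] d mnat_zero_less_Suc unfolding Msection_class_def by blast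
  ultimately obtain i j where ij: "i < j" "dl (d i) (d j)" using assms unfolding MWPO_iff by blast
  \<comment> \<open>As \<open>d i\<close> lies below \<open>d j\<close>, the latter belongs to
    section \<open>i + 2\<close>. That section is contained in section \<open>j + 1\<close>, from
    which \<open>d j\<close> was chosen to be absent.\<close>
  have "pr (i + 1 + 1) (d j) \<in> X"
    using closed_up[OF cl[of "i + 1 + 1"] _ \<open>\<And>i. Mdiagram (d i)\<close> ij(2)] d mnat_zero_less_Suc
    unfolding Msection_class_def by blast
  moreover have "i + 1 + 1 \<le> j + 1" using ij(1) unfolding emb by linarith
  ultimately have "pr (j + 1) (d j) \<in> X" using up mnat_zero_less_Suc by blast
  then show False using d by blast
qed

lemma no_ascending_imp_fg: "Mno_ascending \<Longrightarrow> Mno_ascending_fg"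
  unfolding Mno_ascending_def Mno_ascending_fg_def by blast

text \<open>Collects what the two refutations need from a modified bad sequence: that
  \<open>ler\<close> implies \<open>dl\<close> gives closed upward closures, and the long first rows
  bound the indices of the terms below a diagram.\<close>

definition bad_stars :: "(mnat \<Rightarrow> mnat) \<Rightarrow> bool" where
  "bad_stars s \<longleftrightarrow> fn (\<lambda>e. s (e 0)) \<and> (\<forall>i. Mdiagram (s i)) \<and> (\<forall>i j. i < j \<longrightarrow> \<not> dl (s i) (s j)) \<and>
     (\<forall>i E. Mdiagram E \<longrightarrow> ler (s i) E \<longrightarrow> dl (s i) E) \<and> (\<forall>i. i < rw (s i) 1)"

lemma bad_starsD:
  assumes "bad_stars s"
  shows "fn (\<lambda>e. s (e 0))" "Mdiagram (s i)" "i < j \<Longrightarrow> \<not> dl (s i) (s j)"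
    "Mdiagram E \<Longrightarrow> ler (s i) E \<Longrightarrow> dl (s i) E" "i < rw (s i) 1"
  using assms unfolding bad_stars_def by blast+

lemma bad_stars_exist:
  assumes "\<not> MWPO"
  shows "\<exists>s. bad_stars s"
proof -
  obtain d where d: "fn (\<lambda>e. d (e 0))" "\<And>i. Mdiagram (d i)" "\<And>i j. i < j \<Longrightarrow> \<not> dl (d i) (d j)"
    using assms unfolding MWPO_iff by blast
  have "bad_stars (\<lambda>i. star i (d i))"
    unfolding bad_stars_def
    using fn_star[OF d(1,2)] star(1)[OF d(2)] star_diff_ascending[of d, OF d(2,3)]
      star_ler[OF d(2)] star_above[OF d(2)] by blast
  then show ?thesis by (rule exI[of _ "\<lambda>i. star i (d i)"])
qed

lemma no_ascending_fg_imp_WPO: assumes Mno_ascending_fg shows MWPO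
proof (rule ccontr)
  assume "\<not> MWPO"
  then obtain s where "bad_stars s" using bad_stars_exist by blast
  note s = bad_starsD[OF this]
  have fns: "fn f \<Longrightarrow> fn (\<lambda>e. s (f e))" for f using fn_app1 s(1) by blast
  define V where "V n E \<longleftrightarrow> Mdiagram E \<and> (\<exists>i. i < n \<and> dl (s i) E)" for n E
  define X where "X = {p. \<exists>n. n < p + 1 \<and> (\<exists>E. E < p + 1 \<and> p = pr n E \<and> V n E)}"
  have "X \<in> Sets"
    unfolding X_def V_def by (rule set_exists) (intro dec_intros fn_pr fns dec_Mdiagram dec_dl)
  have X: "Msection_class X n = V n" for n
    unfolding Msection_class_def X_def mem_Collect_eq mnat_less_Suc using pr_ge by auto
  have "Mascending X"
    unfolding Mascending_def X Mclass_less_def Mclass_le_def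
  proof (intro allI impI conjI)
    fix i j n :: mnat assume "0 < i \<and> i < j" "V i n"
    then show "V j n" unfolding V_def using less_trans by blast
  next
    fix i j :: mnat assume ij: "0 < i \<and> i < j"
    \<comment> \<open>The term \<open>s i\<close> separates the two classes: by badness no earlier
      term lies below it.\<close>
    have "V j (s i)" "\<not> V i (s i)" unfolding V_def using s(2,3) dl_refl ij by blast+
    then show "\<not> (\<forall>n. V j n \<longrightarrow> V i n)" by blast
  qed
  moreover have "Mclosed_class (V n)" for n
  proof -
    have "Mclosed_class (\<lambda>E. Mdiagram E \<and> (\<exists>D. (\<exists>i. i < n \<and> D = s i) \<and> dl D E))"
      by (rule closed_ucl) (use s(4) in blast)
    moreover have "(\<lambda>E. Mdiagram E \<and> (\<exists>D. (\<exists>i. i < n \<and> D = s i) \<and> dl D E)) = V n"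
      unfolding V_def by (intro ext) blast
    ultimately show ?thesis by simp
  qed
  moreover have "Mfinitely_generated (V n)" for n
    unfolding Mfinitely_generated_def
  proof (intro bexI conjI)
    let ?S = "{D. \<exists>i. i < n \<and> D = s i}"
    show "?S \<in> Sets" by (rule set_exists) (intro dec_intros fns)
    obtain z where "\<forall>i. i < n \<longrightarrow> s i < z" using fn_bounded[OF s(1)] by blast
    then show "Mfinite_set ?S" unfolding Mfinite_set_def by blast
    show "Mclass_le (Mset_class ?S) Mdiagram" unfolding Mclass_le_def Mset_class_def using s(2) by blast
    show "Mclass_eq (V n) (Mcl ?S)"
      unfolding Mclass_eq_def
    proof
      fix E
      have "Mcl ?S E \<longleftrightarrow> Mdiagram E \<and> (\<exists>D\<in>?S. \<exists>D'\<in>?S. ler D E \<and> lec D' E)"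
        by (rule Mcl_iff) (use s(2) in blast)
      \<comment> \<open>For these terms \<open>ler\<close> already implies \<open>dl\<close>, so
        \<open>cl\<close> adds nothing to the upward closure.\<close>
      also have "\<dots> \<longleftrightarrow> V n E" unfolding V_def using s(4) dl_ler dl_lec by blast
      finally show "V n E \<longleftrightarrow> Mcl ?S E" by blast
    qed
  qed
  ultimately have "\<exists>X\<in>Sets. Mascending X \<and>
     (\<forall>i. 0 < i \<longrightarrow> Mclosed_class (Msection_class X i) \<and> Mfinitely_generated (Msection_class X i))"
    using \<open>X \<in> Sets\<close> unfolding X[symmetric] by blast
  then show False using assms unfolding Mno_ascending_fg_def by blast
qed

lemma closed_sets_fg_imp_WPO: assumes Mclosed_sets_fg shows MWPO
proof (rule ccontr)
  assume "\<not> MWPO"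
  then obtain s where "bad_stars s" using bad_stars_exist by blast
  note s = bad_starsD[OF this]
  have fns: "fn f \<Longrightarrow> fn (\<lambda>e. s (f e))" for f using fn_app1 s(1) by blast
  \<comment> \<open>The bound on \<open>i\<close> makes membership decidable and excludes nothing,
    since \<open>dl (s i) E\<close> gives \<open>i < rw (s i) 1 \<le> rw E 1\<close>.\<close>
  define X where "X = {E. Mdiagram E \<and> (\<exists>i. i < rw E 1 \<and> dl (s i) E)}"
  have "X \<in> Sets"
    unfolding X_def by (rule set_exists) (intro dec_intros fn_rw fns dec_Mdiagram dec_dl)
  have index: "i < rw E 1" if "dl (s i) E" for i E
    using s(5)[of i] that less_le_trans[of i "rw (s i) 1" "rw E 1"] unfolding dl_def by simp
  have X: "Mset_class X = (\<lambda>E. Mdiagram E \<and> (\<exists>D. (\<exists>i. D = s i) \<and> dl D E))"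
    unfolding Mset_class_def X_def using index by (intro ext) auto
  have "Mclosed_class (Mset_class X)" unfolding X by (rule closed_ucl) (use s(4) in blast)
  then have "Mfinitely_generated (Mset_class X)" using assms \<open>X \<in> Sets\<close> unfolding Mclosed_sets_fg_def by blast
  then obtain S where S: "Mfinite_set S" "Mclass_le (Mset_class S) Mdiagram" "Mclass_eq (Mset_class X) (Mcl S)"
    unfolding Mfinitely_generated_def by blast
  have Sd: "D \<in> S \<Longrightarrow> Mdiagram D" for D using S(2) unfolding Mclass_le_def Mset_class_def by blast
  have XS: "(\<exists>i. dl (s i) E) \<longleftrightarrow> (\<exists>D\<in>S. \<exists>D'\<in>S. ler D E \<and> lec D' E)" if "Mdiagram E" for E
    using S(3) Mcl_iff[of S E, OF Sd] that unfolding Mclass_eq_def X by blast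
  obtain b where b: "\<And>D. D \<in> S \<Longrightarrow> D < b" using S(1) unfolding Mfinite_set_def by blast
  \<comment> \<open>The index \<open>b\<close> exceeds the codes of all generators. A generator
    \<open>D\<close> with \<open>ler D (s b)\<close> lies above some \<open>s i\<close>, where
    \<open>i < rw D 1 \<le> D < b\<close>. Then \<open>ler (s i) (s b)\<close>, hence
    \<open>dl (s i) (s b)\<close>, which contradicts badness.\<close>
  obtain D where D: "D \<in> S" "ler D (s b)" using XS[OF s(2)] dl_refl by blast
  obtain i where i: "dl (s i) D" using XS[OF Sd[OF D(1)]] D(1) dl_ler[OF dl_refl] dl_lec[OF dl_refl] by blast
  have "i < b" using index[OF i] rw_le[of D 1] b[OF D(1)] by simp
  moreover have "dl (s i) (s b)" using s(4)[OF s(2) ler_trans[OF dl_ler[OF i] D(2)]] .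
  ultimately show False using s(3) by blast
qed

lemma closed_sequences_fg_imp_sets: assumes Mclosed_sequences_fg shows Mclosed_sets_fg
  unfolding Mclosed_sets_fg_def
proof (intro ballI impI)
  fix X assume X: "X \<in> Sets" "Mclosed_class (Mset_class X)"
  show "Mfinitely_generated (Mset_class X)"
  proof (cases "X = {}")
    \<comment> \<open>The empty set is not the range of a sequence; it is generated by the empty
      set.\<close>
    case True
    have "{} \<in> Sets" using set_exists[of "\<lambda>_. False"] dec_const by simp
    then show ?thesis
      unfolding Mfinitely_generated_def Mfinite_set_def Mclass_le_def Mclass_eq_def Mset_class_def
      using Mcl_iff[of "{}"] by (intro bexI[of _ "{}"]) (simp_all add: True)
  next
    case False
    then obtain D0 where D0: "D0 \<in> X" by blast
    \<comment> \<open>Each member is listed at the position of its own code and \<open>D0\<close>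
      elsewhere, which avoids an increasing enumeration.\<close>
    define d where "d i = (if i \<in> X then i else D0)" for i
    have "fn (\<lambda>e. d (e 0))" unfolding d_def by (intro fn_if dec_intros X)
    moreover have dX: "d i \<in> X" for i using D0 unfolding d_def by simp
    then have "Mdiagram (d i)" for i using closed_diagram[OF X(2)] unfolding Mset_class_def by blast
    ultimately obtain Y where Y: "Y \<in> Sets" "Mdiagram_sequence Y" "\<And>i D. pr (i + 1) D \<in> Y \<longleftrightarrow> D = d i"
      using fn_sequence[of d] by blast
    have "Mrange_class Y = Mset_class X"
    proof
      fix D
      have "(\<exists>i. D = d i) \<longleftrightarrow> D \<in> X" using dX unfolding d_def by (metis (full_types))
      then show "Mrange_class Y D = Mset_class X D"
        unfolding range_iff[of Y d, OF Y(2,3)] Mset_class_def .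
    qed
    then show ?thesis using assms Y X(2) unfolding Mclosed_sequences_fg_def by metis
  qed
qed

text \<open>If the terms outside the closure of their predecessors occur up to arbitrarily large
  indices, take at stage \<open>n\<close> the next one, with index \<open>j \<ge> n\<close>. A new first row whose length
  decreases by 1 as \<open>n\<close> grows towards \<open>j\<close> makes repetitions of the same term incomparable in the
  required direction, so no enumeration of the indices is needed.\<close>

lemma WPO_imp_closed_sequences_fg: assumes MWPO shows Mclosed_sequences_fg
  unfolding Mclosed_sequences_fg_def
proof (intro ballI impI, elim conjE)
  fix X assume X: "X \<in> Sets" "Mdiagram_sequence X" and cl: "Mclosed_class (Mrange_class X)"
  obtain d where d: "fn (\<lambda>e. d (e 0))" "\<And>i. Mdiagram (d i)" "\<And>i D. pr (i + 1) D \<in> X \<longleftrightarrow> D = d i"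
    using sequence_fn[OF X] by blast
  have fnd: "fn f \<Longrightarrow> fn (\<lambda>e. d (f e))" for f using fn_app1 d(1) by blast
  have U: "Mrange_class X D \<longleftrightarrow> (\<exists>i. D = d i)" for D using range_iff[of X d, OF X(2) d(3)] .
  define new where "new j \<longleftrightarrow> (\<forall>a. a < j \<longrightarrow> (\<forall>b. b < j \<longrightarrow> \<not> (ler (d a) (d j) \<and> lec (d b) (d j))))" for j
  have dec_new: "fn f \<Longrightarrow> dec (\<lambda>e. new (f e))" for f
    by (rule dec_app1[of new]) (unfold new_def, intro dec_intros dec_ler dec_lec fnd)
  show "Mfinitely_generated (Mrange_class X)"
  proof (cases "\<exists>b. \<forall>j. new j \<longrightarrow> j < b")
    case True
    then obtain b where b: "\<And>j. new j \<Longrightarrow> j < b" by blast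
    define S where "S = {D. \<exists>i. i < b \<and> D = d i}"
    have S: "S \<in> Sets" unfolding S_def by (rule set_exists) (intro dec_intros fnd)
    have Sd: "D \<in> S \<Longrightarrow> Mdiagram D" for D unfolding S_def using d(2) by blast
    \<comment> \<open>Strong induction: a term that is not new lies, in the sense of
      \<open>ler\<close> and \<open>lec\<close>, above earlier terms, and both relations are
      transitive.\<close>
    have gen: "\<exists>a. a < b \<and> (\<exists>a'. a' < b \<and> ler (d a) (d j) \<and> lec (d a') (d j))" for j
    proof (rule mnat_less_induct[of "\<lambda>j. \<exists>a. a < b \<and> (\<exists>a'. a' < b \<and> ler (d a) (d j) \<and> lec (d a') (d j))"])
      show "dec (\<lambda>e. \<exists>a. a < b \<and> (\<exists>a'. a' < b \<and> ler (d a) (d (e 0)) \<and> lec (d a') (d (e 0))))"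
        by (intro dec_intros dec_ler dec_lec fnd)
      fix j assume IH: "\<And>y. y < j \<Longrightarrow> \<exists>a. a < b \<and> (\<exists>a'. a' < b \<and> ler (d a) (d y) \<and> lec (d a') (d y))"
      show "\<exists>a. a < b \<and> (\<exists>a'. a' < b \<and> ler (d a) (d j) \<and> lec (d a') (d j))"
      proof (cases "new j")
        case True
        then show ?thesis using b dl_ler[OF dl_refl] dl_lec[OF dl_refl] by blast
      next
        case False
        then obtain a a' where "a < j" "a' < j" "ler (d a) (d j)" "lec (d a') (d j)" unfolding new_def by blast
        then show ?thesis using IH[of a] IH[of a'] ler_trans lec_trans by blast
      qed
    qed
    have "Mrange_class X E \<longleftrightarrow> Mcl S E" for E
    proof
      assume "Mrange_class X E"
      then obtain j where "E = d j" using U by blast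
      then show "Mcl S E" using gen[of j] d(2) Mcl_iff[of S E, OF Sd] unfolding S_def by blast
    next
      assume "Mcl S E"
      then obtain D D' where E: "Mdiagram E" "D \<in> S" "D' \<in> S" "ler D E" "lec D' E"
        using Mcl_iff[of S E, OF Sd] by blast
      \<comment> \<open>The range of the sequence is only Sigma01, which is all that
        \<open>closed_generates\<close> requires.\<close>
      have "sig (\<lambda>e. Mrange_class X (e 0))" unfolding U by (intro sig_ex dec_sig dec_intros fnd)
      moreover have "Mrange_class X D" "Mrange_class X D'" using E(2,3) unfolding U S_def by blast+
      ultimately show "Mrange_class X E" using closed_generates[OF cl] E by blast
    qed
    moreover obtain z where "\<forall>i. i < b \<longrightarrow> d i < z" using fn_bounded[OF d(1)] by blast
    then have "Mfinite_set S" unfolding Mfinite_set_def S_def by blast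
    ultimately show ?thesis
      unfolding Mfinitely_generated_def Mclass_eq_def Mclass_le_def Mset_class_def using S Sd by blast
  next
    case False
    then have ex: "\<exists>j. n \<le> j \<and> new j" for n by (meson not_less)
    define J where "J n = (LEAST j. n \<le> j \<and> new j)" for n
    have "fn (\<lambda>e. J (e 0))"
      unfolding J_def by (rule fn_Least) (intro dec_intros dec_new, rule ex)
    then have fnJ: "fn f \<Longrightarrow> fn (\<lambda>e. J (f e))" for f by (rule fn_app1)
    have "dec (\<lambda>e. n \<le> e 0 \<and> new (e 0))" for n by (intro dec_intros dec_new)
    then have J: "n \<le> J n" "new (J n)" "n \<le> j \<Longrightarrow> new j \<Longrightarrow> J n \<le> j" for n j
      using Least_dec[of "\<lambda>j. n \<le> j \<and> new j"] ex[of n] unfolding J_def by blast+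
    \<comment> \<open>Starting from the old first row keeps the rows weakly decreasing, and the
      distance \<open>J n - n\<close> drops strictly as long as \<open>J\<close> stays
      constant.\<close>
    define g where "g n i = (if i \<le> 1 then rw (d (J n)) 1 + (J n - n) else rw (d (J n)) (i - 1))" for n i
    define h where "h n = d (J n) + 1 + 1" for n
    have sh: "shape (g n) (h n)" for n
      unfolding shape_def
    proof (intro conjI allI impI)
      show "fn (\<lambda>e. g n (e 0))" unfolding g_def by (intro fn_if fn_rw dec_intros)
      show "0 < h n" unfolding h_def by (rule mnat_zero_less_Suc)
      have "\<not> d (J n) + 1 + 1 \<le> 1" unfolding emb using emb_nonneg[of "d (J n)"] by linarith
      moreover have "d (J n) + 1 + 1 - 1 = d (J n) + 1" by (rule add_diff_cancel_right')
      ultimately show "g n (h n) = 0" unfolding g_def h_def using rw_zero[of "d (J n)" "d (J n) + 1"] by simp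
      show "0 < g n 1" unfolding g_def
        using less_le_trans[OF rw_1_pos[OF d(2)], of "J n" "rw (d (J n)) 1 + (J n - n)"] by simp
      fix i j :: mnat assume i: "0 < i" "i \<le> j"
      show "g n j \<le> g n i"
      proof (cases "j \<le> 1")
        case True
        then show ?thesis using order.trans[OF i(2) True] unfolding g_def by simp
      next
        case False
        have "0 < j" using i by simp
        then obtain l where "j = l + 1" using mnat_pos_Suc by blast
        then have l: "j = l + 1" "0 < l" using False by (auto simp: mnat_pos_iff)
        show ?thesis
        proof (cases "i \<le> 1")
          case True
          have "rw (d (J n)) l \<le> rw (d (J n)) 1"
            using rw_antimono[OF d(2) zero_less_one] l(2) mnat_pos_one by blast
          then show ?thesis using False True l(1) unfolding g_def mnat_le_add_iff by (auto simp: add.assoc)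
        next
          case F: False
          obtain k where "i = k + 1" using mnat_pos_Suc[OF i(1)] by blast
          then have k: "i = k + 1" "0 < k" using F by (auto simp: mnat_pos_iff)
          have "rw (d (J n)) l \<le> rw (d (J n)) k" using rw_antimono[OF d(2) k(2)] i(2) k(1) l(1) by simp
          then show ?thesis using False F k(1) l(1) unfolding g_def by simp
        qed
      qed
    qed
    define E where "E n = mkd (g n) (h n)" for n
    have "fn (\<lambda>e. E (e 0))"
      unfolding E_def
    proof (rule fn_mkd[OF _ _ sh])
      show "fn (\<lambda>e. g (e 0) (e (Suc 0)))" unfolding g_def by (intro fn_if fn_rw dec_intros fnd fnJ)
      show "fn (\<lambda>e. h (e 0))" unfolding h_def by (intro fn_intros fnd fnJ)
    qed
    moreover have "Mdiagram (E n)" for n unfolding E_def by (rule mkd(1)[OF sh])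
    ultimately obtain n m where nm: "n < m" "dl (E n) (E m)" using assms unfolding MWPO_iff by blast
    then have le: "g n i \<le> g m i" if "0 < i" for i
      using mkd(2)[OF sh that] that unfolding E_def dl_def by metis
    have "n \<le> J m" using nm(1) J(1)[of m] by simp
    then have "J n \<le> J m" using J(3)[OF _ J(2)] by blast
    \<comment> \<open>If \<open>J\<close> has grown, the rows from 2 on compare two different terms
      and contradict \<open>new (J m)\<close>; if not, row 1 has become shorter.\<close>
    then consider "J n < J m" | "J n = J m" by (auto simp: le_less)
    then show ?thesis
    proof cases
      case 1
      have "rw (d (J n)) i \<le> rw (d (J m)) i" if "0 < i" for i
      proof -
        have "\<not> i + 1 \<le> 1" using that by (simp add: mnat_pos_iff)
        then show ?thesis using le[OF mnat_zero_less_Suc[of i]] unfolding g_def by simp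
      qed
      then have "dl (d (J n)) (d (J m))" unfolding dl_def by blast
      then show ?thesis using J(2)[of m] 1 dl_ler dl_lec unfolding new_def by blast
    next
      case 2
      obtain c where c: "m = n + c + 1" using nm(1) mnat_less_add_iff by blast
      obtain x where x: "J m = m + x" using J(1)[of m] mnat_le_add by blast
      have "J n = m + x" using 2 x by simp
      also have "\<dots> = n + (c + 1 + x)" unfolding c by (simp add: ac_simps)
      finally have "J n = n + (c + 1 + x)" .
      then have "J n - n = c + 1 + x" by (simp only: mnat_minus)
      moreover have "J m - m = x" unfolding x by (rule mnat_minus)
      moreover have "rw (d (J m)) 1 + (J n - n) \<le> rw (d (J m)) 1 + (J m - m)"
        using le[OF zero_less_one] 2 unfolding g_def by simp
      ultimately have "c + 1 + x \<le> x" by simp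
      then have False unfolding emb using emb_nonneg[of c] by linarith
      then show ?thesis ..
    qed
  qed
qed

lemma statements_agree: "Mno_ascending = MWPO" "Mno_ascending_fg = MWPO" "Mclosed_sets_fg = MWPO" "Mclosed_sequences_fg = MWPO"
  using WPO_imp_no_ascending no_ascending_imp_fg no_ascending_fg_imp_WPO closed_sets_fg_imp_WPO
    closed_sequences_fg_imp_sets WPO_imp_closed_sequences_fg by blast+

lemma sat_statement: "P \<in> statements \<Longrightarrow> sat mm e r (sentence P) = MWPO"
  unfolding statements_def using sat_statements statements_agree by auto

theorem theorem3p13:
  shows "\<forall>P \<in> {WPO_D, no_ascending_closed, no_ascending_fg_closed, closed_sets_fg, closed_sequences_fg}.
         \<forall>Q \<in> {WPO_D, no_ascending_closed, no_ascending_fg_closed, closed_sets_fg, closed_sequences_fg}.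
           RCA0 \<turnstile> Iff (sentence P) (sentence Q)"
proof (intro ballI)
  fix P Q
  assume "P \<in> {WPO_D, no_ascending_closed, no_ascending_fg_closed, closed_sets_fg, closed_sequences_fg}"
    "Q \<in> {WPO_D, no_ascending_closed, no_ascending_fg_closed, closed_sets_fg, closed_sequences_fg}"
  then have PQ: "P \<in> statements" "Q \<in> statements" unfolding statements_def by blast+
  show "RCA0 \<turnstile> Iff (sentence P) (sentence Q)"
  proof (rule equivalences_provable)
    show "Iff (sentence P) (sentence Q) \<in> equivalences" unfolding equivalences_def using PQ by blast
    show "sat mm e r A" if "A \<in> equivalences" for A e r
      using that sat_statement unfolding equivalences_def by auto
  qed
qed

end
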